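(* Suppose that assumptions (FS1), (FS2), (FS3), (SS1) and (VA1) (written out in the context) hold. Then $$E\left(\left[A^{-2}n_I\left\{\hat V_{HT,A}(\hat\tau_\rho)-V_1(\hat\tau_\rho)-V_2(\hat\tau_\rho)\right\}\right]^2\right)=O(n_I^{-1}),$$ $$E\left(\left[A^{-2}N_In_{II0}\left\{\hat V_B(\hat\tau_\rho)-V_3(\hat\tau_\rho)\right\}\right]^2\right)=O(n_I^{-1}).$$ If in addition assumption (VA2) holds, then $$E\left(\left[A^{-2}n_I\left\{\hat V_{HT}(\hat\tau_\rho)-V(\hat\tau_\rho)\right\}\right]^2\right)=O(n_I^{-1})\qquad\text{and}\qquad\frac{\hat V_{HT}(\hat\tau_\rho)}{V(\hat\tau_\rho)}\longrightarrow1\ \text{ in probability.}$$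
   Context: Setting. $\mathcal F\subset\mathbb R^d$ is a fixed bounded measurable set of Lebesgue measure $A>0$, and $\rho:\mathcal F\to\mathbb R$ is Lebesgue integrable, with $\tau_\rho=\int_{\mathcal F}\rho(x)\,dx$. We consider a sequence (index suppressed) of partitions of $\mathcal F$ into $N_I$ disjoint measurable sub-regions (primary sampling units, PSUs) forming $U_I=\{u_1,\dots,u_{N_I}\}$; $A_i$ is the measure of $u_i$. Asymptotics: $A$ is fixed, $N_I\to\infty$, the partition becomes increasingly fine (PSU diameters shrink to $0$), and $n_I\to\infty$. Constants in the assumptions do not depend on the position in the sequence; $O(\cdot)$ and limits are along this sequence. Sampling. First stage: a random sample $S_I\subset U_I$ of size $n_I$ is selected; $I_{Ii}$ is the indicator of $u_i\in S_I$, $\pi_{Ii}=E(I_{Ii})$, $\pi_{Iij}=E(I_{Ii}I_{Ij})$ (so $\pi_{Iii}=\pi_{Ii}$), $\Delta_{Iij}=\pi_{Iij}-\pi_{Ii}\pi_{Ij}$. Second stage: conditionally on $S_I$, for each $u_i\in S_I$ a sample $S_{IIi}$ of $n_{IIi}$ points is drawn independently from a probability density $f_{IIi}$ supported on $u_i$; the second-stage mechanism does not depend on the realization of $S_I$, and the samples $S_{IIi}$ are conditionally independent across PSUs given $S_I$. Put $\pi_{IIi}(x)=n_{IIi}f_{IIi}(x)$ and $n_{II0}=N_I^{-1}\sum_{i=1}^{N_I}n_{IIi}$. Estimator and variance. $\tau_{\rho i}=\int_{u_i}\rho(x)\,dx$, $\hat\tau_{\rho i}=\sum_{x\in S_{IIi}}\rho(x)/\pi_{IIi}(x)$,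 $\hat\tau_\rho=\sum_{u_i\in S_I}\hat\tau_{\rho i}/\pi_{Ii}$. $V(\hat\tau_\rho)=V_1(\hat\tau_\rho)+V_2(\hat\tau_\rho)+V_3(\hat\tau_\rho)$ with $$V_1(\hat\tau_\rho)=\sum_{u_i\in U_I}\sum_{u_j\in U_I}\Delta_{Iij}\frac{\tau_{\rho i}}{\pi_{Ii}}\frac{\tau_{\rho j}}{\pi_{Ij}},\quad V_2(\hat\tau_\rho)=\sum_{u_i\in U_I}\frac{1-\pi_{Ii}}{\pi_{Ii}}V_i,\quad V_3(\hat\tau_\rho)=\sum_{u_i\in U_I}V_i,$$ $$V_i=\int_{u_i}\pi_{IIi}(x)\left\{\frac{\rho(x)}{\pi_{IIi}(x)}-\frac{\tau_{\rho i}}{n_{IIi}}\right\}^2dx.$$ Horvitz–Thompson variance estimator: $\hat V_{HT}(\hat\tau_\rho)=\hat V_{HT,A}(\hat\tau_\rho)+\hat V_B(\hat\tau_\rho)$ with $$\hat V_{HT,A}(\hat\tau_\rho)=\sum_{u_i\in S_I}\sum_{u_j\in S_I}\frac{\Delta_{Iij}}{\pi_{Iij}}\frac{\hat\tau_{\rho i}}{\pi_{Ii}}\frac{\hat\tau_{\rho j}}{\pi_{Ij}},\quad \hat V_B(\hat\tau_\rho)=\sum_{u_i\in S_I}\frac{\hat V_i}{\pi_{Ii}},\quad \hat V_i=\frac{n_{IIi}}{n_{IIi}-1}\sum_{x\in S_{IIi}}\left\{\frac{\rho(x)}{\pi_{IIi}(x)}-\frac{\hat\tau_{\rho i}}{n_{IIi}}\right\}^2.$$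 Assumptions. (FS1) There exist constants $f_{I0}<1$ and $0<c_{I1}\le C_{I1}<\infty$ with $n_I/N_I\le f_{I0}$ and $c_{I1}\le (N_I/n_I)\pi_{Ii}\le C_{I1}$ for all $i$. (FS2) There exist constants $C_{I2},C_{I3},C_{I4}>0$ such that, the maxima being over distinct indices in $\{1,\dots,N_I\}$, $\Delta_{I2}=\max|E\{(I_{Ii}-\pi_{Ii})(I_{Ij}-\pi_{Ij})\}|\le C_{I2}N_I^{-2}n_I$, $\Delta_{I3}=\max|E\{(I_{Ii}-\pi_{Ii})(I_{Ij}-\pi_{Ij})(I_{Ii'}-\pi_{Ii'})\}|\le C_{I3}N_I^{-3}n_I^2$, $\Delta_{I4}=\max|E\{(I_{Ii}-\pi_{Ii})(I_{Ij}-\pi_{Ij})(I_{Ii'}-\pi_{Ii'})(I_{Ij'}-\pi_{Ij'})\}|\le C_{I4}N_I^{-4}n_I^2$. (FS3) There exists $c_{I2}>0$ such that $c_{I2}N_I^{-2}n_I^2\le\pi_{Iij}$ for all $i\ne j$. (SS1) There exist constants $0<\lambda_1\le\Lambda_1<\infty$, $0<\phi_1\le\Phi_1<\infty$, $0<c_1\le C_1<\infty$ such that for every PSU $u_i$: $\lambda_1n_{II0}\le n_{IIi}\le\Lambda_1n_{II0}$; $\phi_1A/N_I\le A_i\le\Phi_1A/N_I$; $c_1/A_i\le f_{IIi}(x)\le C_1/A_i$ for all $x\in u_i$; and $n_{IIi}\ge2$. (VA1) There exist constants $m_1,M_1$ such that $A^{-1}\int_{\mathcal F}\rho(x)^4dx\le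 M_1$ and $|A^{-1}\int_{\mathcal F}\rho(x)\,dx|\ge m_1>0$. (VA2) There exists a constant $m_2$ such that $n_IA^{-2}V_1(\hat\tau_\rho)\ge m_2>0$. *)

theory Defs
  imports "HOL-Probability.Probability" "HOL-Library.Landau_Symbols"
begin

text \<open>
  PSUs are numbered \<open>0, \<dots>, num_psu - 1\<close>, and a first-stage sample is a set of such indices.
  The second-stage sample in PSU \<open>i\<close> is the family \<open>pts2 i l\<close> with \<open>l < size2 i\<close>; it is only
  meaningful at outcomes \<open>\<omega>\<close> with \<open>i \<in> samp1 \<omega>\<close>. As the points have a density, they are almost
  surely distinct, so sums over the sample are written as sums over \<open>l\<close>.
\<close>

record ('w, 'a) design =
  prob_sp :: "'w measure"
  num_psu :: nat
  psu :: "nat \<Rightarrow> 'a set"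
  size1 :: nat
  samp1 :: "'w \<Rightarrow> nat set"
  size2 :: "nat \<Rightarrow> nat"
  dens2 :: "nat \<Rightarrow> 'a \<Rightarrow> real"
  pts2 :: "nat \<Rightarrow> nat \<Rightarrow> 'w \<Rightarrow> 'a"

definition psu_partition :: "'a::euclidean_space set \<Rightarrow> ('w, 'a) design \<Rightarrow> bool" where
  "psu_partition F d \<longleftrightarrow>
     (\<forall>i<num_psu d. psu d i \<in> sets lebesgue) \<and>
     disjoint_family_on (psu d) {..<num_psu d} \<and>
     (\<Union>i<num_psu d. psu d i) = F"

definition first_stage :: "('w, 'a) design \<Rightarrow> bool" where
  "first_stage d \<longleftrightarrow>
     samp1 d \<in> measurable (prob_sp d) (count_space (Pow {..<num_psu d})) \<and>
     (\<forall>\<omega>\<in>space (prob_sp d). card (samp1 d \<omega>) = size1 d)"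

definition density_on :: "'a::euclidean_space set \<Rightarrow> ('a \<Rightarrow> real) \<Rightarrow> bool" where
  "density_on U f \<longleftrightarrow>
     f \<in> borel_measurable lebesgue \<and> (\<forall>x. 0 \<le> f x) \<and> (\<forall>x. x \<notin> U \<longrightarrow> f x = 0) \<and>
     (\<integral>\<^sup>+x. ennreal (f x) \<partial>lebesgue) = 1"

text \<open>
  The conditional law given the event that the first-stage sample equals \<open>s\<close>. All points drawn in
  the PSUs of \<open>s\<close> are independent under it (within and across PSUs), and neither the number of
  points nor the densities depend on \<open>s\<close>.
\<close>

definition cond_prob_sp :: "('w, 'a) design \<Rightarrow> nat set \<Rightarrow> 'w measure" where
  "cond_prob_sp d s = uniform_measure (prob_sp d) {\<omega>\<in>space (prob_sp d). samp1 d \<omega> = s}"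

definition second_stage :: "('w, 'a::euclidean_space) design \<Rightarrow> bool" where
  "second_stage d \<longleftrightarrow>
     (\<forall>i<num_psu d. density_on (psu d i) (dens2 d i)) \<and>
     (\<forall>i<num_psu d. \<forall>l<size2 d i. pts2 d i l \<in> measurable (prob_sp d) lebesgue) \<and>
     (\<forall>\<omega>\<in>space (prob_sp d). \<forall>i\<in>samp1 d \<omega>. \<forall>l<size2 d i. pts2 d i l \<omega> \<in> psu d i) \<and>
     (\<forall>s. measure (prob_sp d) {\<omega>\<in>space (prob_sp d). samp1 d \<omega> = s} > 0 \<longrightarrow>
        prob_space.indep_vars (cond_prob_sp d s) (\<lambda>_. lebesgue) (\<lambda>(i, l). pts2 d i l)
          (SIGMA i:s. {..<size2 d i}) \<and>
        (\<forall>i\<in>s. \<forall>l<size2 d i.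
           distributed (cond_prob_sp d s) lebesgue (pts2 d i l) (\<lambda>x. ennreal (dens2 d i x))))"

definition two_stage_design :: "'a::euclidean_space set \<Rightarrow> ('w, 'a) design \<Rightarrow> bool" where
  "two_stage_design F d \<longleftrightarrow>
     prob_space (prob_sp d) \<and> psu_partition F d \<and> first_stage d \<and> second_stage d"

definition design_sequence ::
    "'a::euclidean_space set \<Rightarrow> (nat \<Rightarrow> ('w, 'a) design) \<Rightarrow> bool" where
  "design_sequence F D \<longleftrightarrow>
     (\<forall>k. two_stage_design F (D k)) \<and>
     filterlim (\<lambda>k. num_psu (D k)) at_top sequentially \<and>
     filterlim (\<lambda>k. size1 (D k)) at_top sequentially \<and>
     (\<lambda>k. MAX i\<in>{..<num_psu (D k)}. diameter (psu (D k) i)) \<longlonglongrightarrow> 0"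

definition incl :: "('w, 'a) design \<Rightarrow> nat \<Rightarrow> 'w \<Rightarrow> real" where
  "incl d i \<omega> = of_bool (i \<in> samp1 d \<omega>)"

definition pi1 :: "('w, 'a) design \<Rightarrow> nat \<Rightarrow> real" where
  "pi1 d i = (\<integral>\<omega>. incl d i \<omega> \<partial>prob_sp d)"

definition pi12 :: "('w, 'a) design \<Rightarrow> nat \<Rightarrow> nat \<Rightarrow> real" where
  "pi12 d i j = (\<integral>\<omega>. incl d i \<omega> * incl d j \<omega> \<partial>prob_sp d)"

definition Delta1 :: "('w, 'a) design \<Rightarrow> nat \<Rightarrow> nat \<Rightarrow> real" where
  "Delta1 d i j = pi12 d i j - pi1 d i * pi1 d j"

definition cincl :: "('w, 'a) design \<Rightarrow> nat \<Rightarrow> 'w \<Rightarrow> real" where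
  "cincl d i \<omega> = incl d i \<omega> - pi1 d i"

definition pi2 :: "('w, 'a) design \<Rightarrow> nat \<Rightarrow> 'a \<Rightarrow> real" where
  "pi2 d i x = real (size2 d i) * dens2 d i x"

definition mean_size2 :: "('w, 'a) design \<Rightarrow> real" where
  "mean_size2 d = (\<Sum>i<num_psu d. real (size2 d i)) / real (num_psu d)"

definition psu_total :: "('a::euclidean_space \<Rightarrow> real) \<Rightarrow> ('w, 'a) design \<Rightarrow> nat \<Rightarrow> real" where
  "psu_total \<rho> d i = (LINT x:psu d i|lebesgue. \<rho> x)"

definition psu_var :: "('a::euclidean_space \<Rightarrow> real) \<Rightarrow> ('w, 'a) design \<Rightarrow> nat \<Rightarrow> real" where
  "psu_var \<rho> d i =
     (LINT x:psu d i|lebesgue.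
        pi2 d i x * (\<rho> x / pi2 d i x - psu_total \<rho> d i / real (size2 d i))\<^sup>2)"

definition V1 :: "('a::euclidean_space \<Rightarrow> real) \<Rightarrow> ('w, 'a) design \<Rightarrow> real" where
  "V1 \<rho> d =
     (\<Sum>i<num_psu d. \<Sum>j<num_psu d.
        Delta1 d i j * (psu_total \<rho> d i / pi1 d i) * (psu_total \<rho> d j / pi1 d j))"

definition V2 :: "('a::euclidean_space \<Rightarrow> real) \<Rightarrow> ('w, 'a) design \<Rightarrow> real" where
  "V2 \<rho> d = (\<Sum>i<num_psu d. (1 - pi1 d i) / pi1 d i * psu_var \<rho> d i)"

definition V3 :: "('a::euclidean_space \<Rightarrow> real) \<Rightarrow> ('w, 'a) design \<Rightarrow> real" where
  "V3 \<rho> d = (\<Sum>i<num_psu d. psu_var \<rho> d i)"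

definition V_total :: "('a::euclidean_space \<Rightarrow> real) \<Rightarrow> ('w, 'a) design \<Rightarrow> real" where
  "V_total \<rho> d = V1 \<rho> d + V2 \<rho> d + V3 \<rho> d"

definition psu_total_hat :: "('a \<Rightarrow> real) \<Rightarrow> ('w, 'a) design \<Rightarrow> nat \<Rightarrow> 'w \<Rightarrow> real" where
  "psu_total_hat \<rho> d i \<omega> = (\<Sum>l<size2 d i. \<rho> (pts2 d i l \<omega>) / pi2 d i (pts2 d i l \<omega>))"

definition psu_var_hat :: "('a \<Rightarrow> real) \<Rightarrow> ('w, 'a) design \<Rightarrow> nat \<Rightarrow> 'w \<Rightarrow> real" where
  "psu_var_hat \<rho> d i \<omega> =
     real (size2 d i) / (real (size2 d i) - 1) *
     (\<Sum>l<size2 d i.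
        (\<rho> (pts2 d i l \<omega>) / pi2 d i (pts2 d i l \<omega>) - psu_total_hat \<rho> d i \<omega> / real (size2 d i))\<^sup>2)"

definition V_HT_A :: "('a \<Rightarrow> real) \<Rightarrow> ('w, 'a) design \<Rightarrow> 'w \<Rightarrow> real" where
  "V_HT_A \<rho> d \<omega> =
     (\<Sum>i\<in>samp1 d \<omega>. \<Sum>j\<in>samp1 d \<omega>.
        Delta1 d i j / pi12 d i j *
        (psu_total_hat \<rho> d i \<omega> / pi1 d i) * (psu_total_hat \<rho> d j \<omega> / pi1 d j))"

definition V_B :: "('a \<Rightarrow> real) \<Rightarrow> ('w, 'a) design \<Rightarrow> 'w \<Rightarrow> real" where
  "V_B \<rho> d \<omega> = (\<Sum>i\<in>samp1 d \<omega>. psu_var_hat \<rho> d i \<omega> / pi1 d i)"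

definition V_HT :: "('a \<Rightarrow> real) \<Rightarrow> ('w, 'a) design \<Rightarrow> 'w \<Rightarrow> real" where
  "V_HT \<rho> d \<omega> = V_HT_A \<rho> d \<omega> + V_B \<rho> d \<omega>"

definition FS1 :: "(nat \<Rightarrow> ('w, 'a) design) \<Rightarrow> bool" where
  "FS1 D \<longleftrightarrow>
     (\<exists>f0 c C. f0 < 1 \<and> 0 < c \<and> c \<le> C \<and>
       (\<forall>k. real (size1 (D k)) / real (num_psu (D k)) \<le> f0 \<and>
          (\<forall>i<num_psu (D k).
             c \<le> real (num_psu (D k)) / real (size1 (D k)) * pi1 (D k) i \<and>
             real (num_psu (D k)) / real (size1 (D k)) * pi1 (D k) i \<le> C)))"

text \<open>
  Bounds on maxima over distinct indices are stated for all tuples of distinct indices, so that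
  they are void when there are too few PSUs.
\<close>

definition FS2 :: "(nat \<Rightarrow> ('w, 'a) design) \<Rightarrow> bool" where
  "FS2 D \<longleftrightarrow>
     (\<exists>C2>0. \<exists>C3>0. \<exists>C4>0. \<forall>k.
       (\<forall>i<num_psu (D k). \<forall>j<num_psu (D k). distinct [i, j] \<longrightarrow>
          \<bar>\<integral>\<omega>. cincl (D k) i \<omega> * cincl (D k) j \<omega> \<partial>prob_sp (D k)\<bar>
            \<le> C2 * real (size1 (D k)) / real (num_psu (D k)) ^ 2) \<and>
       (\<forall>i<num_psu (D k). \<forall>j<num_psu (D k). \<forall>i'<num_psu (D k). distinct [i, j, i'] \<longrightarrow>
          \<bar>\<integral>\<omega>. cincl (D k) i \<omega> * cincl (D k) j \<omega> * cincl (D k) i' \<omega> \<partial>prob_sp (D k)\<bar>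
            \<le> C3 * real (size1 (D k)) ^ 2 / real (num_psu (D k)) ^ 3) \<and>
       (\<forall>i<num_psu (D k). \<forall>j<num_psu (D k). \<forall>i'<num_psu (D k). \<forall>j'<num_psu (D k).
          distinct [i, j, i', j'] \<longrightarrow>
          \<bar>\<integral>\<omega>. cincl (D k) i \<omega> * cincl (D k) j \<omega> * cincl (D k) i' \<omega> * cincl (D k) j' \<omega>
             \<partial>prob_sp (D k)\<bar>
            \<le> C4 * real (size1 (D k)) ^ 2 / real (num_psu (D k)) ^ 4))"

definition FS3 :: "(nat \<Rightarrow> ('w, 'a) design) \<Rightarrow> bool" where
  "FS3 D \<longleftrightarrow>
     (\<exists>c>0. \<forall>k. \<forall>i<num_psu (D k). \<forall>j<num_psu (D k). i \<noteq> j \<longrightarrow>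
        c * real (size1 (D k)) ^ 2 / real (num_psu (D k)) ^ 2 \<le> pi12 (D k) i j)"

definition SS1 :: "'a::euclidean_space set \<Rightarrow> (nat \<Rightarrow> ('w, 'a) design) \<Rightarrow> bool" where
  "SS1 F D \<longleftrightarrow>
     (\<exists>l1 L1 p1 P1 c1 C1. 0 < l1 \<and> l1 \<le> L1 \<and> 0 < p1 \<and> p1 \<le> P1 \<and> 0 < c1 \<and> c1 \<le> C1 \<and>
       (\<forall>k. \<forall>i<num_psu (D k).
          l1 * mean_size2 (D k) \<le> real (size2 (D k) i) \<and>
          real (size2 (D k) i) \<le> L1 * mean_size2 (D k) \<and>
          p1 * measure lebesgue F / real (num_psu (D k)) \<le> measure lebesgue (psu (D k) i) \<and>
          measure lebesgue (psu (D k) i) \<le> P1 * measure lebesgue F / real (num_psu (D k)) \<and>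
          (\<forall>x\<in>psu (D k) i.
             c1 / measure lebesgue (psu (D k) i) \<le> dens2 (D k) i x \<and>
             dens2 (D k) i x \<le> C1 / measure lebesgue (psu (D k) i)) \<and>
          2 \<le> size2 (D k) i))"

text \<open>
  Integrability of the fourth power has to be required separately, because the integral of a
  non-integrable function is 0.
\<close>

definition VA1 :: "'a::euclidean_space set \<Rightarrow> ('a \<Rightarrow> real) \<Rightarrow> bool" where
  "VA1 F \<rho> \<longleftrightarrow>
     set_integrable lebesgue F (\<lambda>x. \<rho> x ^ 4) \<and>
     (\<exists>m1 M1. (LINT x:F|lebesgue. \<rho> x ^ 4) / measure lebesgue F \<le> M1 \<and>
        \<bar>(LINT x:F|lebesgue. \<rho> x) / measure lebesgue F\<bar> \<ge> m1 \<and> m1 > 0)"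

definition VA2 ::
    "'a::euclidean_space set \<Rightarrow> ('a \<Rightarrow> real) \<Rightarrow> (nat \<Rightarrow> ('w, 'a) design) \<Rightarrow> bool" where
  "VA2 F \<rho> D \<longleftrightarrow>
     (\<exists>m2>0. \<forall>k. real (size1 (D k)) * V1 \<rho> (D k) / (measure lebesgue F)\<^sup>2 \<ge> m2)"

text \<open>
  The random variables \<open>Z k\<close> may live on different probability spaces. Integrability of the square
  is included because the integral of a non-integrable function is 0.
\<close>

definition mean_square_bigo ::
    "(nat \<Rightarrow> 'w measure) \<Rightarrow> (nat \<Rightarrow> 'w \<Rightarrow> real) \<Rightarrow> (nat \<Rightarrow> real) \<Rightarrow> bool" where
  "mean_square_bigo M Z g \<longleftrightarrow>
     (\<forall>k. integrable (M k) (\<lambda>\<omega>. (Z k \<omega>)\<^sup>2)) \<and>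
     (\<lambda>k. \<integral>\<omega>. (Z k \<omega>)\<^sup>2 \<partial>M k) \<in> O(g)"

definition tendsto_in_prob ::
    "(nat \<Rightarrow> 'w measure) \<Rightarrow> (nat \<Rightarrow> 'w \<Rightarrow> real) \<Rightarrow> real \<Rightarrow> bool" where
  "tendsto_in_prob M Z c \<longleftrightarrow>
     (\<forall>k. Z k \<in> borel_measurable (M k)) \<and>
     (\<forall>\<epsilon>>0. (\<lambda>k. measure (M k) {\<omega>\<in>space (M k). \<bar>Z k \<omega> - c\<bar> > \<epsilon>}) \<longlonglongrightarrow> 0)"

end

theory Submission
  imports Defs
begin

text \<open>
  Conditionally on the first-stage sample the estimated PSU totals \<open>Y\<^sub>i\<close> are independent, with moments that do
  not depend on the sample, so every moment of \<open>I\<^sub>i Y\<^sub>i I\<^sub>j Y\<^sub>j \<cdots>\<close> is an inclusion probability times a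
  product of second-stage moments. In particular \<open>V_HT_A\<close> and \<open>V_B\<close> are unbiased for \<open>V1 + V2\<close> and
  \<open>V3\<close>. For the variance of the double sum \<open>V_HT_A\<close> the diagonal is treated separately, and the
  covariance of the terms \<open>(i, j)\<close> and \<open>(k, l)\<close> off the diagonal is bounded according to the overlap of the
  two pairs. Disjoint pairs contribute a covariance of inclusion indicators, which (FS2) makes of order
  \<open>n\<^sup>3 / N\<^sup>4\<close>; overlapping pairs are bounded crudely by \<open>n\<^sup>3 / N\<^sup>3\<close> and \<open>n\<^sup>2 / N\<^sup>2\<close> but are fewer.
  The second-stage moments enter through \<open>\<mu>\<^sub>i\<close>, the fourth root of the integral of \<open>\<rho>\<^sup>4 / f\<^sup>3\<close> over the PSU: by
  (SS1) and (VA1) the sum of \<open>\<mu>\<^sub>i\<^sup>4\<close> is \<open>O(N\<^sup>-\<^sup>3)\<close>, hence by Cauchy-Schwarz the sums of \<open>\<mu>\<^sub>i\<^sup>2\<close> and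
  \<open>\<mu>\<^sub>i\<close> are \<open>O(1 / N)\<close> and \<open>O(1)\<close>. The ratio statement is Chebyshev's inequality.
\<close>

section \<open>Random sets\<close>

text \<open>After normalisation by n a mean square error of order 1 / n is wanted, so the variance
  of \<open>V_HT_A\<close> must be of order 1 / n^3, for any ratio of n to N that (FS1) allows. The
  weights \<open>wt i j\<close> are of order N^2 / n^2 on the diagonal but N^2 / n^3 off it, because
  there (FS2) makes the numerator small while (FS3) keeps the joint inclusion probability of order
  n^2 / N^2. This gap is one reason for the split. The other is the moment budget: (VA1) controls
  moments up to the fourth. Off the diagonal, a covariance of two pairs contains each index at most
  twice, so first and second moments of single PSU totals suffice; the diagonal is a linear sum in
  the squares of the totals and spends the fourth moment there. The covariance between the two
  parts, which would bring in third powers, is never computed, since (x + y)^2 is at most 2 x^2 + 2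
  y^2.\<close>

text \<open>Bounds on the covariances take the place of their values, and the index type is
  arbitrary: the lemma serves sums over PSUs as well as sums over ordered pairs of PSUs.\<close>

lemma (in prob_space) second_moment_centered_sum:
  fixes X :: "'j \<Rightarrow> 'a \<Rightarrow> real"
  assumes J: "finite J"
    and int1: "\<And>j. j \<in> J \<Longrightarrow> integrable M (X j)"
    and int2: "\<And>j k. j \<in> J \<Longrightarrow> k \<in> J \<Longrightarrow> integrable M (\<lambda>\<omega>. X j \<omega> * X k \<omega>)"
    and mean: "\<And>j. j \<in> J \<Longrightarrow> expectation (X j) = m j"
    and cov: "\<And>j k. j \<in> J \<Longrightarrow> k \<in> J \<Longrightarrow>
      \<bar>expectation (\<lambda>\<omega>. X j \<omega> * X k \<omega>) - m j * m k\<bar> \<le> C j k"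
  shows "integrable M (\<lambda>\<omega>. ((\<Sum>j\<in>J. a j * X j \<omega>) - (\<Sum>j\<in>J. a j * m j))\<^sup>2)"
    and "expectation (\<lambda>\<omega>. ((\<Sum>j\<in>J. a j * X j \<omega>) - (\<Sum>j\<in>J. a j * m j))\<^sup>2)
      \<le> (\<Sum>j\<in>J. \<Sum>k\<in>J. \<bar>a j\<bar> * \<bar>a k\<bar> * C j k)"
proof -
  have eq: "((\<Sum>j\<in>J. a j * X j \<omega>) - (\<Sum>j\<in>J. a j * m j))\<^sup>2 =
    (\<Sum>j\<in>J. \<Sum>k\<in>J. a j * a k * (X j \<omega> * X k \<omega> - m k * X j \<omega> - m j * X k \<omega> + m j * m k))" for \<omega>
  proof -
    have "((\<Sum>j\<in>J. a j * X j \<omega>) - (\<Sum>j\<in>J. a j * m j))\<^sup>2 =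
      (\<Sum>j\<in>J. a j * (X j \<omega> - m j)) * (\<Sum>k\<in>J. a k * (X k \<omega> - m k))"
      by (simp add: power2_eq_square right_diff_distrib sum_subtractf)
    also have "\<dots> = (\<Sum>j\<in>J. \<Sum>k\<in>J. a j * (X j \<omega> - m j) * (a k * (X k \<omega> - m k)))"
      by (simp add: sum_product)
    finally show ?thesis by (simp add: algebra_simps)
  qed
  have int: "integrable M (\<lambda>\<omega>. a j * a k * (X j \<omega> * X k \<omega> - m k * X j \<omega> - m j * X k \<omega> + m j * m k))"
    if "j \<in> J" "k \<in> J" for j k
    using int1 int2 that by (intro integrable_mult_right Bochner_Integration.integrable_add
        Bochner_Integration.integrable_diff integrable_const) auto
  then show "integrable M (\<lambda>\<omega>. ((\<Sum>j\<in>J. a j * X j \<omega>) - (\<Sum>j\<in>J. a j * m j))\<^sup>2)"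
    unfolding eq by (intro Bochner_Integration.integrable_sum) auto
  have cov': "expectation (\<lambda>\<omega>. a j * a k * (X j \<omega> * X k \<omega> - m k * X j \<omega> - m j * X k \<omega> + m j * m k))
      \<le> \<bar>a j\<bar> * \<bar>a k\<bar> * C j k" if "j \<in> J" "k \<in> J" for j k
  proof -
    have "expectation (\<lambda>\<omega>. a j * a k * (X j \<omega> * X k \<omega> - m k * X j \<omega> - m j * X k \<omega> + m j * m k))
      = a j * a k * (expectation (\<lambda>\<omega>. X j \<omega> * X k \<omega>) - m j * m k)"
      using int1 int2 mean that by (simp add: prob_space algebra_simps)
    also have "\<dots> \<le> \<bar>a j * a k * (expectation (\<lambda>\<omega>. X j \<omega> * X k \<omega>) - m j * m k)\<bar>" by simp
    also have "\<dots> \<le> \<bar>a j\<bar> * \<bar>a k\<bar> * C j k"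
      unfolding abs_mult using cov[OF that] by (intro mult_left_mono) auto
    finally show ?thesis .
  qed
  have "expectation (\<lambda>\<omega>. ((\<Sum>j\<in>J. a j * X j \<omega>) - (\<Sum>j\<in>J. a j * m j))\<^sup>2)
    = (\<Sum>j\<in>J. \<Sum>k\<in>J. expectation (\<lambda>\<omega>. a j * a k * (X j \<omega> * X k \<omega> - m k * X j \<omega> - m j * X k \<omega> + m j * m k)))"
    \<comment> \<open>The scalar rules are removed so that each summand keeps the form for which
      integrability was shown.\<close>
    unfolding eq using int by (simp add: Bochner_Integration.integral_sum Bochner_Integration.integrable_sum
        del: integral_mult_right_zero integral_mult_right)
  also have "\<dots> \<le> (\<Sum>j\<in>J. \<Sum>k\<in>J. \<bar>a j\<bar> * \<bar>a k\<bar> * C j k)"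
    using cov' by (intro sum_mono) auto
  finally show "expectation (\<lambda>\<omega>. ((\<Sum>j\<in>J. a j * X j \<omega>) - (\<Sum>j\<in>J. a j * m j))\<^sup>2)
      \<le> (\<Sum>j\<in>J. \<Sum>k\<in>J. \<bar>a j\<bar> * \<bar>a k\<bar> * C j k)" .
qed

text \<open>Nonnegativity of the variance. Applied to a square and then to the variable itself, it
  takes integrability from fourth powers down to second and first powers.\<close>

lemma (in prob_space) square_integral_le:
  fixes X :: "'a \<Rightarrow> real"
  assumes [measurable]: "X \<in> borel_measurable M" and "integrable M (\<lambda>\<omega>. (X \<omega>)\<^sup>2)"
  shows "integrable M X" "(expectation X)\<^sup>2 \<le> expectation (\<lambda>\<omega>. (X \<omega>)\<^sup>2)"
proof -
  show "integrable M X" using square_integrable_imp_integrable[OF assms] .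
  then show "(expectation X)\<^sup>2 \<le> expectation (\<lambda>\<omega>. (X \<omega>)\<^sup>2)"
    using variance_eq[of X] assms variance_positive[of X] by simp
qed

section \<open>Conditioning on the value of a finite random set\<close>

locale finite_random_set = prob_space M for M :: "'w measure" +
  fixes S :: "'w \<Rightarrow> 'i set" and U :: "'i set"
  assumes finite_U: "finite U"
    and S_meas: "S \<in> measurable M (count_space (Pow U))"
begin

definition ev :: "'i set \<Rightarrow> 'w set" where
  "ev s = {\<omega> \<in> space M. S \<omega> = s}"

definition cond :: "'i set \<Rightarrow> 'w measure" where
  "cond s = uniform_measure M (ev s)"

definition I :: "'i \<Rightarrow> 'w \<Rightarrow> real" where
  "I i \<omega> = of_bool (i \<in> S \<omega>)"

text \<open>Joint inclusion probability. Indexing by a set makes \<open>P {i, i}\<close> collapse to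
  \<open>P {i}\<close>, which is the convention for the diagonal of the second-order
  probabilities.\<close>

definition P :: "'i set \<Rightarrow> real" where
  "P T = expectation (\<lambda>\<omega>. of_bool (T \<subseteq> S \<omega>))"

lemma S_subset: "\<omega> \<in> space M \<Longrightarrow> S \<omega> \<subseteq> U"
  using measurable_space[OF S_meas] by auto

lemma fun_S_measurable: "(\<lambda>\<omega>. g (S \<omega>) :: real) \<in> borel_measurable M"
proof -
  have "g \<in> borel_measurable (count_space (Pow U))" by simp
  then show ?thesis using measurable_compose[OF S_meas] by blast
qed

lemma I_measurable [measurable]: "I i \<in> borel_measurable M"
  unfolding I_def[abs_def] by (rule fun_S_measurable)

lemma ev_sets [measurable]: "ev s \<in> sets M"
proof (cases "s \<subseteq> U")
  case True
  then have "S -` {s} \<inter> space M \<in> sets M" by (intro measurable_sets[OF S_meas]) auto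
  moreover have "S -` {s} \<inter> space M = ev s" by (auto simp: ev_def)
  ultimately show ?thesis by simp
next
  case False
  then have "ev s = {}" using S_subset by (auto simp: ev_def)
  then show ?thesis by simp
qed

lemma prob_space_cond: "0 < prob (ev s) \<Longrightarrow> prob_space (cond s)"
  unfolding cond_def by (rule prob_space_uniform_measure) (auto simp: emeasure_eq_measure)

lemma sets_cond [simp, measurable_cong]: "sets (cond s) = sets M"
  by (simp add: cond_def)

lemma space_cond [simp]: "space (cond s) = space M"
  by (simp add: cond_def)

lemma AE_cond: "AE \<omega> in cond s. \<omega> \<in> ev s"
  unfolding cond_def by (rule AE_uniform_measureI) auto

text \<open>A real-valued density makes \<open>integral_real_density\<close> applicable, which turns
  integrals over \<open>cond s\<close> into integrals over \<open>M\<close>.\<close>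

lemma cond_density:
  assumes "0 < prob (ev s)"
  shows "cond s = density M (\<lambda>\<omega>. ennreal (indicator (ev s) \<omega> / prob (ev s)))"
  unfolding cond_def uniform_measure_def
  using assms by (intro arg_cong2[where f = density] refl ext)
    (auto simp: emeasure_eq_measure divide_ennreal[of 1, simplified] split: split_indicator)

text \<open>Law of total expectation. As \<open>S\<close> takes finitely many values,
  \<open>X\<close> is the finite sum of its restrictions to the events \<open>ev s\<close>, and each
  restriction is handled separately.\<close>

lemma
  fixes X :: "'w \<Rightarrow> real"
  assumes X [measurable]: "X \<in> borel_measurable M"
    and int: "\<And>s. s \<subseteq> U \<Longrightarrow> 0 < prob (ev s) \<Longrightarrow> integrable (cond s) X"
  shows total_integrable: "integrable M X"
    and total_expectation: "expectation X = (\<Sum>s\<in>Pow U. prob (ev s) * integral\<^sup>L (cond s) X)"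
proof -
  have decomp: "X \<omega> = (\<Sum>s\<in>Pow U. indicator (ev s) \<omega> * X \<omega>)" if "\<omega> \<in> space M" for \<omega>
  proof -
    have "(\<Sum>s\<in>Pow U. indicator (ev s) \<omega> * X \<omega>) = (\<Sum>s\<in>Pow U. if S \<omega> = s then X \<omega> else 0)"
      using that by (intro sum.cong) (auto simp: ev_def)
    also have "\<dots> = X \<omega>" using S_subset[OF that] finite_U by (subst sum.delta') auto
    finally show ?thesis by simp
  qed
  have part: "integrable M (\<lambda>\<omega>. indicator (ev s) \<omega> * X \<omega>) \<and>
    expectation (\<lambda>\<omega>. indicator (ev s) \<omega> * X \<omega>) = prob (ev s) * integral\<^sup>L (cond s) X"
    if "s \<subseteq> U" for s
  proof (cases "0 < prob (ev s)")
    case True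
    have c: "integrable M (\<lambda>\<omega>. indicator (ev s) \<omega> / prob (ev s) * X \<omega>)"
      using int[OF that True] unfolding cond_density[OF True]
      by (subst (asm) integrable_real_density) auto
    have c2: "integral\<^sup>L (cond s) X = expectation (\<lambda>\<omega>. indicator (ev s) \<omega> / prob (ev s) * X \<omega>)"
      unfolding cond_density[OF True] by (subst integral_real_density) auto
    have c3: "indicator (ev s) \<omega> * X \<omega> = prob (ev s) * (indicator (ev s) \<omega> / prob (ev s) * X \<omega>)" for \<omega>
      using True by simp
    show ?thesis unfolding c2 using c
      by (subst (1 2) c3) (simp only: integrable_mult_right integral_mult_right_zero simp_thms)
  next
    case False
    \<comment> \<open>Nothing is known about \<open>cond s\<close> here. The term vanishes through
      the factor \<open>prob (ev s)\<close>, and the restricted variable is zero almost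
      everywhere.\<close>
    then have "prob (ev s) = 0" by (simp add: zero_less_measure_iff)
    then have "AE \<omega> in M. indicator (ev s) \<omega> * X \<omega> = 0"
      using prob_eq_0[OF ev_sets] by (auto split: split_indicator)
    moreover have [measurable]: "(\<lambda>\<omega>. indicator (ev s) \<omega> * X \<omega>) \<in> borel_measurable M" by simp
    ultimately show ?thesis
      using \<open>prob (ev s) = 0\<close> integrable_cong_AE[of "\<lambda>\<omega>. indicator (ev s) \<omega> * X \<omega>" M "\<lambda>_. 0"]
        integral_cong_AE[of "\<lambda>\<omega>. indicator (ev s) \<omega> * X \<omega>" M "\<lambda>_. 0"] by simp
  qed
  have "integrable M (\<lambda>\<omega>. \<Sum>s\<in>Pow U. indicator (ev s) \<omega> * X \<omega>)"
    using part by (intro Bochner_Integration.integrable_sum) auto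
  then show "integrable M X"
    using decomp by (subst Bochner_Integration.integrable_cong[OF refl]) auto
  have "expectation X = expectation (\<lambda>\<omega>. \<Sum>s\<in>Pow U. indicator (ev s) \<omega> * X \<omega>)"
    using decomp by (intro Bochner_Integration.integral_cong) auto
  also have "\<dots> = (\<Sum>s\<in>Pow U. prob (ev s) * integral\<^sup>L (cond s) X)"
    using part by (subst Bochner_Integration.integral_sum) auto
  finally show "expectation X = (\<Sum>s\<in>Pow U. prob (ev s) * integral\<^sup>L (cond s) X)" .
qed

lemma fun_S_cond_AE: "AE \<omega> in cond s. g (S \<omega>) = g s"
  using AE_cond[of s] by eventually_elim (simp add: ev_def)

lemma P_eq_sum: "P T = (\<Sum>s\<in>Pow U. prob (ev s) * of_bool (T \<subseteq> s))"
proof -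
  have ae: "AE \<omega> in cond s. (of_bool (T \<subseteq> S \<omega>) :: real) = of_bool (T \<subseteq> s)" for s
    by (rule fun_S_cond_AE)
  have meas: "(\<lambda>\<omega>. of_bool (T \<subseteq> S \<omega>) :: real) \<in> borel_measurable M" by (rule fun_S_measurable)
  have eq: "integral\<^sup>L (cond s) (\<lambda>\<omega>. of_bool (T \<subseteq> S \<omega>) :: real) = of_bool (T \<subseteq> s)"
    if "0 < prob (ev s)" for s
  proof -
    interpret c: prob_space "cond s" using prob_space_cond[OF that] .
    have "integral\<^sup>L (cond s) (\<lambda>\<omega>. of_bool (T \<subseteq> S \<omega>) :: real) = integral\<^sup>L (cond s) (\<lambda>_. of_bool (T \<subseteq> s))"
      using ae meas by (intro integral_cong_AE) auto
    then show ?thesis using c.prob_space by simp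
  qed
  have "P T = (\<Sum>s\<in>Pow U. prob (ev s) * integral\<^sup>L (cond s) (\<lambda>\<omega>. of_bool (T \<subseteq> S \<omega>) :: real))"
    unfolding P_def
  proof (rule total_expectation[OF meas])
    fix s assume "0 < prob (ev s)"
    then interpret c: prob_space "cond s" by (rule prob_space_cond)
    show "integrable (cond s) (\<lambda>\<omega>. of_bool (T \<subseteq> S \<omega>) :: real)"
      using meas by (intro c.integrable_const_bound[where B = 1]) auto
  qed
  also have "\<dots> = (\<Sum>s\<in>Pow U. prob (ev s) * of_bool (T \<subseteq> s))"
    using eq by (intro sum.cong refl) (metis measure_nonneg mult_zero_left order_less_le)
  finally show ?thesis .
qed

lemma P_nonneg: "0 \<le> P T"
  unfolding P_def by simp

text \<open>The indicator vanishes on samples that do not contain T, so independence and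
  integrability are asked only for those that do. There the conditional mean of the product
  factorises, with a value that is the same for all such samples, and their probabilities add up to
  \<open>P T\<close> by \<open>P_eq_sum\<close>.\<close>

lemma
  fixes H :: "'i \<Rightarrow> 'w \<Rightarrow> real"
  assumes T: "T \<subseteq> U"
    and meas: "\<And>i. i \<in> T \<Longrightarrow> H i \<in> borel_measurable M"
    and indep: "\<And>s. T \<subseteq> s \<Longrightarrow> s \<subseteq> U \<Longrightarrow> 0 < prob (ev s) \<Longrightarrow>
      prob_space.indep_vars (cond s) (\<lambda>_. borel) H T"
    and int: "\<And>s i. T \<subseteq> s \<Longrightarrow> s \<subseteq> U \<Longrightarrow> 0 < prob (ev s) \<Longrightarrow> i \<in> T \<Longrightarrow> integrable (cond s) (H i)"
  shows prod_integrable: "integrable M (\<lambda>\<omega>. of_bool (T \<subseteq> S \<omega>) * (\<Prod>i\<in>T. H i \<omega>))"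
    and prod_expectation: "(\<And>s i. T \<subseteq> s \<Longrightarrow> s \<subseteq> U \<Longrightarrow> 0 < prob (ev s) \<Longrightarrow> i \<in> T \<Longrightarrow>
        integral\<^sup>L (cond s) (H i) = e i) \<Longrightarrow>
      expectation (\<lambda>\<omega>. of_bool (T \<subseteq> S \<omega>) * (\<Prod>i\<in>T. H i \<omega>)) = P T * (\<Prod>i\<in>T. e i)"
    and prod_expectation_le: "(\<And>s i. T \<subseteq> s \<Longrightarrow> s \<subseteq> U \<Longrightarrow> 0 < prob (ev s) \<Longrightarrow> i \<in> T \<Longrightarrow>
        \<bar>integral\<^sup>L (cond s) (H i)\<bar> \<le> e i) \<Longrightarrow>
      \<bar>expectation (\<lambda>\<omega>. of_bool (T \<subseteq> S \<omega>) * (\<Prod>i\<in>T. H i \<omega>))\<bar> \<le> P T * (\<Prod>i\<in>T. e i)"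
proof -
  let ?X = "\<lambda>\<omega>. of_bool (T \<subseteq> S \<omega>) * (\<Prod>i\<in>T. H i \<omega>)"
  have finT: "finite T" using T finite_U finite_subset by blast
  have meas1 [measurable]: "(\<lambda>\<omega>. of_bool (T \<subseteq> S \<omega>) :: real) \<in> borel_measurable M" by (rule fun_S_measurable)
  have meas2 [measurable]: "(\<lambda>\<omega>. \<Prod>i\<in>T. H i \<omega>) \<in> borel_measurable M" using meas by (intro borel_measurable_prod)
  have measX: "?X \<in> borel_measurable M" by measurable
  have c: "integrable (cond s) ?X \<and>
    integral\<^sup>L (cond s) ?X = of_bool (T \<subseteq> s) * (\<Prod>i\<in>T. integral\<^sup>L (cond s) (H i))"
    if s: "s \<subseteq> U" "0 < prob (ev s)" for s
  proof -
    interpret c: prob_space "cond s" using prob_space_cond[OF s(2)] .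
    have "AE \<omega> in cond s. (of_bool (T \<subseteq> S \<omega>) :: real) = of_bool (T \<subseteq> s)" by (rule fun_S_cond_AE)
    then have ae: "AE \<omega> in cond s. ?X \<omega> = of_bool (T \<subseteq> s) * (\<Prod>i\<in>T. H i \<omega>)"
      by eventually_elim simp
    have m: "?X \<in> borel_measurable (cond s)" "(\<lambda>\<omega>. of_bool (T \<subseteq> s) * (\<Prod>i\<in>T. H i \<omega>)) \<in> borel_measurable (cond s)"
      by measurable
    show ?thesis
      unfolding integrable_cong_AE[OF m ae] integral_cong_AE[OF m ae]
      using c.indep_vars_integrable[OF finT indep int] c.indep_vars_lebesgue_integral[OF finT indep int] s
      by (cases "T \<subseteq> s") auto
  qed
  show "integrable M ?X" using c by (intro total_integrable[OF measX]) auto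
  have tot: "expectation ?X = (\<Sum>s\<in>Pow U. prob (ev s) * integral\<^sup>L (cond s) ?X)"
    using c by (intro total_expectation[OF measX]) auto
  show "expectation ?X = P T * (\<Prod>i\<in>T. e i)"
    if e: "\<And>s i. T \<subseteq> s \<Longrightarrow> s \<subseteq> U \<Longrightarrow> 0 < prob (ev s) \<Longrightarrow> i \<in> T \<Longrightarrow> integral\<^sup>L (cond s) (H i) = e i"
  proof -
    have "prob (ev s) * integral\<^sup>L (cond s) ?X = prob (ev s) * of_bool (T \<subseteq> s) * (\<Prod>i\<in>T. e i)"
      if "s \<in> Pow U" for s
      using c[of s] e[of s] that by (cases "prob (ev s) = 0"; cases "T \<subseteq> s") (auto simp: zero_less_measure_iff)
    then show ?thesis unfolding tot P_eq_sum sum_distrib_right by (intro sum.cong refl)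
  qed
  show "\<bar>expectation ?X\<bar> \<le> P T * (\<Prod>i\<in>T. e i)"
    if e: "\<And>s i. T \<subseteq> s \<Longrightarrow> s \<subseteq> U \<Longrightarrow> 0 < prob (ev s) \<Longrightarrow> i \<in> T \<Longrightarrow> \<bar>integral\<^sup>L (cond s) (H i)\<bar> \<le> e i"
  proof -
    have "\<bar>prob (ev s) * integral\<^sup>L (cond s) ?X\<bar> \<le> prob (ev s) * of_bool (T \<subseteq> s) * (\<Prod>i\<in>T. e i)"
      if "s \<in> Pow U" for s
    proof (cases "prob (ev s) = 0 \<or> \<not> T \<subseteq> s")
      case True
      then show ?thesis using c[of s] that by (cases "prob (ev s) = 0") (auto simp: zero_less_measure_iff)
    next
      case False
      then have *: "s \<subseteq> U" "0 < prob (ev s)" "T \<subseteq> s" using that by (auto simp: zero_less_measure_iff)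
      have "\<bar>\<Prod>i\<in>T. integral\<^sup>L (cond s) (H i)\<bar> \<le> (\<Prod>i\<in>T. e i)"
        unfolding abs_prod using e[OF *(3,1,2)] by (intro prod_mono) auto
      then show ?thesis using c[OF *(1,2)] * by (simp add: abs_mult)
    qed
    then have "\<bar>expectation ?X\<bar> \<le> (\<Sum>s\<in>Pow U. prob (ev s) * of_bool (T \<subseteq> s) * (\<Prod>i\<in>T. e i))"
      unfolding tot by (intro order_trans[OF sum_abs] sum_mono)
    then show ?thesis unfolding P_eq_sum sum_distrib_right .
  qed
qed

end

section \<open>Inclusion probabilities in terms of centred moments\<close>

context finite_random_set
begin

definition cI :: "'i \<Rightarrow> 'w \<Rightarrow> real" where
  "cI i \<omega> = I i \<omega> - P {i}"

lemma cI_measurable [measurable]: "cI i \<in> borel_measurable M"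
  unfolding cI_def[abs_def] by measurable

lemma P_le_1: "P T \<le> 1"
  unfolding P_def by (rule integral_le_const) (auto intro!: integrable_const_bound[where B = 1] fun_S_measurable)

lemma cI_bounded: "\<bar>cI i \<omega>\<bar> \<le> 1"
  using P_nonneg[of "{i}"] P_le_1[of "{i}"] unfolding cI_def I_def by (auto simp: abs_if)

lemma integrable_cI: "integrable M (cI i)"
  by (rule integrable_const_bound[where B = 1]) (auto simp: cI_bounded)

text \<open>Iterating this rule makes products of centred indicators of any length
  integrable.\<close>

lemma integrable_mult_cI:
  assumes [measurable_dest]: "integrable M X" shows "integrable M (\<lambda>\<omega>. X \<omega> * cI i \<omega>)"
proof (rule Bochner_Integration.integrable_bound[OF assms])
  show "(\<lambda>\<omega>. X \<omega> * cI i \<omega>) \<in> borel_measurable M" using assms by measurable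
  show "AE \<omega> in M. norm (X \<omega> * cI i \<omega>) \<le> norm (X \<omega>)"
    using cI_bounded by (intro AE_I2) (simp add: abs_mult mult_left_le)
qed

lemma I_eq: "I i \<omega> = cI i \<omega> + P {i}"
  by (simp add: cI_def)

text \<open>Indicators are idempotent, so these identities and the expansions built on them hold for
  repeated indices too; the diagonal of \<open>pi12\<close> needs no separate case.\<close>

lemma of_bool_subset_2: "of_bool ({i, j} \<subseteq> S \<omega>) = I i \<omega> * I j \<omega>"
  and of_bool_subset_3: "of_bool ({i, j, k} \<subseteq> S \<omega>) = I i \<omega> * I j \<omega> * I k \<omega>"
  and of_bool_subset_4: "of_bool ({i, j, k, l} \<subseteq> S \<omega>) = I i \<omega> * I j \<omega> * I k \<omega> * I l \<omega>"
  by (auto simp: I_def)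

lemma P_single: "P {i} = expectation (I i)"
  by (simp add: P_def I_def[abs_def])

lemma expectation_cI: "expectation (cI i) = 0"
proof -
  have "integrable M (I i)"
    using integrable_cI[of i] unfolding I_eq[abs_def] by simp
  then show ?thesis unfolding cI_def[abs_def] by (simp add: P_single prob_space)
qed

lemma P_pair: "P {i, j} = expectation (\<lambda>\<omega>. cI i \<omega> * cI j \<omega>) + P {i} * P {j}"
proof -
  have "P {i, j} = expectation (\<lambda>\<omega>. cI i \<omega> * cI j \<omega> + P {j} * cI i \<omega> + P {i} * cI j \<omega> + P {i} * P {j})"
    unfolding P_def of_bool_subset_2 unfolding P_def[symmetric] I_eq by (simp add: algebra_simps)
  then show ?thesis
    using integrable_cI integrable_mult_cI[OF integrable_cI] by (simp add: expectation_cI prob_space)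
qed

lemma P_triple: "P {i, j, k} = expectation (\<lambda>\<omega>. cI i \<omega> * cI j \<omega> * cI k \<omega>)
    + P {i} * expectation (\<lambda>\<omega>. cI j \<omega> * cI k \<omega>)
    + P {j} * expectation (\<lambda>\<omega>. cI i \<omega> * cI k \<omega>)
    + P {k} * expectation (\<lambda>\<omega>. cI i \<omega> * cI j \<omega>) + P {i} * P {j} * P {k}"
proof -
  have "P {i, j, k} = expectation (\<lambda>\<omega>. cI i \<omega> * cI j \<omega> * cI k \<omega>
      + P {i} * (cI j \<omega> * cI k \<omega>) + P {j} * (cI i \<omega> * cI k \<omega>) + P {k} * (cI i \<omega> * cI j \<omega>)
      + P {j} * P {k} * cI i \<omega> + P {i} * P {k} * cI j \<omega> + P {i} * P {j} * cI k \<omega> + P {i} * P {j} * P {k})"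
    unfolding P_def of_bool_subset_3 unfolding P_def[symmetric] I_eq by (simp add: algebra_simps)
  then show ?thesis
    using integrable_cI integrable_mult_cI[OF integrable_cI]
      integrable_mult_cI[OF integrable_mult_cI[OF integrable_cI]]
    by (simp add: expectation_cI prob_space)
qed

text \<open>Expanding four factors \<open>cI + P\<close> and subtracting the product of two
  \<open>P_pair\<close> expansions cancels the product of all four first-order probabilities, of
  order n^4 / N^4, and the terms in which only one inner pair interacts. Each remaining term
  contains a centred moment that (FS2) controls.\<close>

lemma P_quadruple: "P {i, j, k, l} - P {i, j} * P {k, l} =
    expectation (\<lambda>\<omega>. cI i \<omega> * cI j \<omega> * cI k \<omega> * cI l \<omega>)
    + P {i} * expectation (\<lambda>\<omega>. cI j \<omega> * cI k \<omega> * cI l \<omega>)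
    + P {j} * expectation (\<lambda>\<omega>. cI i \<omega> * cI k \<omega> * cI l \<omega>)
    + P {k} * expectation (\<lambda>\<omega>. cI i \<omega> * cI j \<omega> * cI l \<omega>)
    + P {l} * expectation (\<lambda>\<omega>. cI i \<omega> * cI j \<omega> * cI k \<omega>)
    + P {j} * P {l} * expectation (\<lambda>\<omega>. cI i \<omega> * cI k \<omega>)
    + P {j} * P {k} * expectation (\<lambda>\<omega>. cI i \<omega> * cI l \<omega>)
    + P {i} * P {l} * expectation (\<lambda>\<omega>. cI j \<omega> * cI k \<omega>)
    + P {i} * P {k} * expectation (\<lambda>\<omega>. cI j \<omega> * cI l \<omega>)
    - expectation (\<lambda>\<omega>. cI i \<omega> * cI j \<omega>) * expectation (\<lambda>\<omega>. cI k \<omega> * cI l \<omega>)"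
proof -
  have prod4: "(x + a) * (y + b) * (z + c) * (w + d) = x * y * z * w + a * (y * z * w) + b * (x * z * w)
      + c * (x * y * w) + d * (x * y * z) + a * b * (z * w) + a * c * (y * w) + a * d * (y * z)
      + b * c * (x * w) + b * d * (x * z) + c * d * (x * y) + b * c * d * x + a * c * d * y
      + a * b * d * z + a * b * c * w + a * b * c * d" for a b c d x y z w :: real
    by algebra
  have h0: "has_bochner_integral M (\<lambda>_. c) c" for c :: real
    by (simp add: has_bochner_integral_iff prob_space)
  have h1: "has_bochner_integral M (cI h) 0" for h
    by (simp add: has_bochner_integral_iff integrable_cI expectation_cI)
  note h2 = has_bochner_integral_integrable[OF integrable_mult_cI[OF integrable_cI]]
  note h3 = has_bochner_integral_integrable[OF integrable_mult_cI[OF integrable_mult_cI[OF integrable_cI]]]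
  note h4 = has_bochner_integral_integrable[OF integrable_mult_cI[OF integrable_mult_cI[OF integrable_mult_cI[OF integrable_cI]]]]
  \<comment> \<open>\<open>has_bochner_integral\<close> carries integrability and value together, so
    the sixteen-term expansion is assembled by introduction rules. The four linear terms contribute
    the zeros.\<close>
  have hb: "has_bochner_integral M (\<lambda>\<omega>. I i \<omega> * I j \<omega> * I k \<omega> * I l \<omega>)
      (expectation (\<lambda>\<omega>. cI i \<omega> * cI j \<omega> * cI k \<omega> * cI l \<omega>)
      + P {i} * expectation (\<lambda>\<omega>. cI j \<omega> * cI k \<omega> * cI l \<omega>)
      + P {j} * expectation (\<lambda>\<omega>. cI i \<omega> * cI k \<omega> * cI l \<omega>)
      + P {k} * expectation (\<lambda>\<omega>. cI i \<omega> * cI j \<omega> * cI l \<omega>)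
      + P {l} * expectation (\<lambda>\<omega>. cI i \<omega> * cI j \<omega> * cI k \<omega>)
      + P {i} * P {j} * expectation (\<lambda>\<omega>. cI k \<omega> * cI l \<omega>)
      + P {i} * P {k} * expectation (\<lambda>\<omega>. cI j \<omega> * cI l \<omega>)
      + P {i} * P {l} * expectation (\<lambda>\<omega>. cI j \<omega> * cI k \<omega>)
      + P {j} * P {k} * expectation (\<lambda>\<omega>. cI i \<omega> * cI l \<omega>)
      + P {j} * P {l} * expectation (\<lambda>\<omega>. cI i \<omega> * cI k \<omega>)
      + P {k} * P {l} * expectation (\<lambda>\<omega>. cI i \<omega> * cI j \<omega>)
      + P {j} * P {k} * P {l} * 0 + P {i} * P {k} * P {l} * 0 + P {i} * P {j} * P {l} * 0
      + P {i} * P {j} * P {k} * 0 + P {i} * P {j} * P {k} * P {l})"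
    unfolding I_eq prod4
    by (intro has_bochner_integral_add has_bochner_integral_mult_right h4 h3 h2 h1 h0)
  have pair: "(ijkl + a * jkl + b * ikl + c * ijl + d * ijk + a * b * kl + a * c * jl + a * d * jk
      + b * c * il + b * d * ik + c * d * ij + b * c * d * 0 + a * c * d * 0 + a * b * d * 0 + a * b * c * 0
      + a * b * c * d) - (ij + a * b) * (kl + c * d) = ijkl + a * jkl + b * ikl + c * ijl + d * ijk
      + b * d * ik + b * c * il + a * d * jk + a * c * jl - ij * kl"
    for a b c d ijkl jkl ikl ijl ijk ij ik il jk jl kl :: real
    by algebra
  show ?thesis
    unfolding P_pair[of i j] P_pair[of k l] P_def[of "{i, j, k, l}"] of_bool_subset_4
      has_bochner_integral_integral_eq[OF hb] pair ..
qed

text \<open>The factor 3 counts the pairs among three indices. The factors 4 count the triples among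
  four indices and the pairs with one index from each side; the last square bounds the product of
  the two inner covariances.\<close>

lemma
  assumes p: "\<And>i. i \<in> U \<Longrightarrow> P {i} \<le> p"
    and d2: "\<And>i j. i \<in> U \<Longrightarrow> j \<in> U \<Longrightarrow> i \<noteq> j \<Longrightarrow> \<bar>expectation (\<lambda>\<omega>. cI i \<omega> * cI j \<omega>)\<bar> \<le> d2"
  shows P_pair_le: "i \<in> U \<Longrightarrow> j \<in> U \<Longrightarrow> i \<noteq> j \<Longrightarrow> P {i, j} \<le> p\<^sup>2 + d2"
    and P_triple_le: "(\<And>i j k. i \<in> U \<Longrightarrow> j \<in> U \<Longrightarrow> k \<in> U \<Longrightarrow> distinct [i, j, k] \<Longrightarrow>
          \<bar>expectation (\<lambda>\<omega>. cI i \<omega> * cI j \<omega> * cI k \<omega>)\<bar> \<le> d3) \<Longrightarrow>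
        i \<in> U \<Longrightarrow> j \<in> U \<Longrightarrow> k \<in> U \<Longrightarrow> distinct [i, j, k] \<Longrightarrow> P {i, j, k} \<le> p ^ 3 + 3 * p * d2 + d3"
    and P_quadruple_le: "(\<And>i j k. i \<in> U \<Longrightarrow> j \<in> U \<Longrightarrow> k \<in> U \<Longrightarrow> distinct [i, j, k] \<Longrightarrow>
          \<bar>expectation (\<lambda>\<omega>. cI i \<omega> * cI j \<omega> * cI k \<omega>)\<bar> \<le> d3) \<Longrightarrow>
        (\<And>i j k l. i \<in> U \<Longrightarrow> j \<in> U \<Longrightarrow> k \<in> U \<Longrightarrow> l \<in> U \<Longrightarrow> distinct [i, j, k, l] \<Longrightarrow>
          \<bar>expectation (\<lambda>\<omega>. cI i \<omega> * cI j \<omega> * cI k \<omega> * cI l \<omega>)\<bar> \<le> d4) \<Longrightarrow>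
        i \<in> U \<Longrightarrow> j \<in> U \<Longrightarrow> k \<in> U \<Longrightarrow> l \<in> U \<Longrightarrow> distinct [i, j, k, l] \<Longrightarrow>
        \<bar>P {i, j, k, l} - P {i, j} * P {k, l}\<bar> \<le> d4 + 4 * p * d3 + 4 * p\<^sup>2 * d2 + d2\<^sup>2"
proof -
  have pp: "P {i} * P {j} \<le> p\<^sup>2" "0 \<le> p" "\<bar>P {i} * P {j}\<bar> \<le> p\<^sup>2" if "i \<in> U" "j \<in> U" for i j
    using mult_mono[OF p[OF that(1)] p[OF that(2)] _ P_nonneg] p[OF that(1)] P_nonneg[of "{i}"] P_nonneg[of "{j}"]
    by (auto simp: power2_eq_square intro: order_trans)
  have mul: "\<bar>P {i} * x\<bar> \<le> p * y" if "i \<in> U" "\<bar>x\<bar> \<le> y" for i x y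
    unfolding abs_mult using that p[of i] P_nonneg[of "{i}"] by (intro mult_mono) auto
  have mul2: "\<bar>P {i} * P {j} * x\<bar> \<le> p\<^sup>2 * y" if "i \<in> U" "j \<in> U" "\<bar>x\<bar> \<le> y" for i j x y
    unfolding abs_mult[of _ x] using that pp[of i j] by (intro mult_mono) auto
  show "P {i, j} \<le> p\<^sup>2 + d2" if "i \<in> U" "j \<in> U" "i \<noteq> j"
    using pp(1)[OF that(1,2)] d2[OF that] unfolding P_pair by linarith
  show "P {i, j, k} \<le> p ^ 3 + 3 * p * d2 + d3"
    if d3: "\<And>i j k. i \<in> U \<Longrightarrow> j \<in> U \<Longrightarrow> k \<in> U \<Longrightarrow> distinct [i, j, k] \<Longrightarrow>
          \<bar>expectation (\<lambda>\<omega>. cI i \<omega> * cI j \<omega> * cI k \<omega>)\<bar> \<le> d3"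
      and U: "i \<in> U" "j \<in> U" "k \<in> U" and dist: "distinct [i, j, k]"
  proof -
    have "P {i} * P {j} * P {k} \<le> p ^ 3"
      using mult_mono[OF pp(1)[OF U(1,2)] p[OF U(3)]] P_nonneg[of "{k}"] by (simp add: power3_eq_cube power2_eq_square)
    moreover have "\<bar>P {i} * expectation (\<lambda>\<omega>. cI j \<omega> * cI k \<omega>)\<bar> \<le> p * d2"
      "\<bar>P {j} * expectation (\<lambda>\<omega>. cI i \<omega> * cI k \<omega>)\<bar> \<le> p * d2"
      "\<bar>P {k} * expectation (\<lambda>\<omega>. cI i \<omega> * cI j \<omega>)\<bar> \<le> p * d2"
      using U dist by (auto intro!: mul d2)
    ultimately show ?thesis using d3[OF U dist] unfolding P_triple[of i j k] by linarith
  qed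
  show "\<bar>P {i, j, k, l} - P {i, j} * P {k, l}\<bar> \<le> d4 + 4 * p * d3 + 4 * p\<^sup>2 * d2 + d2\<^sup>2"
    if d3: "\<And>i j k. i \<in> U \<Longrightarrow> j \<in> U \<Longrightarrow> k \<in> U \<Longrightarrow> distinct [i, j, k] \<Longrightarrow>
          \<bar>expectation (\<lambda>\<omega>. cI i \<omega> * cI j \<omega> * cI k \<omega>)\<bar> \<le> d3"
      and d4: "\<And>i j k l. i \<in> U \<Longrightarrow> j \<in> U \<Longrightarrow> k \<in> U \<Longrightarrow> l \<in> U \<Longrightarrow> distinct [i, j, k, l] \<Longrightarrow>
          \<bar>expectation (\<lambda>\<omega>. cI i \<omega> * cI j \<omega> * cI k \<omega> * cI l \<omega>)\<bar> \<le> d4"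
      and U: "i \<in> U" "j \<in> U" "k \<in> U" "l \<in> U" and dist: "distinct [i, j, k, l]"
  proof -
    have "\<bar>P {i} * expectation (\<lambda>\<omega>. cI j \<omega> * cI k \<omega> * cI l \<omega>)\<bar> \<le> p * d3"
      "\<bar>P {j} * expectation (\<lambda>\<omega>. cI i \<omega> * cI k \<omega> * cI l \<omega>)\<bar> \<le> p * d3"
      "\<bar>P {k} * expectation (\<lambda>\<omega>. cI i \<omega> * cI j \<omega> * cI l \<omega>)\<bar> \<le> p * d3"
      "\<bar>P {l} * expectation (\<lambda>\<omega>. cI i \<omega> * cI j \<omega> * cI k \<omega>)\<bar> \<le> p * d3"
      "\<bar>P {j} * P {l} * expectation (\<lambda>\<omega>. cI i \<omega> * cI k \<omega>)\<bar> \<le> p\<^sup>2 * d2"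
      "\<bar>P {j} * P {k} * expectation (\<lambda>\<omega>. cI i \<omega> * cI l \<omega>)\<bar> \<le> p\<^sup>2 * d2"
      "\<bar>P {i} * P {l} * expectation (\<lambda>\<omega>. cI j \<omega> * cI k \<omega>)\<bar> \<le> p\<^sup>2 * d2"
      "\<bar>P {i} * P {k} * expectation (\<lambda>\<omega>. cI j \<omega> * cI l \<omega>)\<bar> \<le> p\<^sup>2 * d2"
      using U dist by (auto intro!: mul mul2 d2 d3)
    moreover have "\<bar>expectation (\<lambda>\<omega>. cI i \<omega> * cI j \<omega>) * expectation (\<lambda>\<omega>. cI k \<omega> * cI l \<omega>)\<bar> \<le> d2\<^sup>2"
      unfolding abs_mult power2_eq_square using d2[of i j] d2[of k l] U dist by (intro mult_mono) auto
    moreover note d4[OF U dist]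
    ultimately show ?thesis unfolding P_quadruple[of i j k l] abs_le_iff by linarith
  qed
qed

end

section \<open>Sums of conditionally independent variables over a random set\<close>

text \<open>The means \<open>w\<close> are exact, as they enter the centring of the sums, while for
  second moments a bound is enough. Neither depends on s: this records that the second stage does
  not react to the realised first-stage sample. No moment or independence property of
  \<open>W i\<close> is assumed on samples that omit i.\<close>

locale cond_indep_variables = finite_random_set M S U
  for M :: "'w measure" and S :: "'w \<Rightarrow> 'i set" and U +
  fixes W :: "'i \<Rightarrow> 'w \<Rightarrow> real" and w v :: "'i \<Rightarrow> real"
  assumes W_meas: "i \<in> U \<Longrightarrow> W i \<in> borel_measurable M"
    and W_indep: "s \<subseteq> U \<Longrightarrow> 0 < prob (ev s) \<Longrightarrow> prob_space.indep_vars (cond s) (\<lambda>_. borel) W s"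
    and W_square_int: "s \<subseteq> U \<Longrightarrow> 0 < prob (ev s) \<Longrightarrow> i \<in> s \<Longrightarrow> integrable (cond s) (\<lambda>\<omega>. (W i \<omega>)\<^sup>2)"
    and W_mean: "s \<subseteq> U \<Longrightarrow> 0 < prob (ev s) \<Longrightarrow> i \<in> s \<Longrightarrow> integral\<^sup>L (cond s) (W i) = w i"
    and W_square: "s \<subseteq> U \<Longrightarrow> 0 < prob (ev s) \<Longrightarrow> i \<in> s \<Longrightarrow>
      integral\<^sup>L (cond s) (\<lambda>\<omega>. (W i \<omega>)\<^sup>2) \<le> v i"
begin

definition R :: "'i \<Rightarrow> 'w \<Rightarrow> real" where
  "R i \<omega> = I i \<omega> * W i \<omega>"

text \<open>The function \<open>f\<close> chooses exponent 1 or 2 for each index, so one statement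
  yields all mixed moments that occur below. A squared indicator is the indicator, so powers of
  \<open>R\<close> leave a single inclusion event for T. The equality is confined to exponent 1
  because second moments are only bounded.\<close>

lemma
  fixes f :: "'i \<Rightarrow> real \<Rightarrow> real"
  assumes T: "T \<subseteq> U" and f: "\<And>i. i \<in> T \<Longrightarrow> f i = (\<lambda>x. x) \<or> f i = (\<lambda>x. x\<^sup>2)"
  shows moment_integrable: "integrable M (\<lambda>\<omega>. of_bool (T \<subseteq> S \<omega>) * (\<Prod>i\<in>T. f i (W i \<omega>)))"
    and moment_eq: "(\<And>i. i \<in> T \<Longrightarrow> f i = (\<lambda>x. x)) \<Longrightarrow>
      expectation (\<lambda>\<omega>. of_bool (T \<subseteq> S \<omega>) * (\<Prod>i\<in>T. f i (W i \<omega>))) = P T * (\<Prod>i\<in>T. w i)"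
    and moment_le: "(\<And>i. i \<in> T \<Longrightarrow> (if f i = (\<lambda>x. x) then \<bar>w i\<bar> else v i) \<le> e i) \<Longrightarrow>
      \<bar>expectation (\<lambda>\<omega>. of_bool (T \<subseteq> S \<omega>) * (\<Prod>i\<in>T. f i (W i \<omega>)))\<bar> \<le> P T * (\<Prod>i\<in>T. e i)"
proof -
  have f_meas: "f i \<in> borel_measurable borel" if "i \<in> T" for i using f[OF that] by auto
  have meas: "(\<lambda>\<omega>. f i (W i \<omega>)) \<in> borel_measurable M" if "i \<in> T" for i
    using measurable_compose[OF W_meas f_meas, of i i] that T by auto
  have indep: "prob_space.indep_vars (cond s) (\<lambda>_. borel) (\<lambda>i \<omega>. f i (W i \<omega>)) T"
    if "T \<subseteq> s" "s \<subseteq> U" "0 < prob (ev s)" for s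
  proof -
    interpret c: prob_space "cond s" using prob_space_cond[OF that(3)] .
    show ?thesis
      using c.indep_vars_compose2[OF c.indep_vars_subset[OF W_indep[OF that(2,3)] that(1)] f_meas] .
  qed
  have int: "integrable (cond s) (\<lambda>\<omega>. f i (W i \<omega>))" "integrable (cond s) (W i)"
    if "T \<subseteq> s" "s \<subseteq> U" "0 < prob (ev s)" "i \<in> T" for s i
  proof -
    interpret c: prob_space "cond s" using prob_space_cond[OF that(3)] .
    have [measurable]: "W i \<in> borel_measurable M" using W_meas that T by auto
    have sq: "integrable (cond s) (\<lambda>\<omega>. (W i \<omega>)\<^sup>2)" using W_square_int that by auto
    then show "integrable (cond s) (W i)"
      by (rule c.square_integral_le(1)[rotated]) simp
    then show "integrable (cond s) (\<lambda>\<omega>. f i (W i \<omega>))" using f[OF that(4)] sq by auto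
  qed
  show "integrable M (\<lambda>\<omega>. of_bool (T \<subseteq> S \<omega>) * (\<Prod>i\<in>T. f i (W i \<omega>)))"
    by (rule prod_integrable[OF T meas indep int(1)])
  show "expectation (\<lambda>\<omega>. of_bool (T \<subseteq> S \<omega>) * (\<Prod>i\<in>T. f i (W i \<omega>))) = P T * (\<Prod>i\<in>T. w i)"
    if "\<And>i. i \<in> T \<Longrightarrow> f i = (\<lambda>x. x)"
    using W_mean that by (intro prod_expectation[OF T meas indep int(1)]) auto
  show "\<bar>expectation (\<lambda>\<omega>. of_bool (T \<subseteq> S \<omega>) * (\<Prod>i\<in>T. f i (W i \<omega>)))\<bar> \<le> P T * (\<Prod>i\<in>T. e i)"
    if e: "\<And>i. i \<in> T \<Longrightarrow> (if f i = (\<lambda>x. x) then \<bar>w i\<bar> else v i) \<le> e i"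
  proof (intro prod_expectation_le[OF T meas indep int(1)])
    fix s i assume s: "T \<subseteq> s" "s \<subseteq> U" "0 < prob (ev s)" "i \<in> T"
    then have "i \<in> s" by auto
    show "\<bar>\<integral>\<omega>. f i (W i \<omega>) \<partial>cond s\<bar> \<le> e i"
    proof (cases "f i = (\<lambda>x. x)")
      case True
      then show ?thesis using W_mean[OF s(2,3) \<open>i \<in> s\<close>] e[OF s(4)] by simp
    next
      case False
      then have "f i = (\<lambda>x. x\<^sup>2)" using f[OF s(4)] by simp
      then show ?thesis using W_square[OF s(2,3) \<open>i \<in> s\<close>] e[OF s(4)] False by simp
    qed
  qed
qed

text \<open>Settles the test on \<open>f i\<close> in \<open>moment_le\<close>.\<close>

lemma power2_fun_neq: "(\<lambda>x::real. x\<^sup>2) \<noteq> (\<lambda>x. x)"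
  by (auto dest!: fun_cong[where x = 2])

lemma I_square: "(I i \<omega>)\<^sup>2 = I i \<omega>"
  by (simp add: I_def)

lemma
  assumes "i \<in> U"
  shows R_integrable: "integrable M (R i)"
    and R_mean: "expectation (R i) = P {i} * w i"
    and R2_integrable: "integrable M (\<lambda>\<omega>. (R i \<omega>)\<^sup>2)"
    and R2_le: "expectation (\<lambda>\<omega>. (R i \<omega>)\<^sup>2) \<le> P {i} * v i"
  using moment_integrable[of "{i}" "\<lambda>_ x. x"] moment_eq[of "{i}" "\<lambda>_ x. x"]
    moment_integrable[of "{i}" "\<lambda>_ x. x\<^sup>2"] moment_le[of "{i}" "\<lambda>_ x. x\<^sup>2" v] assms
  by (simp_all add: R_def[abs_def] I_def power_mult_distrib I_square[unfolded I_def]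
      power2_fun_neq abs_le_iff)

lemma
  assumes "i \<in> U" "j \<in> U" "i \<noteq> j"
  shows RR_integrable: "integrable M (\<lambda>\<omega>. R i \<omega> * R j \<omega>)"
    and RR_mean: "expectation (\<lambda>\<omega>. R i \<omega> * R j \<omega>) = P {i, j} * w i * w j"
  using moment_integrable[of "{i, j}" "\<lambda>_ x. x"] moment_eq[of "{i, j}" "\<lambda>_ x. x"] assms
  by (simp_all add: R_def[abs_def] of_bool_subset_2[simplified] mult_ac del: of_bool_conj)

lemma
  assumes "i \<in> U" "j \<in> U" "i \<noteq> j"
  shows R2R2_integrable: "integrable M (\<lambda>\<omega>. (R i \<omega>)\<^sup>2 * (R j \<omega>)\<^sup>2)"
    and R2R2_le: "\<bar>expectation (\<lambda>\<omega>. (R i \<omega>)\<^sup>2 * (R j \<omega>)\<^sup>2)\<bar> \<le> P {i, j} * v i * v j"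
  using moment_integrable[of "{i, j}" "\<lambda>_ x. x\<^sup>2"] moment_le[of "{i, j}" "\<lambda>_ x. x\<^sup>2" v] assms
  by (simp_all add: R_def[abs_def] of_bool_subset_2[simplified] power_mult_distrib I_square
      power2_fun_neq mult_ac del: of_bool_conj)

lemma
  assumes "i \<in> U" "j \<in> U" "k \<in> U" "distinct [i, j, k]"
  shows R2RR_integrable: "integrable M (\<lambda>\<omega>. (R i \<omega>)\<^sup>2 * (R j \<omega> * R k \<omega>))"
    and R2RR_le: "\<bar>expectation (\<lambda>\<omega>. (R i \<omega>)\<^sup>2 * (R j \<omega> * R k \<omega>))\<bar> \<le> P {i, j, k} * v i * \<bar>w j\<bar> * \<bar>w k\<bar>"
proof -
  \<comment> \<open>Squares the index shared by the two pairs, here i, and leaves the other two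
    alone.\<close>
  let ?f = "\<lambda>h x. if h = i then x\<^sup>2 else x :: real"
  have f: "?f h = (\<lambda>x. x) \<or> ?f h = (\<lambda>x::real. x\<^sup>2)" for h by (cases "h = i") auto
  have ne: "j \<noteq> i" "k \<noteq> i" using assms(4) by auto
  have f': "?f i \<noteq> (\<lambda>x. x :: real)" using power2_fun_neq by simp
  have T: "{i, j, k} \<subseteq> U" using assms by auto
  show "integrable M (\<lambda>\<omega>. (R i \<omega>)\<^sup>2 * (R j \<omega> * R k \<omega>))"
    using moment_integrable[of "{i, j, k}" ?f, OF T f] assms(4) ne
    by (simp add: R_def[abs_def] of_bool_subset_3[simplified] power_mult_distrib I_square mult_ac del: of_bool_conj)
  have "(if ?f h = (\<lambda>x. x) then \<bar>w h\<bar> else v h) \<le> (if h = i then v h else \<bar>w h\<bar>)" for h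
    using f' by (cases "h = i") auto
  from moment_le[of "{i, j, k}" ?f, OF T f this]
  show "\<bar>expectation (\<lambda>\<omega>. (R i \<omega>)\<^sup>2 * (R j \<omega> * R k \<omega>))\<bar> \<le> P {i, j, k} * v i * \<bar>w j\<bar> * \<bar>w k\<bar>"
    using assms(4) ne
    by (simp add: R_def[abs_def] of_bool_subset_3[simplified] power_mult_distrib I_square mult_ac del: of_bool_conj)
qed

lemma
  assumes "i \<in> U" "j \<in> U" "k \<in> U" "l \<in> U" "distinct [i, j, k, l]"
  shows RRRR_integrable: "integrable M (\<lambda>\<omega>. R i \<omega> * R j \<omega> * (R k \<omega> * R l \<omega>))"
    and RRRR_mean: "expectation (\<lambda>\<omega>. R i \<omega> * R j \<omega> * (R k \<omega> * R l \<omega>)) = P {i, j, k, l} * (w i * w j * w k * w l)"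
  using moment_integrable[of "{i, j, k, l}" "\<lambda>_ x. x"] moment_eq[of "{i, j, k, l}" "\<lambda>_ x. x"] assms
  by (simp_all add: R_def[abs_def] of_bool_subset_4[simplified] mult_ac del: of_bool_conj)

end

section \<open>Variance bounds for weighted single and double sums\<close>

text \<open>The summands are nonnegative, so the sum may be extended from J to all quadruples, where
  it factorises. A single coincidence merges two factors into a square, in four ways; a double
  coincidence merges both pairs of factors, in two ways. The indicators are not exclusive: a double
  coincidence also occurs in the \<open>\<kappa>1\<close> terms, which is harmless for an upper
  bound.\<close>

lemma sum_offdiag_overlap_le:
  fixes \<mu> :: "'i \<Rightarrow> real"
  assumes U: "finite U" and \<mu>: "\<And>i. i \<in> U \<Longrightarrow> 0 \<le> \<mu> i"
    and nonneg: "0 \<le> \<kappa>0" "0 \<le> \<kappa>1" "0 \<le> \<kappa>2"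
  defines "J \<equiv> {(i, j). i \<in> U \<and> j \<in> U \<and> i \<noteq> j}"
  shows "(\<Sum>(i, j)\<in>J. \<Sum>(k, l)\<in>J. \<mu> i * \<mu> j * \<mu> k * \<mu> l *
      (\<kappa>0 + \<kappa>1 * (of_bool (i = k) + of_bool (i = l) + of_bool (j = k) + of_bool (j = l)) +
       \<kappa>2 * (of_bool (i = k \<and> j = l) + of_bool (i = l \<and> j = k))))
    \<le> \<kappa>0 * (\<Sum>i\<in>U. \<mu> i) ^ 4 + 4 * \<kappa>1 * (\<Sum>i\<in>U. (\<mu> i)\<^sup>2) * (\<Sum>i\<in>U. \<mu> i)\<^sup>2
      + 2 * \<kappa>2 * (\<Sum>i\<in>U. (\<mu> i)\<^sup>2)\<^sup>2"
proof -
  let ?f = "\<lambda>i j k l. \<mu> i * \<mu> j * \<mu> k * \<mu> l *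
      (\<kappa>0 + \<kappa>1 * (of_bool (i = k) + of_bool (i = l) + of_bool (j = k) + of_bool (j = l)) +
       \<kappa>2 * (of_bool (i = k \<and> j = l) + of_bool (i = l \<and> j = k)))"
  let ?m1 = "\<Sum>i\<in>U. \<mu> i" and ?m2 = "\<Sum>i\<in>U. (\<mu> i)\<^sup>2"
  have fin: "finite J" "J \<subseteq> U \<times> U"
    using U by (auto simp: J_def intro: finite_subset[of _ "U \<times> U"])
  have pos: "0 \<le> ?f i j k l" if "i \<in> U" "j \<in> U" "k \<in> U" "l \<in> U" for i j k l
    using that \<mu> nonneg by (intro mult_nonneg_nonneg add_nonneg_nonneg) auto
  define f where "f x y = ?f (fst x) (snd x) (fst y) (snd y)" for x y
  have f0: "0 \<le> f x y" if "x \<in> U \<times> U" "y \<in> U \<times> U" for x y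
    unfolding f_def by (rule pos) (use that in auto)
  have "(\<Sum>x\<in>J. \<Sum>y\<in>J. f x y) \<le> (\<Sum>x\<in>J. \<Sum>y\<in>U \<times> U. f x y)"
    using fin U f0 by (intro sum_mono sum_mono2) auto
  also have "\<dots> \<le> (\<Sum>x\<in>U \<times> U. \<Sum>y\<in>U \<times> U. f x y)"
    using fin U f0 by (intro sum_mono2 sum_nonneg) auto
  finally have "(\<Sum>(i, j)\<in>J. \<Sum>(k, l)\<in>J. ?f i j k l) \<le> (\<Sum>(i, j)\<in>U \<times> U. \<Sum>(k, l)\<in>U \<times> U. ?f i j k l)"
    unfolding f_def case_prod_unfold .
  also have "\<dots> = (\<Sum>i\<in>U. \<Sum>j\<in>U. \<Sum>k\<in>U. \<Sum>l\<in>U. ?f i j k l)"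
    by (simp only: sum.cartesian_product[symmetric])
  also have "\<dots> = (\<Sum>i\<in>U. \<Sum>j\<in>U. \<mu> i * \<mu> j * (\<kappa>0 * ?m1\<^sup>2 + 2 * \<kappa>1 * (\<mu> i + \<mu> j) * ?m1
      + 2 * \<kappa>2 * (\<mu> i * \<mu> j)))"
  proof (intro sum.cong refl)
    fix i j assume ij: "i \<in> U" "j \<in> U"
    have "(\<Sum>k\<in>U. \<Sum>l\<in>U. ?f i j k l) = (\<Sum>k\<in>U. \<mu> i * \<mu> j * \<mu> k *
      (\<kappa>0 * ?m1 + \<kappa>1 * (of_bool (i = k) * ?m1 + \<mu> i + of_bool (j = k) * ?m1 + \<mu> j)
        + \<kappa>2 * (of_bool (i = k) * \<mu> j + of_bool (j = k) * \<mu> i)))"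
    proof (intro sum.cong refl)
      fix k
      have d: "(\<Sum>l\<in>U. \<mu> l * of_bool (i = l)) = \<mu> i" "(\<Sum>l\<in>U. \<mu> l * of_bool (j = l)) = \<mu> j"
        using ij U by (simp_all add: of_bool_def if_distrib[of "(*) _"] sum.delta' cong: if_cong)
      have "(\<Sum>l\<in>U. ?f i j k l) = (\<Sum>l\<in>U. \<mu> i * \<mu> j * \<mu> k *
        (\<kappa>0 * \<mu> l + \<kappa>1 * (of_bool (i = k) * \<mu> l + \<mu> l * of_bool (i = l) + of_bool (j = k) * \<mu> l + \<mu> l * of_bool (j = l))
        + \<kappa>2 * (of_bool (i = k) * (\<mu> l * of_bool (j = l)) + of_bool (j = k) * (\<mu> l * of_bool (i = l)))))"
        by (intro sum.cong refl) (auto simp: of_bool_conj algebra_simps)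
      then show "(\<Sum>l\<in>U. ?f i j k l) = \<mu> i * \<mu> j * \<mu> k *
        (\<kappa>0 * ?m1 + \<kappa>1 * (of_bool (i = k) * ?m1 + \<mu> i + of_bool (j = k) * ?m1 + \<mu> j)
          + \<kappa>2 * (of_bool (i = k) * \<mu> j + of_bool (j = k) * \<mu> i))"
        by (simp add: sum_distrib_left[symmetric] sum.distrib d)
    qed
    also have "\<dots> = (\<Sum>k\<in>U. \<mu> i * \<mu> j *
      (\<kappa>0 * ?m1 * \<mu> k + \<kappa>1 * (?m1 * (\<mu> k * of_bool (i = k)) + \<mu> i * \<mu> k + ?m1 * (\<mu> k * of_bool (j = k)) + \<mu> j * \<mu> k)
        + \<kappa>2 * (\<mu> j * (\<mu> k * of_bool (i = k)) + \<mu> i * (\<mu> k * of_bool (j = k)))))"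
      by (intro sum.cong refl) (simp add: algebra_simps)
    also have "\<dots> = \<mu> i * \<mu> j *
      (\<kappa>0 * ?m1 * ?m1 + \<kappa>1 * (?m1 * \<mu> i + \<mu> i * ?m1 + ?m1 * \<mu> j + \<mu> j * ?m1) + \<kappa>2 * (\<mu> j * \<mu> i + \<mu> i * \<mu> j))"
    proof -
      have d: "(\<Sum>l\<in>U. \<mu> l * of_bool (i = l)) = \<mu> i" "(\<Sum>l\<in>U. \<mu> l * of_bool (j = l)) = \<mu> j"
        using ij U by (simp_all add: of_bool_def if_distrib[of "(*) _"] sum.delta' cong: if_cong)
      show ?thesis by (simp only: sum_distrib_left[symmetric] sum.distrib d)
    qed
    finally show "(\<Sum>k\<in>U. \<Sum>l\<in>U. ?f i j k l) = \<mu> i * \<mu> j * (\<kappa>0 * ?m1\<^sup>2 + 2 * \<kappa>1 * (\<mu> i + \<mu> j) * ?m1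
      + 2 * \<kappa>2 * (\<mu> i * \<mu> j))"
      by (simp add: power2_eq_square algebra_simps)
  qed
  also have "\<dots> = (\<Sum>i\<in>U. \<Sum>j\<in>U. \<kappa>0 * ?m1\<^sup>2 * (\<mu> i * \<mu> j) + 2 * \<kappa>1 * ?m1 * ((\<mu> i)\<^sup>2 * \<mu> j)
      + 2 * \<kappa>1 * ?m1 * (\<mu> i * (\<mu> j)\<^sup>2) + 2 * \<kappa>2 * ((\<mu> i)\<^sup>2 * (\<mu> j)\<^sup>2))"
    by (intro sum.cong refl) (simp add: power2_eq_square algebra_simps)
  also have "\<dots> = \<kappa>0 * ?m1\<^sup>2 * (?m1 * ?m1) + 2 * \<kappa>1 * ?m1 * (?m2 * ?m1)
      + 2 * \<kappa>1 * ?m1 * (?m1 * ?m2) + 2 * \<kappa>2 * (?m2 * ?m2)"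
    by (simp only: sum.distrib sum_distrib_left[symmetric] sum_product)
  also have "\<dots> = \<kappa>0 * ?m1 ^ 4 + 4 * \<kappa>1 * ?m2 * ?m1\<^sup>2 + 2 * \<kappa>2 * ?m2\<^sup>2"
    by (simp add: power2_eq_square power4_eq_xxxx algebra_simps)
  finally show ?thesis by (simp add: J_def)
qed

context cond_indep_variables
begin

lemma R_prod_integrable:
  assumes "i \<in> U" "j \<in> U" shows "integrable M (\<lambda>\<omega>. R i \<omega> * R j \<omega>)"
  using R2_integrable[of i] RR_integrable[of i j] assms
  by (cases "i = j") (auto simp: power2_eq_square)

lemma weighted_sum_variance:
  assumes b: "\<And>i. i \<in> U \<Longrightarrow> \<bar>b i\<bar> \<le> B"
    and p: "\<And>i. i \<in> U \<Longrightarrow> P {i} \<le> p"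
    and \<delta>: "\<And>i j. i \<in> U \<Longrightarrow> j \<in> U \<Longrightarrow> i \<noteq> j \<Longrightarrow> \<bar>P {i, j} - P {i} * P {j}\<bar> \<le> \<delta>" and "0 \<le> \<delta>"
    and \<nu>: "\<And>i. i \<in> U \<Longrightarrow> \<bar>w i\<bar> \<le> \<nu> i"
    and v: "\<And>i. i \<in> U \<Longrightarrow> 0 \<le> v i"
  shows "integrable M (\<lambda>\<omega>. ((\<Sum>i\<in>U. b i * R i \<omega>) - (\<Sum>i\<in>U. b i * (P {i} * w i)))\<^sup>2)"
    and "expectation (\<lambda>\<omega>. ((\<Sum>i\<in>U. b i * R i \<omega>) - (\<Sum>i\<in>U. b i * (P {i} * w i)))\<^sup>2)
      \<le> B\<^sup>2 * (p * (\<Sum>i\<in>U. v i) + \<delta> * (\<Sum>i\<in>U. \<nu> i)\<^sup>2)"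
proof -
  \<comment> \<open>The term with \<open>\<delta>\<close> is kept on the diagonal as well, so that
    its double sum is a full square.\<close>
  let ?C = "\<lambda>i j. (if i = j then p * v i else 0) + \<delta> * (\<nu> i * \<nu> j)"
  have \<nu>0: "0 \<le> \<nu> i" if "i \<in> U" for i using \<nu>[OF that] by linarith
  have cov: "\<bar>expectation (\<lambda>\<omega>. R i \<omega> * R j \<omega>) - (P {i} * w i) * (P {j} * w j)\<bar> \<le> ?C i j"
    if "i \<in> U" "j \<in> U" for i j
  proof (cases "i = j")
    case True
    \<comment> \<open>A variance lies between zero and the second moment, which bounds its absolute
      value.\<close>
    have "(P {i} * w i)\<^sup>2 \<le> expectation (\<lambda>\<omega>. (R i \<omega>)\<^sup>2)"
      using square_integral_le(2)[of "R i"] R_integrable[OF that(1)] R2_integrable[OF that(1)] R_mean[OF that(1)]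
      by simp
    moreover have "expectation (\<lambda>\<omega>. (R i \<omega>)\<^sup>2) \<le> p * v i"
      using R2_le[OF that(1)] mult_right_mono[OF p[OF that(1)] v[OF that(1)]] by linarith
    moreover have "0 \<le> \<delta> * (\<nu> i * \<nu> i)" using \<open>0 \<le> \<delta>\<close> by simp
    moreover have "0 \<le> (P {i} * w i)\<^sup>2" by simp
    ultimately have "\<bar>expectation (\<lambda>\<omega>. (R i \<omega>)\<^sup>2) - (P {i} * w i)\<^sup>2\<bar> \<le> p * v i + \<delta> * (\<nu> i * \<nu> i)"
      by linarith
    then show ?thesis using True by (simp add: power2_eq_square)
  next
    case False
    have "expectation (\<lambda>\<omega>. R i \<omega> * R j \<omega>) - (P {i} * w i) * (P {j} * w j)
      = (P {i, j} - P {i} * P {j}) * (w i * w j)"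
      using RR_mean[OF that False] by (simp add: algebra_simps)
    then have "\<bar>expectation (\<lambda>\<omega>. R i \<omega> * R j \<omega>) - (P {i} * w i) * (P {j} * w j)\<bar>
      = \<bar>P {i, j} - P {i} * P {j}\<bar> * (\<bar>w i\<bar> * \<bar>w j\<bar>)" by (simp add: abs_mult)
    also have "\<dots> \<le> \<delta> * (\<nu> i * \<nu> j)"
      using \<delta>[OF that False] \<nu> \<nu>0 that \<open>0 \<le> \<delta>\<close> by (intro mult_mono) auto
    finally show ?thesis using False by simp
  qed
  note * = second_moment_centered_sum[where J = U and X = R and m = "\<lambda>i. P {i} * w i" and a = b and C = ?C,
      OF finite_U R_integrable R_prod_integrable R_mean cov]
  show "integrable M (\<lambda>\<omega>. ((\<Sum>i\<in>U. b i * R i \<omega>) - (\<Sum>i\<in>U. b i * (P {i} * w i)))\<^sup>2)"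
    by (rule *(1))
  have "(\<Sum>i\<in>U. \<Sum>j\<in>U. \<bar>b i\<bar> * \<bar>b j\<bar> * ?C i j) \<le> (\<Sum>i\<in>U. \<Sum>j\<in>U. B\<^sup>2 * ?C i j)"
  proof (intro sum_mono mult_right_mono)
    fix i j assume ij: "i \<in> U" "j \<in> U"
    show "\<bar>b i\<bar> * \<bar>b j\<bar> \<le> B\<^sup>2" unfolding power2_eq_square using b[of i] b[of j] ij by (intro mult_mono) auto
    have "0 \<le> p" using p[of i] P_nonneg[of "{i}"] ij by linarith
    then show "0 \<le> ?C i j" using ij \<nu>0 v \<open>0 \<le> \<delta>\<close> by auto
  qed
  also have "\<dots> = B\<^sup>2 * (p * (\<Sum>i\<in>U. v i) + \<delta> * (\<Sum>i\<in>U. \<nu> i)\<^sup>2)"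
  proof -
    have "(\<Sum>i\<in>U. \<Sum>j\<in>U. if i = j then p * v i else 0) = p * (\<Sum>i\<in>U. v i)"
      using finite_U by (simp add: sum_distrib_left)
    moreover have "(\<Sum>i\<in>U. \<Sum>j\<in>U. \<delta> * (\<nu> i * \<nu> j)) = \<delta> * (\<Sum>i\<in>U. \<nu> i)\<^sup>2"
      by (simp only: power2_eq_square sum_product sum_distrib_left[symmetric])
    ultimately show ?thesis by (simp add: sum.distrib sum_distrib_left[symmetric])
  qed
  finally show "expectation (\<lambda>\<omega>. ((\<Sum>i\<in>U. b i * R i \<omega>) - (\<Sum>i\<in>U. b i * (P {i} * w i)))\<^sup>2)
      \<le> B\<^sup>2 * (p * (\<Sum>i\<in>U. v i) + \<delta> * (\<Sum>i\<in>U. \<nu> i)\<^sup>2)"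
    using *(2) by linarith
qed

text \<open>The covariance bound has one level per overlap class: \<open>c4\<close> for disjoint
  pairs, \<open>c3 + c2\<^sup>2\<close> for one shared index, \<open>c2 + c2\<^sup>2\<close> for
  two. For overlapping pairs the mixed moment and the product of the means are added in absolute
  value, hence the squares of \<open>c2\<close>; cancellation is exploited only for disjoint
  pairs.\<close>

lemma weighted_pair_sum_variance:
  assumes a: "\<And>i j. i \<in> U \<Longrightarrow> j \<in> U \<Longrightarrow> i \<noteq> j \<Longrightarrow> \<bar>a i j\<bar> \<le> \<alpha>"
    and c2: "\<And>i j. i \<in> U \<Longrightarrow> j \<in> U \<Longrightarrow> i \<noteq> j \<Longrightarrow> P {i, j} \<le> c2"
    and c3: "\<And>i j k. i \<in> U \<Longrightarrow> j \<in> U \<Longrightarrow> k \<in> U \<Longrightarrow> distinct [i, j, k] \<Longrightarrow> P {i, j, k} \<le> c3"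
    and c4: "\<And>i j k l. i \<in> U \<Longrightarrow> j \<in> U \<Longrightarrow> k \<in> U \<Longrightarrow> l \<in> U \<Longrightarrow> distinct [i, j, k, l] \<Longrightarrow>
      \<bar>P {i, j, k, l} - P {i, j} * P {k, l}\<bar> \<le> c4"
    and c: "0 \<le> c2" "0 \<le> c3" "0 \<le> c4"
    and w: "\<And>i. i \<in> U \<Longrightarrow> \<bar>w i\<bar> \<le> \<mu> i"
    and v: "\<And>i. i \<in> U \<Longrightarrow> 0 \<le> v i" "\<And>i. i \<in> U \<Longrightarrow> v i \<le> (\<mu> i)\<^sup>2"
  defines "J \<equiv> {(i, j). i \<in> U \<and> j \<in> U \<and> i \<noteq> j}"
  shows "integrable M (\<lambda>\<omega>. ((\<Sum>(i, j)\<in>J. a i j * (R i \<omega> * R j \<omega>)) - (\<Sum>(i, j)\<in>J. a i j * (P {i, j} * w i * w j)))\<^sup>2)"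
    and "expectation (\<lambda>\<omega>. ((\<Sum>(i, j)\<in>J. a i j * (R i \<omega> * R j \<omega>)) - (\<Sum>(i, j)\<in>J. a i j * (P {i, j} * w i * w j)))\<^sup>2)
      \<le> \<alpha>\<^sup>2 * (c4 * (\<Sum>i\<in>U. \<mu> i) ^ 4 + 4 * (c3 + c2\<^sup>2) * (\<Sum>i\<in>U. (\<mu> i)\<^sup>2) * (\<Sum>i\<in>U. \<mu> i)\<^sup>2
      + 2 * (c2 + c2\<^sup>2) * (\<Sum>i\<in>U. (\<mu> i)\<^sup>2)\<^sup>2)"
proof -
  let ?G = "\<lambda>i j k l. c4 + (c3 + c2\<^sup>2) * (of_bool (i = k) + of_bool (i = l) + of_bool (j = k) + of_bool (j = l)) +
       (c2 + c2\<^sup>2) * (of_bool (i = k \<and> j = l) + of_bool (i = l \<and> j = k))"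
  let ?C = "\<lambda>i j k l. \<mu> i * \<mu> j * \<mu> k * \<mu> l * ?G i j k l"
  have \<mu>0: "0 \<le> \<mu> i" if "i \<in> U" for i using w[OF that] by linarith
  have finJ: "finite J"
    using finite_U by (auto simp: J_def intro: finite_subset[of _ "U \<times> U"])
  have means: "\<bar>P {i, j} * w i * w j * (P {k, l} * w k * w l)\<bar> \<le> \<mu> i * \<mu> j * \<mu> k * \<mu> l * c2\<^sup>2"
    if "i \<in> U" "j \<in> U" "k \<in> U" "l \<in> U" "i \<noteq> j" "k \<noteq> l" for i j k l
  proof -
    have "\<bar>P {i, j} * w i * w j * (P {k, l} * w k * w l)\<bar>
      = \<bar>w i\<bar> * \<bar>w j\<bar> * \<bar>w k\<bar> * \<bar>w l\<bar> * (P {i, j} * P {k, l})"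
      using P_nonneg by (simp add: abs_mult)
    also have "\<dots> \<le> \<mu> i * \<mu> j * \<mu> k * \<mu> l * (c2 * c2)"
      using that w \<mu>0 c2 P_nonneg c by (intro mult_mono) auto
    finally show ?thesis by (simp add: power2_eq_square)
  qed
  have one: "integrable M (\<lambda>\<omega>. (R i \<omega> * R j \<omega>) * (R i \<omega> * R k \<omega>)) \<and>
    \<bar>expectation (\<lambda>\<omega>. (R i \<omega> * R j \<omega>) * (R i \<omega> * R k \<omega>)) - P {i, j} * w i * w j * (P {i, k} * w i * w k)\<bar>
      \<le> \<mu> i * \<mu> j * \<mu> i * \<mu> k * (c3 + c2\<^sup>2)"
    if "i \<in> U" "j \<in> U" "k \<in> U" "distinct [i, j, k]" for i j k
  proof -
    have eq: "(R i \<omega> * R j \<omega>) * (R i \<omega> * R k \<omega>) = (R i \<omega>)\<^sup>2 * (R j \<omega> * R k \<omega>)" for \<omega>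
      by (simp add: power2_eq_square mult_ac)
    have "P {i, j, k} * v i * \<bar>w j\<bar> * \<bar>w k\<bar> \<le> c3 * (\<mu> i)\<^sup>2 * \<mu> j * \<mu> k"
      using that w \<mu>0 c3 P_nonneg c v by (intro mult_mono) auto
    then have "\<bar>expectation (\<lambda>\<omega>. (R i \<omega>)\<^sup>2 * (R j \<omega> * R k \<omega>))\<bar> \<le> \<mu> i * \<mu> j * \<mu> i * \<mu> k * c3"
      using R2RR_le[OF that] by (simp add: power2_eq_square mult_ac)
    moreover have "\<bar>P {i, j} * w i * w j * (P {i, k} * w i * w k)\<bar> \<le> \<mu> i * \<mu> j * \<mu> i * \<mu> k * c2\<^sup>2"
      using means[of i j i k] that by simp
    ultimately show ?thesis unfolding eq distrib_left using R2RR_integrable[OF that] by linarith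
  qed
  have two: "integrable M (\<lambda>\<omega>. (R i \<omega> * R j \<omega>) * (R i \<omega> * R j \<omega>)) \<and>
    \<bar>expectation (\<lambda>\<omega>. (R i \<omega> * R j \<omega>) * (R i \<omega> * R j \<omega>)) - P {i, j} * w i * w j * (P {i, j} * w i * w j)\<bar>
      \<le> \<mu> i * \<mu> j * \<mu> i * \<mu> j * (c2 + c2\<^sup>2)"
    if "i \<in> U" "j \<in> U" "i \<noteq> j" for i j
  proof -
    have eq: "(R i \<omega> * R j \<omega>) * (R i \<omega> * R j \<omega>) = (R i \<omega>)\<^sup>2 * (R j \<omega>)\<^sup>2" for \<omega>
      by (simp add: power2_eq_square mult_ac)
    have "P {i, j} * v i * v j \<le> c2 * (\<mu> i)\<^sup>2 * (\<mu> j)\<^sup>2"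
      using that c2 P_nonneg c v by (intro mult_mono) auto
    then have "\<bar>expectation (\<lambda>\<omega>. (R i \<omega>)\<^sup>2 * (R j \<omega>)\<^sup>2)\<bar> \<le> \<mu> i * \<mu> j * \<mu> i * \<mu> j * c2"
      using R2R2_le[OF that] by (simp add: power2_eq_square mult_ac)
    then show ?thesis unfolding eq distrib_left
      using R2R2_integrable[OF that] means[of i j i j] that by linarith
  qed
  let ?A = "\<lambda>i j k l. of_bool (i = k) + of_bool (i = l) + of_bool (j = k) + of_bool (j = l) :: real"
  let ?B = "\<lambda>i j k l. of_bool (i = k \<and> j = l) + of_bool (i = l \<and> j = k) :: real"
  have \<kappa>: "0 \<le> c3 + c2\<^sup>2" "0 \<le> c2 + c2\<^sup>2" using c by simp_all
  have A0: "0 \<le> (c3 + c2\<^sup>2) * ?A i j k l" for i j k l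
    using \<kappa> by (intro mult_nonneg_nonneg) simp_all
  have B0: "0 \<le> (c2 + c2\<^sup>2) * ?B i j k l" for i j k l
    using \<kappa> by (intro mult_nonneg_nonneg) simp_all
  have C0: "0 \<le> ?G i j k l" "c4 \<le> ?G i j k l" for i j k l
    using c A0[of i k l j] B0[of i k j l] by linarith+
  have C1: "c3 + c2\<^sup>2 \<le> ?G i j k l" if "i = k \<or> i = l \<or> j = k \<or> j = l" for i j k l
  proof -
    have "1 \<le> ?A i j k l" using that by auto
    from add_mono[OF add_mono[OF c(3) mult_left_mono[OF this \<kappa>(1)]] B0[of i k j l]] show ?thesis
      by (simp only: add_0_left add_0_right mult_1_right)
  qed
  have C2: "c2 + c2\<^sup>2 \<le> ?G i j k l" if "i = k \<and> j = l \<or> i = l \<and> j = k" for i j k l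
  proof -
    have "1 \<le> ?B i j k l" using that by auto
    from add_mono[OF add_mono[OF c(3) A0[of i k l j]] mult_left_mono[OF this \<kappa>(2)]] show ?thesis
      by (simp only: add_0_left add_0_right mult_1_right)
  qed
  have cov: "integrable M (\<lambda>\<omega>. (R i \<omega> * R j \<omega>) * (R k \<omega> * R l \<omega>)) \<and>
    \<bar>expectation (\<lambda>\<omega>. (R i \<omega> * R j \<omega>) * (R k \<omega> * R l \<omega>)) - P {i, j} * w i * w j * (P {k, l} * w k * w l)\<bar>
      \<le> ?C i j k l"
    if U: "i \<in> U" "j \<in> U" "k \<in> U" "l \<in> U" and ne: "i \<noteq> j" "k \<noteq> l" for i j k l
  proof -
    have q0: "0 \<le> \<mu> i * \<mu> j * \<mu> k * \<mu> l" using \<mu>0 U by simp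
    \<comment> \<open>Weakens a bound by one level of the overlap scale to a bound by the whole of
      \<open>?G\<close>.\<close>
    note up = mult_left_mono[OF _ q0, THEN order_trans[rotated]]
    \<comment> \<open>These are all overlaps of two ordered pairs with distinct entries. The six
      overlapping patterns reduce to \<open>one\<close> and \<open>two\<close> by renaming and
      commuting factors.\<close>
    consider "i = k" "j = l" | "i = l" "j = k" | "i = k" "j \<noteq> l" | "i = l" "j \<noteq> k"
      | "j = k" "i \<noteq> l" | "j = l" "i \<noteq> k" | "distinct [i, j, k, l]"
      using ne by auto
    then show ?thesis
    proof cases
      case 1
      show ?thesis using two[of i j] up[OF C2[of i k j l]] U ne 1 by blast
    next
      case 2
      then have kl: "k = j" "l = i" by auto
      show ?thesis using two[of i j] up[OF C2[of i k j l]] U ne unfolding kl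
        by (simp add: insert_commute[of j i "{}"] mult_ac)
    next
      case 3
      show ?thesis using one[of i j l] up[OF C1[of i k l j]] U ne 3 by auto
    next
      case 4
      then have l: "l = i" by auto
      show ?thesis using one[of i j k] up[OF C1[of i k l j]] U ne 4 unfolding l
        by (simp add: insert_commute[of k i "{}"] mult_ac)
    next
      case 5
      then have k: "k = j" by auto
      show ?thesis using one[of j i l] up[OF C1[of i k l j]] U ne 5 unfolding k
        by (simp add: insert_commute[of j i "{}"] mult_ac)
    next
      case 6
      then have l: "l = j" by auto
      show ?thesis using one[of j i k] up[OF C1[of i k l j]] U ne 6 unfolding l
        by (simp add: insert_commute[of j i "{}"] insert_commute[of k j "{}"] mult_ac)
    next
      case 7
      \<comment> \<open>By conditional independence both moments are exact products of the
        \<open>w\<close>, so the second stage factors out and only the first-stage covariance of the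
        two inclusion events remains.\<close>
      have "expectation (\<lambda>\<omega>. (R i \<omega> * R j \<omega>) * (R k \<omega> * R l \<omega>)) - P {i, j} * w i * w j * (P {k, l} * w k * w l)
        = (w i * w j * w k * w l) * (P {i, j, k, l} - P {i, j} * P {k, l})"
        unfolding RRRR_mean[OF U 7] by (simp add: algebra_simps)
      also have "\<bar>\<dots>\<bar> \<le> \<mu> i * \<mu> j * \<mu> k * \<mu> l * c4"
        unfolding abs_mult using w \<mu>0 U c4[OF U 7] c by (intro mult_mono) auto
      finally show ?thesis using RRRR_integrable[OF U 7] up[OF C0(2)[of i k l j]] by blast
    qed
  qed
  let ?X = "\<lambda>(i, j) \<omega>. R i \<omega> * R j \<omega>" and ?m = "\<lambda>(i, j). P {i, j} * w i * w j"
  let ?a = "\<lambda>(i, j). a i j" and ?CC = "\<lambda>(i, j) (k, l). ?C i j k l"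
  have h1: "integrable M (?X x)" if "x \<in> J" for x
    using that RR_integrable by (auto simp: J_def)
  have h2: "integrable M (\<lambda>\<omega>. ?X x \<omega> * ?X y \<omega>)" if "x \<in> J" "y \<in> J" for x y
    using that cov by (auto simp: J_def)
  have h3: "expectation (?X x) = ?m x" if "x \<in> J" for x
    using that RR_mean by (auto simp: J_def)
  have h4: "\<bar>expectation (\<lambda>\<omega>. ?X x \<omega> * ?X y \<omega>) - ?m x * ?m y\<bar> \<le> ?CC x y" if "x \<in> J" "y \<in> J" for x y
  proof -
    obtain i j k l where xy: "x = (i, j)" "y = (k, l)" by (cases x, cases y) auto
    show ?thesis using cov[of i j k l] that unfolding xy J_def by simp
  qed
  note * = second_moment_centered_sum[where J = J and X = ?X and m = ?m and a = ?a and C = ?CC,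
      OF finJ h1 h2 h3 h4]
  have form: "((\<Sum>(i, j)\<in>J. a i j * (R i \<omega> * R j \<omega>)) - (\<Sum>(i, j)\<in>J. a i j * (P {i, j} * w i * w j)))
    = (\<Sum>x\<in>J. ?a x * ?X x \<omega>) - (\<Sum>x\<in>J. ?a x * ?m x)" for \<omega>
    by (simp add: case_prod_unfold)
  show "integrable M (\<lambda>\<omega>. ((\<Sum>(i, j)\<in>J. a i j * (R i \<omega> * R j \<omega>)) - (\<Sum>(i, j)\<in>J. a i j * (P {i, j} * w i * w j)))\<^sup>2)"
    unfolding form by (rule *(1))
  have "(\<Sum>x\<in>J. \<Sum>y\<in>J. \<bar>?a x\<bar> * \<bar>?a y\<bar> * ?CC x y) \<le> (\<Sum>x\<in>J. \<Sum>y\<in>J. \<alpha>\<^sup>2 * ?CC x y)"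
  proof (intro sum_mono mult_right_mono)
    fix x y assume xy: "x \<in> J" "y \<in> J"
    then have "\<bar>?a x\<bar> \<le> \<alpha>" "\<bar>?a y\<bar> \<le> \<alpha>" using a by (auto simp: J_def)
    then show "\<bar>?a x\<bar> * \<bar>?a y\<bar> \<le> \<alpha>\<^sup>2" unfolding power2_eq_square by (intro mult_mono) auto
    obtain i j k l where ijkl: "x = (i, j)" "y = (k, l)" by (cases x, cases y) auto
    have "0 \<le> \<mu> i * \<mu> j * \<mu> k * \<mu> l" using xy \<mu>0 unfolding ijkl J_def by simp
    from mult_nonneg_nonneg[OF this C0(1)] show "0 \<le> ?CC x y" unfolding ijkl prod.case .
  qed
  also have "\<dots> = \<alpha>\<^sup>2 * (\<Sum>(i, j)\<in>J. \<Sum>(k, l)\<in>J. ?C i j k l)"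
    by (simp add: sum_distrib_left case_prod_unfold)
  also have "\<dots> \<le> \<alpha>\<^sup>2 * (c4 * (\<Sum>i\<in>U. \<mu> i) ^ 4 + 4 * (c3 + c2\<^sup>2) * (\<Sum>i\<in>U. (\<mu> i)\<^sup>2) * (\<Sum>i\<in>U. \<mu> i)\<^sup>2
      + 2 * (c2 + c2\<^sup>2) * (\<Sum>i\<in>U. (\<mu> i)\<^sup>2)\<^sup>2)"
    unfolding J_def using c \<mu>0
    by (intro mult_left_mono sum_offdiag_overlap_le[OF finite_U]) auto
  finally show "expectation (\<lambda>\<omega>. ((\<Sum>(i, j)\<in>J. a i j * (R i \<omega> * R j \<omega>)) - (\<Sum>(i, j)\<in>J. a i j * (P {i, j} * w i * w j)))\<^sup>2)
      \<le> \<alpha>\<^sup>2 * (c4 * (\<Sum>i\<in>U. \<mu> i) ^ 4 + 4 * (c3 + c2\<^sup>2) * (\<Sum>i\<in>U. (\<mu> i)\<^sup>2) * (\<Sum>i\<in>U. \<mu> i)\<^sup>2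
      + 2 * (c2 + c2\<^sup>2) * (\<Sum>i\<in>U. (\<mu> i)\<^sup>2)\<^sup>2)"
    using *(2) unfolding form by linarith
qed

end

section \<open>Moments of sample means and sample variances\<close>

lemma mean_square_le:
  fixes x :: "nat \<Rightarrow> real"
  shows "((\<Sum>l<n. x l) / n)\<^sup>2 \<le> (\<Sum>l<n. (x l)\<^sup>2) / n"
proof (cases "n = 0")
  case False
  have "(\<Sum>l<n. x l)\<^sup>2 \<le> n * (\<Sum>l<n. (x l)\<^sup>2)"
    using Cauchy_Schwarz_ineq_sum[of "\<lambda>_. 1" x "{..<n}"] by simp
  then show ?thesis using False by (simp add: power_divide power2_eq_square field_simps)
qed simp

text \<open>The summand of \<open>psu_var_hat\<close> carries a factor 1 / n, as \<open>pi2\<close>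
  contains the sample size; hence this scaling of the usual identity for centred squares.\<close>

lemma sum_square_deviation:
  fixes x :: "nat \<Rightarrow> real"
  assumes "0 < n"
  shows "(\<Sum>l<n. (x l / n - (\<Sum>l<n. x l) / n / n)\<^sup>2) = ((\<Sum>l<n. (x l)\<^sup>2) - n * ((\<Sum>l<n. x l) / n)\<^sup>2) / (real n)\<^sup>2"
proof -
  define m where "m = (\<Sum>l<n. x l) / n"
  have s: "(\<Sum>l<n. x l) = n * m" using assms by (simp add: m_def)
  have "(\<Sum>l<n. (x l / n - m / n)\<^sup>2) = (\<Sum>l<n. ((x l)\<^sup>2 - 2 * m * x l + m\<^sup>2) / (real n)\<^sup>2)"
    by (intro sum.cong refl) (simp add: power2_diff power_divide diff_divide_distrib[symmetric] mult_ac)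
  also have "\<dots> = ((\<Sum>l<n. (x l)\<^sup>2) - 2 * m * (n * m) + n * m\<^sup>2) / (real n)\<^sup>2"
    by (simp add: sum_divide_distrib[symmetric] sum.distrib sum_subtractf sum_distrib_left[symmetric] s)
  also have "\<dots> = ((\<Sum>l<n. (x l)\<^sup>2) - n * m\<^sup>2) / (real n)\<^sup>2"
    by (simp add: power2_eq_square algebra_simps)
  finally show ?thesis by (simp add: m_def)
qed

text \<open>\<open>Y\<close> is a sample mean and \<open>W\<close> the unbiased estimator of its
  variance, that is, the sample variance divided by n. Independence enters through the second moment
  of \<open>Y\<close>. The bounds on the fourth moment of \<open>Y\<close> and on the square of
  \<open>W\<close> come from convexity of the square, applied pointwise to sample averages, so their
  constants do not grow with n.\<close>

lemma (in prob_space)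
  fixes X :: "nat \<Rightarrow> 'a \<Rightarrow> real"
  assumes n: "0 < n"
    and indep: "indep_vars (\<lambda>_. borel) X {..<n}"
    and int4: "\<And>l. l < n \<Longrightarrow> integrable M (\<lambda>\<omega>. X l \<omega> ^ 4)"
    and t: "\<And>l. l < n \<Longrightarrow> expectation (X l) = t"
    and b: "\<And>l. l < n \<Longrightarrow> expectation (\<lambda>\<omega>. (X l \<omega>)\<^sup>2) = b"
    and q: "\<And>l. l < n \<Longrightarrow> expectation (\<lambda>\<omega>. X l \<omega> ^ 4) = q"
  defines "Y \<equiv> \<lambda>\<omega>. (\<Sum>l<n. X l \<omega>) / n"
    and "W \<equiv> \<lambda>\<omega>. n / (real n - 1) * (\<Sum>l<n. (X l \<omega> / n - (\<Sum>l<n. X l \<omega>) / n / n)\<^sup>2)"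
  shows sample_mean_expectation: "expectation Y = t"
    and sample_mean_power4_integrable: "integrable M (\<lambda>\<omega>. Y \<omega> ^ 4)"
    and sample_mean_power4: "expectation (\<lambda>\<omega>. Y \<omega> ^ 4) \<le> q"
    and sample_mean_square_integrable: "integrable M (\<lambda>\<omega>. (Y \<omega>)\<^sup>2)"
    and sample_mean_square: "expectation (\<lambda>\<omega>. (Y \<omega>)\<^sup>2) = t\<^sup>2 + (b - t\<^sup>2) / n"
    and sample_variance_expectation: "2 \<le> n \<Longrightarrow> expectation W = (b - t\<^sup>2) / n"
    and sample_variance_square_integrable: "2 \<le> n \<Longrightarrow> integrable M (\<lambda>\<omega>. (W \<omega>)\<^sup>2)"
    and sample_variance_square: "2 \<le> n \<Longrightarrow> expectation (\<lambda>\<omega>. (W \<omega>)\<^sup>2) \<le> 4 * q / (real n)\<^sup>2"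
proof -
  have [measurable]: "X l \<in> borel_measurable M" if "l < n" for l
    using indep that by (auto simp: indep_vars_def)
  have Y_meas [measurable]: "Y \<in> borel_measurable M" unfolding Y_def by measurable
  have W_meas [measurable]: "W \<in> borel_measurable M" unfolding W_def by measurable
  have int2: "integrable M (\<lambda>\<omega>. (X l \<omega>)\<^sup>2)" if "l < n" for l
    by (rule square_integral_le(1)[rotated]) (use that int4[OF that] in \<open>simp_all add: power_mult[symmetric]\<close>)
  have int1: "integrable M (X l)" if "l < n" for l
    by (rule square_integral_le(1)[rotated]) (use that int2[OF that] in simp_all)
  show "expectation Y = t"
    unfolding Y_def using int1 t n by (simp add: Bochner_Integration.integral_sum)
  have intS4: "integrable M (\<lambda>\<omega>. \<Sum>l<n. X l \<omega> ^ 4)"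
    using int4 by (intro Bochner_Integration.integrable_sum) auto
  have intS2: "integrable M (\<lambda>\<omega>. \<Sum>l<n. (X l \<omega>)\<^sup>2)"
    using int2 by (intro Bochner_Integration.integrable_sum) auto
  have Y2_le: "(Y \<omega>)\<^sup>2 \<le> (\<Sum>l<n. (X l \<omega>)\<^sup>2) / n" for \<omega>
    unfolding Y_def by (rule mean_square_le)
  have S2_le: "((\<Sum>l<n. (X l \<omega>)\<^sup>2) / n)\<^sup>2 \<le> (\<Sum>l<n. X l \<omega> ^ 4) / n" for \<omega>
    using mean_square_le[of "\<lambda>l. (X l \<omega>)\<^sup>2" n] by (simp add: power_mult[symmetric])
  have Y4_le: "Y \<omega> ^ 4 \<le> (\<Sum>l<n. X l \<omega> ^ 4) / n" for \<omega>
  proof -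
    have "Y \<omega> ^ 4 = ((Y \<omega>)\<^sup>2)\<^sup>2" by (simp add: power_mult[symmetric])
    also have "\<dots> \<le> ((\<Sum>l<n. (X l \<omega>)\<^sup>2) / n)\<^sup>2" by (intro power_mono Y2_le) simp
    finally show ?thesis using S2_le by (rule order_trans)
  qed
  show Y4: "integrable M (\<lambda>\<omega>. Y \<omega> ^ 4)"
    by (rule Bochner_Integration.integrable_bound[OF integrable_divide[OF intS4, of "real n"]])
      (auto intro!: AE_I2 order_trans[OF Y4_le] divide_right_mono)
  have "expectation (\<lambda>\<omega>. Y \<omega> ^ 4) \<le> expectation (\<lambda>\<omega>. (\<Sum>l<n. X l \<omega> ^ 4) / n)"
    using Y4 intS4 Y4_le by (intro integral_mono) auto
  also have "\<dots> = q" using int4 q n by (simp add: Bochner_Integration.integral_sum)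
  finally show "expectation (\<lambda>\<omega>. Y \<omega> ^ 4) \<le> q" .
  show Y2: "integrable M (\<lambda>\<omega>. (Y \<omega>)\<^sup>2)"
    by (rule square_integral_le(1)[rotated]) (use Y4 in \<open>simp_all add: power_mult[symmetric]\<close>)
  have XX: "integrable M (\<lambda>\<omega>. X l \<omega> * X k \<omega>) \<and>
    expectation (\<lambda>\<omega>. X l \<omega> * X k \<omega>) = (if l = k then b - t\<^sup>2 else 0) + t\<^sup>2"
    if "l < n" "k < n" for l k
  proof (cases "l = k")
    case True
    then show ?thesis using int2[of k] b[of k] that by (simp add: power2_eq_square)
  next
    case False
    have i: "indep_vars (\<lambda>_. borel) X {l, k}"
      using that by (intro indep_vars_subset[OF indep]) auto
    show ?thesis
      using indep_vars_lebesgue_integral[OF _ i] indep_vars_integrable[OF _ i] int1 t that False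
      by (auto simp: power2_eq_square)
  qed
  have Y2_eq: "(Y \<omega>)\<^sup>2 = (\<Sum>l<n. \<Sum>k<n. X l \<omega> * X k \<omega>) / (real n)\<^sup>2" for \<omega>
    by (simp add: Y_def power_divide power2_eq_square sum_product)
  have "expectation (\<lambda>\<omega>. (Y \<omega>)\<^sup>2) = (\<Sum>l<n. \<Sum>k<n. (if l = k then b - t\<^sup>2 else 0) + t\<^sup>2) / (real n)\<^sup>2"
  proof -
    have row: "integrable M (\<lambda>\<omega>. \<Sum>k<n. X l \<omega> * X k \<omega>)" if "l < n" for l
      using XX that by (intro Bochner_Integration.integrable_sum) auto
    have "expectation (\<lambda>\<omega>. \<Sum>l<n. \<Sum>k<n. X l \<omega> * X k \<omega>)
      = (\<Sum>l<n. expectation (\<lambda>\<omega>. \<Sum>k<n. X l \<omega> * X k \<omega>))"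
      using row by (intro Bochner_Integration.integral_sum) auto
    also have "\<dots> = (\<Sum>l<n. \<Sum>k<n. expectation (\<lambda>\<omega>. X l \<omega> * X k \<omega>))"
      using XX by (intro sum.cong refl Bochner_Integration.integral_sum) auto
    also have "\<dots> = (\<Sum>l<n. \<Sum>k<n. (if l = k then b - t\<^sup>2 else 0) + t\<^sup>2)"
      using XX by (intro sum.cong refl) auto
    finally show ?thesis unfolding Y2_eq by simp
  qed
  also have "(\<Sum>l<n. \<Sum>k<n. (if l = k then b - t\<^sup>2 else 0) + t\<^sup>2) = n * (b - t\<^sup>2) + n * (n * t\<^sup>2)"
    by (simp add: sum.distrib distrib_left)
  also have "\<dots> / (real n)\<^sup>2 = t\<^sup>2 + (b - t\<^sup>2) / n"
    using n by (simp add: power2_eq_square field_simps)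
  finally show EY2: "expectation (\<lambda>\<omega>. (Y \<omega>)\<^sup>2) = t\<^sup>2 + (b - t\<^sup>2) / n" .
  assume n2: "2 \<le> n"
  have W_eq: "W \<omega> = n / (real n - 1) * (((\<Sum>l<n. (X l \<omega>)\<^sup>2) - n * (Y \<omega>)\<^sup>2) / (real n)\<^sup>2)" for \<omega>
    unfolding W_def Y_def sum_square_deviation[OF n] ..
  have "expectation W = n / (real n - 1) * ((n * b - n * (t\<^sup>2 + (b - t\<^sup>2) / n)) / (real n)\<^sup>2)"
  proof -
    have "expectation (\<lambda>\<omega>. (\<Sum>l<n. (X l \<omega>)\<^sup>2) - n * (Y \<omega>)\<^sup>2)
      = expectation (\<lambda>\<omega>. \<Sum>l<n. (X l \<omega>)\<^sup>2) - n * expectation (\<lambda>\<omega>. (Y \<omega>)\<^sup>2)"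
      using intS2 Y2 by simp
    also have "expectation (\<lambda>\<omega>. \<Sum>l<n. (X l \<omega>)\<^sup>2) = n * b"
      using int2 b by (simp add: Bochner_Integration.integral_sum)
    finally show ?thesis unfolding W_eq[abs_def] EY2 by simp
  qed
  also have "n * b - n * (t\<^sup>2 + (b - t\<^sup>2) / n) = (real n - 1) * (b - t\<^sup>2)"
    using n by (simp add: field_simps)
  also have "n / (real n - 1) * ((real n - 1) * (b - t\<^sup>2) / (real n)\<^sup>2) = (b - t\<^sup>2) / n"
    using n2 by (simp add: power2_eq_square)
  finally show "expectation W = (b - t\<^sup>2) / n" .
  have W0: "0 \<le> W \<omega>" for \<omega>
    unfolding W_def using n2 by (intro mult_nonneg_nonneg sum_nonneg) auto
  have W_le: "W \<omega> \<le> 2 / n * ((\<Sum>l<n. (X l \<omega>)\<^sup>2) / n)" for \<omega>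
  proof -
    have "n * (Y \<omega>)\<^sup>2 \<le> (\<Sum>l<n. (X l \<omega>)\<^sup>2)"
      using Y2_le[of \<omega>] n by (simp add: field_simps)
    \<comment> \<open>The subtracted term is dropped and n / (n - 1) is at most 2, which holds from
      n = 2 on; the 4 in the final bound is the square of this 2.\<close>
    then have "W \<omega> \<le> 2 * ((\<Sum>l<n. (X l \<omega>)\<^sup>2) / (real n)\<^sup>2)"
      unfolding W_eq using n2
      by (intro mult_mono divide_right_mono) (auto simp: field_simps)
    then show ?thesis by (simp add: power2_eq_square)
  qed
  have W2_le: "(W \<omega>)\<^sup>2 \<le> 4 / (real n)\<^sup>2 * ((\<Sum>l<n. X l \<omega> ^ 4) / n)" for \<omega>
  proof -
    have "(W \<omega>)\<^sup>2 \<le> (2 / n * ((\<Sum>l<n. (X l \<omega>)\<^sup>2) / n))\<^sup>2" by (intro power_mono W_le W0)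
    also have "\<dots> = 4 / (real n)\<^sup>2 * ((\<Sum>l<n. (X l \<omega>)\<^sup>2) / n)\<^sup>2"
      unfolding power_mult_distrib by (simp add: power_divide)
    also have "\<dots> \<le> 4 / (real n)\<^sup>2 * ((\<Sum>l<n. X l \<omega> ^ 4) / n)" by (intro mult_left_mono S2_le) simp
    finally show ?thesis .
  qed
  have intb: "integrable M (\<lambda>\<omega>. 4 / (real n)\<^sup>2 * ((\<Sum>l<n. X l \<omega> ^ 4) / n))" using intS4 by simp
  show W2: "integrable M (\<lambda>\<omega>. (W \<omega>)\<^sup>2)"
    by (rule Bochner_Integration.integrable_bound[OF intb]) 
      (simp, rule AE_I2, unfold real_norm_def abs_power2, rule order_trans[OF W2_le abs_ge_self])
  have "expectation (\<lambda>\<omega>. (W \<omega>)\<^sup>2) \<le> expectation (\<lambda>\<omega>. 4 / (real n)\<^sup>2 * ((\<Sum>l<n. X l \<omega> ^ 4) / n))"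
    using W2 intb W2_le by (intro integral_mono) auto
  also have "\<dots> = 4 * q / (real n)\<^sup>2" using int4 q n by (simp add: Bochner_Integration.integral_sum)
  finally show "expectation (\<lambda>\<omega>. (W \<omega>)\<^sup>2) \<le> 4 * q / (real n)\<^sup>2" .
qed

section \<open>The two-stage design\<close>

locale psu_sampling =
  fixes F :: "'a::euclidean_space set" and \<rho> :: "'a \<Rightarrow> real" and d :: "('w, 'a) design" and c :: real
  assumes design: "two_stage_design F d"
    and \<rho>_int: "set_integrable lebesgue F \<rho>"
    and \<rho>4_int: "set_integrable lebesgue F (\<lambda>x. \<rho> x ^ 4)"
    and c_pos: "0 < c"
    and size2_ge: "i < num_psu d \<Longrightarrow> 2 \<le> size2 d i"
    and psu_pos: "i < num_psu d \<Longrightarrow> 0 < measure lebesgue (psu d i)"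
    and dens_ge: "i < num_psu d \<Longrightarrow> x \<in> psu d i \<Longrightarrow> c / measure lebesgue (psu d i) \<le> dens2 d i x"
begin

abbreviation M :: "'w measure" where "M \<equiv> prob_sp d"
abbreviation U :: "nat set" where "U \<equiv> {..<num_psu d}"
abbreviation f :: "nat \<Rightarrow> 'a \<Rightarrow> real" where "f i \<equiv> dens2 d i"
abbreviation n2 :: "nat \<Rightarrow> real" where "n2 i \<equiv> real (size2 d i)"

text \<open>
  Nothing is known about \<open>\<rho>\<close> outside \<open>F\<close>; the indicator makes \<open>r i\<close> measurable on the whole space.
\<close>

definition r :: "nat \<Rightarrow> 'a \<Rightarrow> real" where
  "r i x = indicator (psu d i) x * \<rho> x / f i x"

text \<open>The law of one second-stage point in PSU i, the same under every \<open>cond s\<close>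
  with i in s.\<close>

definition Q :: "nat \<Rightarrow> 'a measure" where
  "Q i = density lebesgue (\<lambda>x. ennreal (f i x))"

definition fourth :: "nat \<Rightarrow> real" where
  "fourth i = (\<integral>x. r i x ^ 4 \<partial>Q i)"

text \<open>\<open>pi2\<close> is \<open>n2\<close> times the density, so the estimated PSU total is
  the average of \<open>r i\<close> over the drawn points. The two agree at outcomes that select PSU
  i; elsewhere the points carry no meaning.\<close>

definition Y :: "nat \<Rightarrow> 'w \<Rightarrow> real" where
  "Y i \<omega> = (\<Sum>l<size2 d i. r i (pts2 d i l \<omega>)) / n2 i"

definition Vh :: "nat \<Rightarrow> 'w \<Rightarrow> real" where
  "Vh i \<omega> = n2 i / (n2 i - 1) * (\<Sum>l<size2 d i. (r i (pts2 d i l \<omega>) / n2 i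
     - (\<Sum>l<size2 d i. r i (pts2 d i l \<omega>)) / n2 i / n2 i)\<^sup>2)"

lemma prob_space_M: "prob_space M"
  using design by (simp add: two_stage_design_def)

lemma psu_meas: "i < num_psu d \<Longrightarrow> psu d i \<in> sets lebesgue"
  using design by (simp add: two_stage_design_def psu_partition_def)

lemma psu_subset: "i < num_psu d \<Longrightarrow> psu d i \<subseteq> F"
  using design by (auto simp: two_stage_design_def psu_partition_def)

lemma density_f: "i < num_psu d \<Longrightarrow> density_on (psu d i) (f i)"
  using design by (simp add: two_stage_design_def second_stage_def)

lemma f_meas: "i < num_psu d \<Longrightarrow> f i \<in> borel_measurable lebesgue"
  and f_nonneg: "i < num_psu d \<Longrightarrow> 0 \<le> f i x"
  and f_zero: "i < num_psu d \<Longrightarrow> x \<notin> psu d i \<Longrightarrow> f i x = 0"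
  and f_nn_integral: "i < num_psu d \<Longrightarrow> (\<integral>\<^sup>+x. ennreal (f i x) \<partial>lebesgue) = 1"
  using density_f by (auto simp: density_on_def)

lemma f_pos: "i < num_psu d \<Longrightarrow> x \<in> psu d i \<Longrightarrow> 0 < f i x"
  using dens_ge[of i x] psu_pos[of i] c_pos by (meson divide_pos_pos less_le_trans)

lemma r_meas:
  assumes "i < num_psu d" shows "r i \<in> borel_measurable lebesgue"
proof -
  have [measurable]: "f i \<in> borel_measurable lebesgue" "psu d i \<in> sets lebesgue"
    using f_meas psu_meas assms by auto
  \<comment> \<open>Set integrability gives measurability only of \<open>\<rho>\<close> cut off to
    F. As the PSU lies in F, the cut-off does not change \<open>r i\<close>.\<close>
  have [measurable]: "(\<lambda>x. indicator F x *\<^sub>R \<rho> x) \<in> borel_measurable lebesgue"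
    using \<rho>_int by (auto simp: set_integrable_def)
  have "r i = (\<lambda>x. indicator (psu d i) x * (indicator F x *\<^sub>R \<rho> x) / f i x)"
    using psu_subset[OF assms] by (auto simp: r_def fun_eq_iff split: split_indicator)
  moreover have "\<dots> \<in> borel_measurable lebesgue" by measurable
  ultimately show ?thesis by metis
qed

lemma prob_space_Q: "i < num_psu d \<Longrightarrow> prob_space (Q i)"
  unfolding Q_def using f_meas f_nn_integral
  by (intro prob_spaceI) (simp add: emeasure_density)

lemma sets_Q [measurable_cong, simp]: "sets (Q i) = sets lebesgue"
  by (simp add: Q_def)

lemma
  assumes "i < num_psu d" and "g \<in> borel_measurable lebesgue"
  shows integral_Q: "(\<integral>x. g x \<partial>Q i) = (\<integral>x. f i x * (g x :: real) \<partial>lebesgue)"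
    and integrable_Q: "integrable (Q i) g \<longleftrightarrow> integrable lebesgue (\<lambda>x. f i x * g x)"
  unfolding Q_def using assms f_meas f_nonneg
  by (auto simp: integral_real_density integrable_real_density)

text \<open>On the PSU the left-hand side is \<open>\<rho>\<close> to the fourth over the cube of
  the density, and the lower density bound makes 1 / f at most the PSU measure divided by c.\<close>

lemma f_r4_le:
  assumes "i < num_psu d"
  shows "f i x * r i x ^ 4 \<le> (measure lebesgue (psu d i) / c) ^ 3 * (indicator (psu d i) x * \<rho> x ^ 4)"
proof (cases "x \<in> psu d i")
  case True
  let ?A = "measure lebesgue (psu d i)"
  have p: "0 < f i x" "0 < ?A" using f_pos[OF assms True] psu_pos[OF assms] by auto
  have "1 / f i x \<le> ?A / c"
    using dens_ge[OF assms True] p c_pos by (simp add: field_simps)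
  then have "(1 / f i x) ^ 3 \<le> (?A / c) ^ 3" using p by (intro power_mono) auto
  moreover have "f i x * r i x ^ 4 = (1 / f i x) ^ 3 * \<rho> x ^ 4"
    using True p by (simp add: r_def power_divide field_simps eval_nat_numeral)
  ultimately show ?thesis using True by (simp add: mult_right_mono)
qed (simp add: r_def)

lemma \<rho>4_psu_int: "i < num_psu d \<Longrightarrow> set_integrable lebesgue (psu d i) (\<lambda>x. \<rho> x ^ 4)"
  using set_integrable_subset[OF \<rho>4_int] psu_meas psu_subset by blast

lemma r4_integrable:
  assumes "i < num_psu d" shows "integrable (Q i) (\<lambda>x. r i x ^ 4)"
proof -
  have [measurable]: "r i \<in> borel_measurable lebesgue" "f i \<in> borel_measurable lebesgue"
    using r_meas f_meas assms by auto
  have bound: "integrable lebesgue (\<lambda>x. (measure lebesgue (psu d i) / c) ^ 3 * (indicator (psu d i) x * \<rho> x ^ 4))"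
    using \<rho>4_psu_int[OF assms] by (intro integrable_mult_right) (simp add: set_integrable_def)
  have "integrable lebesgue (\<lambda>x. f i x * r i x ^ 4)"
  proof (rule Bochner_Integration.integrable_bound[OF bound])
    show "AE x in lebesgue. norm (f i x * r i x ^ 4)
      \<le> norm ((measure lebesgue (psu d i) / c) ^ 3 * (indicator (psu d i) x * \<rho> x ^ 4))"
      using f_r4_le[OF assms, THEN order_trans[OF _ abs_ge_self]] f_nonneg[OF assms]
      by (intro AE_I2) (simp only: real_norm_def abs_mult[of "f i _"] abs_of_nonneg zero_le_even_power even_numeral)
  qed simp
  then show ?thesis using assms by (simp add: integrable_Q)
qed

lemma fourth_le:
  assumes "i < num_psu d"
  shows "fourth i \<le> (measure lebesgue (psu d i) / c) ^ 3 * (LINT x:psu d i|lebesgue. \<rho> x ^ 4)"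
proof -
  have [measurable]: "r i \<in> borel_measurable lebesgue" using r_meas assms by auto
  have "fourth i = (\<integral>x. f i x * r i x ^ 4 \<partial>lebesgue)"
    unfolding fourth_def using assms by (simp add: integral_Q)
  also have "\<dots> \<le> (\<integral>x. (measure lebesgue (psu d i) / c) ^ 3 * (indicator (psu d i) x * \<rho> x ^ 4) \<partial>lebesgue)"
    using r4_integrable[OF assms] \<rho>4_psu_int[OF assms] f_r4_le[OF assms] assms
    by (intro integral_mono integrable_mult_right) (auto simp: integrable_Q set_integrable_def)
  finally show ?thesis by (simp add: set_lebesgue_integral_def)
qed

lemma fourth_nonneg: "0 \<le> fourth i"
  unfolding fourth_def by simp

lemma
  assumes "i < num_psu d"
  shows r2_integrable: "integrable (Q i) (\<lambda>x. (r i x)\<^sup>2)"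
    and r_integrable: "integrable (Q i) (r i)"
proof -
  interpret Q: prob_space "Q i" using prob_space_Q[OF assms] .
  have [measurable]: "r i \<in> borel_measurable lebesgue" using r_meas assms by auto
  show r2: "integrable (Q i) (\<lambda>x. (r i x)\<^sup>2)"
    by (rule Q.square_integral_le(1)[rotated])
      (use r4_integrable[OF assms] in \<open>simp_all add: power_mult[symmetric]\<close>)
  show "integrable (Q i) (r i)"
    by (rule Q.square_integral_le(1)[rotated]) (use r2 in simp_all)
qed

lemma psu_total_eq:
  assumes "i < num_psu d" shows "psu_total \<rho> d i = (\<integral>x. r i x \<partial>Q i)"
proof -
  have "f i x * r i x = indicator (psu d i) x * \<rho> x" for x
    using f_pos[OF assms, of x] by (auto simp: r_def split: split_indicator)
  then show ?thesis
    using r_meas[OF assms] assms by (simp add: integral_Q psu_total_def set_lebesgue_integral_def)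
qed

text \<open>As \<open>pi2\<close> is \<open>n2\<close> times f, the deviation in
  \<open>psu_var\<close> is (r - t) / \<open>n2\<close>, and the integral becomes the variance of
  \<open>r i\<close> under \<open>Q i\<close> divided by the sample size: the variance of a mean of
  independent points.\<close>

lemma psu_var_eq:
  assumes "i < num_psu d"
  shows "psu_var \<rho> d i = ((\<integral>x. (r i x)\<^sup>2 \<partial>Q i) - (psu_total \<rho> d i)\<^sup>2) / n2 i"
proof -
  interpret Q: prob_space "Q i" using prob_space_Q[OF assms] .
  let ?t = "psu_total \<rho> d i"
  have [measurable]: "r i \<in> borel_measurable lebesgue" "f i \<in> borel_measurable lebesgue"
    using r_meas f_meas assms by auto
  have n0: "0 < n2 i" using size2_ge[OF assms] by simp
  have eq: "indicator (psu d i) x *\<^sub>R (pi2 d i x * (\<rho> x / pi2 d i x - ?t / n2 i)\<^sup>2)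
    = f i x * ((r i x - ?t)\<^sup>2 / n2 i)" for x
  proof (cases "x \<in> psu d i")
    case True
    have "\<rho> x / (n2 i * f i x) - ?t / n2 i = (r i x - ?t) / n2 i"
      using True f_pos[OF assms True] n0 by (simp add: r_def field_simps)
    then show ?thesis using True n0 by (simp add: pi2_def power_divide power2_eq_square)
  qed (simp add: f_zero[OF assms])
  have "psu_var \<rho> d i = (\<integral>x. f i x * ((r i x - ?t)\<^sup>2 / n2 i) \<partial>lebesgue)"
    unfolding psu_var_def set_lebesgue_integral_def eq ..
  also have "\<dots> = (\<integral>x. (r i x - ?t)\<^sup>2 \<partial>Q i) / n2 i"
    using assms by (simp add: integral_Q[symmetric])
  also have "(\<integral>x. (r i x - ?t)\<^sup>2 \<partial>Q i) = (\<integral>x. (r i x)\<^sup>2 \<partial>Q i) - ?t\<^sup>2"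
    unfolding psu_total_eq[OF assms]
    using Q.variance_eq[OF r_integrable[OF assms] r2_integrable[OF assms]] by simp
  finally show ?thesis .
qed

text \<open>The second moment of \<open>Y i\<close> on samples containing i, see
  \<open>Y2_mean\<close>. It plays two roles: second moment of \<open>Y\<close> and mean of its
  square.\<close>

definition sq :: "nat \<Rightarrow> real" where
  "sq i = (psu_total \<rho> d i)\<^sup>2 + psu_var \<rho> d i"

text \<open>With b the second moment and t the mean of \<open>r i\<close>, nonnegativity of a
  variance gives both t^2 \<le> b and b \<le> sqrt (fourth i); the rest follows as the sample size
  is at least 1.\<close>

lemma
  assumes "i < num_psu d"
  shows psu_var_nonneg: "0 \<le> psu_var \<rho> d i"
    and psu_total_square_le: "(psu_total \<rho> d i)\<^sup>2 \<le> sqrt (fourth i)"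
    and psu_var_le: "psu_var \<rho> d i \<le> sqrt (fourth i) / n2 i"
    and sq_le: "sq i \<le> sqrt (fourth i)"
proof -
  interpret Q: prob_space "Q i" using prob_space_Q[OF assms] .
  have [measurable]: "r i \<in> borel_measurable lebesgue" using r_meas assms by auto
  let ?b = "\<integral>x. (r i x)\<^sup>2 \<partial>Q i" and ?t = "psu_total \<rho> d i"
  have n0: "1 \<le> n2 i" using size2_ge[OF assms] by simp
  have tb: "?t\<^sup>2 \<le> ?b"
    unfolding psu_total_eq[OF assms] by (rule Q.square_integral_le(2)) (use r2_integrable[OF assms] in simp_all)
  have "?b\<^sup>2 \<le> (\<integral>x. ((r i x)\<^sup>2)\<^sup>2 \<partial>Q i)"
    by (rule Q.square_integral_le(2)) (use r4_integrable[OF assms] in \<open>simp_all add: power_mult[symmetric]\<close>)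
  then have bq: "?b \<le> sqrt (fourth i)"
    by (intro real_le_rsqrt) (simp add: fourth_def power_mult[symmetric])
  show "?t\<^sup>2 \<le> sqrt (fourth i)" using tb bq by linarith
  show "0 \<le> psu_var \<rho> d i" unfolding psu_var_eq[OF assms] using tb by simp
  show "psu_var \<rho> d i \<le> sqrt (fourth i) / n2 i"
    unfolding psu_var_eq[OF assms] using bq zero_le_power2[of ?t] by (intro divide_right_mono) linarith+
  have "psu_var \<rho> d i \<le> ?b - ?t\<^sup>2"
    unfolding psu_var_eq[OF assms] using tb n0 by (simp add: divide_le_eq mult_right_le_one_le mult_le_cancel_left1)
  then show "sq i \<le> sqrt (fourth i)" unfolding sq_def using bq by linarith
qed

lemma sq_nonneg: "i < num_psu d \<Longrightarrow> 0 \<le> sq i"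
  unfolding sq_def using psu_var_nonneg by simp

sublocale finite_random_set M "samp1 d" U
proof (intro finite_random_set.intro prob_space_M finite_random_set_axioms.intro)
  show "samp1 d \<in> measurable M (count_space (Pow U))"
    using design by (simp add: two_stage_design_def first_stage_def)
qed simp

lemma cond_eq: "cond s = cond_prob_sp d s"
  unfolding cond_def cond_prob_sp_def ev_def ..

lemma pts_meas: "i < num_psu d \<Longrightarrow> l < size2 d i \<Longrightarrow> pts2 d i l \<in> measurable M lebesgue"
  using design by (simp add: two_stage_design_def second_stage_def)

lemma pts_in_psu: "\<omega> \<in> space M \<Longrightarrow> i \<in> samp1 d \<omega> \<Longrightarrow> l < size2 d i \<Longrightarrow> pts2 d i l \<omega> \<in> psu d i"
  using design by (simp add: two_stage_design_def second_stage_def)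

lemma
  assumes "0 < prob (ev s)"
  shows pts_indep: "prob_space.indep_vars (cond s) (\<lambda>_. lebesgue) (\<lambda>(i, l). pts2 d i l) (SIGMA i:s. {..<size2 d i})"
    and pts_distributed: "i \<in> s \<Longrightarrow> l < size2 d i \<Longrightarrow> distributed (cond s) lebesgue (pts2 d i l) (\<lambda>x. ennreal (f i x))"
  using design assms unfolding cond_eq two_stage_design_def second_stage_def ev_def by auto

lemma
  assumes s: "s \<subseteq> U" "0 < prob (ev s)" "i \<in> s" and l: "l < size2 d i" and g: "g \<in> borel_measurable lebesgue"
  shows pts_expectation: "(\<integral>\<omega>. g (pts2 d i l \<omega>) \<partial>cond s) = (\<integral>x. (g x :: real) \<partial>Q i)"
    and pts_integrable: "integrable (cond s) (\<lambda>\<omega>. g (pts2 d i l \<omega>)) \<longleftrightarrow> integrable (Q i) g"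
proof -
  have Q: "Q i = distr (cond s) lebesgue (pts2 d i l)"
    unfolding Q_def using distributed_distr_eq_density[OF pts_distributed[OF s(2,3) l]] by simp
  have m: "pts2 d i l \<in> measurable (cond s) lebesgue"
    using pts_meas[of i l] s l by auto
  show "(\<integral>\<omega>. g (pts2 d i l \<omega>) \<partial>cond s) = (\<integral>x. g x \<partial>Q i)"
    unfolding Q using integral_distr[OF m g] by simp
  show "integrable (cond s) (\<lambda>\<omega>. g (pts2 d i l \<omega>)) \<longleftrightarrow> integrable (Q i) g"
    unfolding Q using integrable_distr_eq[OF m g] by simp
qed

text \<open>The points of different PSUs form disjoint blocks of one independent family, so
  quantities computed from single blocks are independent across PSUs.\<close>

lemma psu_indep:
  assumes s: "s \<subseteq> U" "0 < prob (ev s)"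
    and h: "\<And>i. i \<in> s \<Longrightarrow> h i \<in> borel_measurable (Pi\<^sub>M ({i} \<times> {..<size2 d i}) (\<lambda>_. lebesgue))"
    and Z: "\<And>i \<omega>. i \<in> s \<Longrightarrow> Z i \<omega> = h i (\<lambda>p\<in>{i} \<times> {..<size2 d i}. (case p of (i, l) \<Rightarrow> pts2 d i l) \<omega>)"
  shows "prob_space.indep_vars (cond s) (\<lambda>_. borel) Z s"
proof -
  interpret c: prob_space "cond s" using prob_space_cond[OF s(2)] .
  have "c.indep_vars (\<lambda>i. Pi\<^sub>M ({i} \<times> {..<size2 d i}) (\<lambda>_. lebesgue))
     (\<lambda>i \<omega>. \<lambda>p\<in>{i} \<times> {..<size2 d i}. (case p of (i, l) \<Rightarrow> pts2 d i l) \<omega>) s"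
    by (rule c.indep_vars_restrict[OF pts_indep[OF s(2)]]) (auto simp: disjoint_family_on_def)
  from c.indep_vars_compose2[OF this h]
  have "c.indep_vars (\<lambda>_. borel) (\<lambda>i \<omega>. h i (\<lambda>p\<in>{i} \<times> {..<size2 d i}. (case p of (i, l) \<Rightarrow> pts2 d i l) \<omega>)) s" .
  then show ?thesis using Z by (subst c.indep_vars_cong[OF refl _ refl]) auto
qed

lemma component_r_meas:
  assumes "i < num_psu d" "l < size2 d i"
  shows "(\<lambda>v. r i (v (i, l))) \<in> borel_measurable (Pi\<^sub>M ({i} \<times> {..<size2 d i}) (\<lambda>_. lebesgue))"
  using assms by (intro measurable_compose[OF measurable_component_singleton[where M = "\<lambda>_. lebesgue"] r_meas]) auto

text \<open>The function \<open>g\<close> is general in order to cover \<open>Y\<close> and its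
  square at once.\<close>

lemma Y_indep:
  assumes s: "s \<subseteq> U" "0 < prob (ev s)" and g: "g \<in> borel_measurable borel"
  shows "prob_space.indep_vars (cond s) (\<lambda>_. borel) (\<lambda>i \<omega>. g (Y i \<omega>) :: real) s"
proof (rule psu_indep[where h = "\<lambda>i v. g ((\<Sum>l<size2 d i. r i (v (i, l))) / n2 i)", OF s])
  fix i assume "i \<in> s"
  then have i: "i < num_psu d" using s by auto
  note [measurable] = g component_r_meas[OF i]
  show "(\<lambda>v. g ((\<Sum>l<size2 d i. r i (v (i, l))) / n2 i))
    \<in> borel_measurable (Pi\<^sub>M ({i} \<times> {..<size2 d i}) (\<lambda>_. lebesgue))"
    by measurable
qed (simp add: Y_def)

lemma Vh_indep:
  assumes s: "s \<subseteq> U" "0 < prob (ev s)"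
  shows "prob_space.indep_vars (cond s) (\<lambda>_. borel) Vh s"
proof (rule psu_indep[where h = "\<lambda>i v. n2 i / (n2 i - 1) * (\<Sum>l<size2 d i. (r i (v (i, l)) / n2 i
     - (\<Sum>l<size2 d i. r i (v (i, l))) / n2 i / n2 i)\<^sup>2)", OF s])
  fix i assume "i \<in> s"
  then have i: "i < num_psu d" using s by auto
  note [measurable] = component_r_meas[OF i]
  show "(\<lambda>v. n2 i / (n2 i - 1) * (\<Sum>l<size2 d i. (r i (v (i, l)) / n2 i
     - (\<Sum>l<size2 d i. r i (v (i, l))) / n2 i / n2 i)\<^sup>2))
    \<in> borel_measurable (Pi\<^sub>M ({i} \<times> {..<size2 d i}) (\<lambda>_. lebesgue))"
    by measurable
qed (simp add: Vh_def)

lemma r_pts_meas: "i < num_psu d \<Longrightarrow> l < size2 d i \<Longrightarrow> (\<lambda>\<omega>. r i (pts2 d i l \<omega>)) \<in> borel_measurable M"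
  by (rule measurable_compose[OF pts_meas r_meas])

lemma Y_meas: "i \<in> U \<Longrightarrow> Y i \<in> borel_measurable M"
  and Vh_meas: "i \<in> U \<Longrightarrow> Vh i \<in> borel_measurable M"
  unfolding Y_def[abs_def] Vh_def[abs_def] using r_pts_meas by measurable

lemma
  assumes s: "s \<subseteq> U" "0 < prob (ev s)" "i \<in> s"
  shows Y_mean: "integral\<^sup>L (cond s) (Y i) = psu_total \<rho> d i"
    and Y2_int: "integrable (cond s) (\<lambda>\<omega>. (Y i \<omega>)\<^sup>2)"
    and Y2_mean: "integral\<^sup>L (cond s) (\<lambda>\<omega>. (Y i \<omega>)\<^sup>2) = sq i"
    and Y4_int: "integrable (cond s) (\<lambda>\<omega>. ((Y i \<omega>)\<^sup>2)\<^sup>2)"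
    and Y4_le: "integral\<^sup>L (cond s) (\<lambda>\<omega>. ((Y i \<omega>)\<^sup>2)\<^sup>2) \<le> fourth i"
    and Vh_mean: "integral\<^sup>L (cond s) (Vh i) = psu_var \<rho> d i"
    and Vh2_int: "integrable (cond s) (\<lambda>\<omega>. (Vh i \<omega>)\<^sup>2)"
    and Vh2_le: "integral\<^sup>L (cond s) (\<lambda>\<omega>. (Vh i \<omega>)\<^sup>2) \<le> 4 * fourth i / (n2 i)\<^sup>2"
proof -
  interpret c: prob_space "cond s" using prob_space_cond[OF s(2)] .
  have i: "i < num_psu d" using s by auto
  note [measurable] = r_meas[OF i]
  have n: "0 < size2 d i" "2 \<le> size2 d i" using size2_ge[OF i] by auto
  let ?X = "\<lambda>l \<omega>. r i (pts2 d i l \<omega>)"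
  have indep: "c.indep_vars (\<lambda>_. borel) ?X {..<size2 d i}"
  proof -
    \<comment> \<open>Singleton blocks turn the independent family indexed by pairs into one indexed
      by l alone, with PSU i fixed.\<close>
    have "c.indep_vars (\<lambda>l. Pi\<^sub>M {(i, l)} (\<lambda>_. lebesgue))
       (\<lambda>l \<omega>. \<lambda>p\<in>{(i, l)}. (case p of (i, l) \<Rightarrow> pts2 d i l) \<omega>) {..<size2 d i}"
      using s(3) by (intro c.indep_vars_restrict[OF pts_indep[OF s(2)]]) (auto simp: disjoint_family_on_def)
    moreover have "(\<lambda>v. r i (v (i, l))) \<in> borel_measurable (Pi\<^sub>M {(i, l)} (\<lambda>_. lebesgue))" for l
      by (rule measurable_compose[OF measurable_component_singleton[where M = "\<lambda>_. lebesgue"] r_meas[OF i]]) simp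
    ultimately have "c.indep_vars (\<lambda>_. borel)
       (\<lambda>l \<omega>. r i ((\<lambda>p\<in>{(i, l)}. (case p of (i, l) \<Rightarrow> pts2 d i l) \<omega>) (i, l))) {..<size2 d i}"
      by (rule c.indep_vars_compose2)
    then show ?thesis by simp
  qed
  have int4: "integrable (cond s) (\<lambda>\<omega>. ?X l \<omega> ^ 4)" if "l < size2 d i" for l
    using pts_integrable[OF s that, of "\<lambda>x. r i x ^ 4"] r4_integrable[OF i] by simp
  have mom: "c.expectation (?X l) = (\<integral>x. r i x \<partial>Q i)"
    "c.expectation (\<lambda>\<omega>. (?X l \<omega>)\<^sup>2) = (\<integral>x. (r i x)\<^sup>2 \<partial>Q i)"
    "c.expectation (\<lambda>\<omega>. ?X l \<omega> ^ 4) = fourth i" if "l < size2 d i" for l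
    using pts_expectation[OF s that, of "\<lambda>x. r i x"] pts_expectation[OF s that, of "\<lambda>x. (r i x)\<^sup>2"]
      pts_expectation[OF s that, of "\<lambda>x. r i x ^ 4"] by (simp_all add: fourth_def)
  note p = n(1) indep int4 mom
  show "integral\<^sup>L (cond s) (Y i) = psu_total \<rho> d i"
    unfolding Y_def[abs_def] psu_total_eq[OF i] by (rule c.sample_mean_expectation[OF p])
  show "integrable (cond s) (\<lambda>\<omega>. (Y i \<omega>)\<^sup>2)"
    unfolding Y_def[abs_def] by (rule c.sample_mean_square_integrable[OF p])
  show "integral\<^sup>L (cond s) (\<lambda>\<omega>. (Y i \<omega>)\<^sup>2) = sq i"
    unfolding Y_def[abs_def] sq_def psu_var_eq[OF i] psu_total_eq[OF i] by (rule c.sample_mean_square[OF p])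
  show "integrable (cond s) (\<lambda>\<omega>. ((Y i \<omega>)\<^sup>2)\<^sup>2)"
    using c.sample_mean_power4_integrable[OF p] unfolding Y_def[abs_def] by (simp add: power_mult[symmetric])
  show "integral\<^sup>L (cond s) (\<lambda>\<omega>. ((Y i \<omega>)\<^sup>2)\<^sup>2) \<le> fourth i"
    using c.sample_mean_power4[OF p] unfolding Y_def[abs_def] by (simp add: power_mult[symmetric])
  show "integral\<^sup>L (cond s) (Vh i) = psu_var \<rho> d i"
    unfolding Vh_def[abs_def] psu_var_eq[OF i] psu_total_eq[OF i]
    by (rule c.sample_variance_expectation[OF p n(2)])
  show "integrable (cond s) (\<lambda>\<omega>. (Vh i \<omega>)\<^sup>2)"
    unfolding Vh_def[abs_def] by (rule c.sample_variance_square_integrable[OF p n(2)])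
  show "integral\<^sup>L (cond s) (\<lambda>\<omega>. (Vh i \<omega>)\<^sup>2) \<le> 4 * fourth i / (n2 i)\<^sup>2"
    unfolding Vh_def[abs_def] by (rule c.sample_variance_square[OF p n(2)])
qed

text \<open>The abstract setting is used three times: \<open>Y\<close> for the off-diagonal
  products, \<open>Y2\<close> for the diagonal, which is linear in the squares, and
  \<open>Vh\<close> for \<open>V_B\<close>.\<close>

sublocale Y: cond_indep_variables M "samp1 d" U Y "psu_total \<rho> d" sq
  using Y_meas Y_indep[of _ "\<lambda>x. x"] Y_mean Y2_int Y2_mean by unfold_locales auto

sublocale Y2: cond_indep_variables M "samp1 d" U "\<lambda>i \<omega>. (Y i \<omega>)\<^sup>2" sq fourth
  using Y_meas Y_indep[of _ "\<lambda>x. x\<^sup>2"] Y2_mean Y4_int Y4_le by unfold_locales auto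

sublocale Vh: cond_indep_variables M "samp1 d" U Vh "psu_var \<rho> d" "\<lambda>i. 4 * fourth i / (n2 i)\<^sup>2"
  using Vh_meas Vh_indep Vh_mean Vh2_int Vh2_le by unfold_locales auto

end

section \<open>The variance estimators as weighted sums over all PSUs\<close>

lemma sum_product_split_diagonal:
  fixes h :: "'i \<Rightarrow> 'i \<Rightarrow> real"
  assumes "finite U"
  shows "(\<Sum>i\<in>U. \<Sum>j\<in>U. h i j) = (\<Sum>i\<in>U. h i i) + (\<Sum>(i, j)\<in>{(i, j). i \<in> U \<and> j \<in> U \<and> i \<noteq> j}. h i j)"
proof -
  let ?J = "{(i, j). i \<in> U \<and> j \<in> U \<and> i \<noteq> j}" and ?D = "(\<lambda>i. (i, i)) ` U"
  have "(\<Sum>i\<in>U. \<Sum>j\<in>U. h i j) = (\<Sum>(i, j)\<in>U \<times> U. h i j)"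
    by (simp add: sum.cartesian_product)
  also have "U \<times> U = ?D \<union> ?J" by auto
  also have "(\<Sum>(i, j)\<in>?D \<union> ?J. h i j) = (\<Sum>(i, j)\<in>?D. h i j) + (\<Sum>(i, j)\<in>?J. h i j)"
    using assms by (intro sum.union_disjoint) (auto intro: finite_subset[of _ "U \<times> U"])
  also have "(\<Sum>(i, j)\<in>?D. h i j) = (\<Sum>i\<in>U. h i i)"
    by (subst sum.reindex) (auto simp: inj_on_def)
  finally show ?thesis .
qed

text \<open>Costs a factor 2 but avoids any covariance between the two summands.\<close>

lemma (in prob_space) second_moment_add:
  fixes X Y :: "'a \<Rightarrow> real"
  assumes [measurable]: "X \<in> borel_measurable M" "Y \<in> borel_measurable M"
    and X: "integrable M (\<lambda>\<omega>. (X \<omega>)\<^sup>2)" and Y: "integrable M (\<lambda>\<omega>. (Y \<omega>)\<^sup>2)"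
  shows "integrable M (\<lambda>\<omega>. (X \<omega> + Y \<omega>)\<^sup>2)"
    and "expectation (\<lambda>\<omega>. (X \<omega> + Y \<omega>)\<^sup>2) \<le> 2 * expectation (\<lambda>\<omega>. (X \<omega>)\<^sup>2) + 2 * expectation (\<lambda>\<omega>. (Y \<omega>)\<^sup>2)"
proof -
  have le: "(x + y)\<^sup>2 \<le> 2 * x\<^sup>2 + 2 * y\<^sup>2" for x y :: real
    using zero_le_power2[of "x - y"] by (simp add: power2_diff power2_sum)
  have b: "integrable M (\<lambda>\<omega>. 2 * (X \<omega>)\<^sup>2 + 2 * (Y \<omega>)\<^sup>2)" using X Y by simp
  show i: "integrable M (\<lambda>\<omega>. (X \<omega> + Y \<omega>)\<^sup>2)"
    by (rule Bochner_Integration.integrable_bound[OF b])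
      (simp, rule AE_I2, unfold real_norm_def abs_power2, rule order_trans[OF le abs_ge_self])
  have "expectation (\<lambda>\<omega>. (X \<omega> + Y \<omega>)\<^sup>2) \<le> expectation (\<lambda>\<omega>. 2 * (X \<omega>)\<^sup>2 + 2 * (Y \<omega>)\<^sup>2)"
    using i b le by (intro integral_mono) auto
  then show "expectation (\<lambda>\<omega>. (X \<omega> + Y \<omega>)\<^sup>2) \<le> 2 * expectation (\<lambda>\<omega>. (X \<omega>)\<^sup>2) + 2 * expectation (\<lambda>\<omega>. (Y \<omega>)\<^sup>2)"
    using X Y by simp
qed

context psu_sampling
begin

lemma pi1_eq: "pi1 d i = P {i}"
  by (simp add: pi1_def P_def incl_def[abs_def])

lemma pi12_eq: "pi12 d i j = P {i, j}"
  unfolding pi12_def P_def of_bool_subset_2 by (simp add: incl_def I_def)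

lemma cincl_eq: "cincl d i = cI i"
  by (simp add: fun_eq_iff cincl_def cI_def incl_def I_def pi1_eq)

lemma psu_total_hat_eq:
  assumes "\<omega> \<in> space M" "i \<in> samp1 d \<omega>" "i < num_psu d"
  shows "psu_total_hat \<rho> d i \<omega> = Y i \<omega>"
  unfolding psu_total_hat_def Y_def sum_divide_distrib
  using pts_in_psu[OF assms(1,2)] by (intro sum.cong refl) (simp add: r_def pi2_def)

lemma psu_var_hat_eq:
  assumes "\<omega> \<in> space M" "i \<in> samp1 d \<omega>" "i < num_psu d"
  shows "psu_var_hat \<rho> d i \<omega> = Vh i \<omega>"
  unfolding psu_var_hat_def Vh_def psu_total_hat_eq[OF assms] Y_def
  using pts_in_psu[OF assms(1,2)]
  by (intro arg_cong2[where f = "(*)"] sum.cong refl) (simp add: r_def pi2_def mult_ac)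

lemma sum_samp1:
  assumes "\<omega> \<in> space M"
  shows "(\<Sum>i\<in>samp1 d \<omega>. g i) = (\<Sum>i\<in>U. I i \<omega> * g i)"
proof -
  have "(\<Sum>i\<in>U. I i \<omega> * g i) = (\<Sum>i\<in>U. if i \<in> samp1 d \<omega> then g i else 0)"
    by (intro sum.cong refl) (simp add: I_def)
  also have "\<dots> = (\<Sum>i\<in>U \<inter> samp1 d \<omega>. g i)" by (simp add: sum.inter_restrict)
  also have "U \<inter> samp1 d \<omega> = samp1 d \<omega>" using S_subset[OF assms] by auto
  finally show ?thesis by simp
qed

text \<open>On the diagonal this is (1 - p) / p^2 for a positive inclusion probability p, because
  the second-order probability there is p itself.\<close>

definition wt :: "nat \<Rightarrow> nat \<Rightarrow> real" where
  "wt i j = Delta1 d i j / pi12 d i j / (pi1 d i * pi1 d j)"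

definition pairs :: "(nat \<times> nat) set" where
  "pairs = {(i, j). i \<in> U \<and> j \<in> U \<and> i \<noteq> j}"

lemma R_square: "Y.R i \<omega> * Y.R i \<omega> = Y2.R i \<omega>"
  unfolding Y.R_def Y2.R_def by (simp add: I_def power2_eq_square)

lemma V_HT_A_eq:
  assumes "\<omega> \<in> space M"
  shows "V_HT_A \<rho> d \<omega> = (\<Sum>i\<in>U. wt i i * Y2.R i \<omega>) + (\<Sum>(i, j)\<in>pairs. wt i j * (Y.R i \<omega> * Y.R j \<omega>))"
proof -
  have "V_HT_A \<rho> d \<omega> = (\<Sum>i\<in>samp1 d \<omega>. \<Sum>j\<in>samp1 d \<omega>. wt i j * (Y i \<omega> * Y j \<omega>))"
    unfolding V_HT_A_def
  proof (intro sum.cong refl)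
    fix i j assume "i \<in> samp1 d \<omega>" "j \<in> samp1 d \<omega>"
    then show "Delta1 d i j / pi12 d i j * (psu_total_hat \<rho> d i \<omega> / pi1 d i) * (psu_total_hat \<rho> d j \<omega> / pi1 d j)
      = wt i j * (Y i \<omega> * Y j \<omega>)"
      using psu_total_hat_eq[OF assms] S_subset[OF assms] by (auto simp: wt_def subset_iff)
  qed
  also have "\<dots> = (\<Sum>i\<in>U. \<Sum>j\<in>U. wt i j * (Y.R i \<omega> * Y.R j \<omega>))"
    unfolding sum_samp1[OF assms] sum_distrib_left Y.R_def by (simp add: mult_ac)
  also have "\<dots> = (\<Sum>i\<in>U. wt i i * (Y.R i \<omega> * Y.R i \<omega>)) + (\<Sum>(i, j)\<in>pairs. wt i j * (Y.R i \<omega> * Y.R j \<omega>))"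
    unfolding pairs_def by (rule sum_product_split_diagonal) simp
  finally show ?thesis unfolding R_square .
qed

text \<open>Unbiasedness: the right-hand side is the termwise mean of \<open>V_HT_A_eq\<close>. On
  the diagonal \<open>sq\<close> adds the within-PSU variance to the squared total, and it arrives
  there with weight (1 - p) / p, which is its weight in \<open>V2\<close>. Positivity lets the joint
  probability cancel against the one in \<open>wt\<close>.\<close>

lemma V1_V2_eq:
  assumes pos: "\<And>i. i \<in> U \<Longrightarrow> 0 < P {i}" and pos2: "\<And>i j. i \<in> U \<Longrightarrow> j \<in> U \<Longrightarrow> i \<noteq> j \<Longrightarrow> 0 < P {i, j}"
  shows "V1 \<rho> d + V2 \<rho> d = (\<Sum>i\<in>U. wt i i * (P {i} * sq i))
    + (\<Sum>(i, j)\<in>pairs. wt i j * (P {i, j} * psu_total \<rho> d i * psu_total \<rho> d j))"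
proof -
  let ?t = "psu_total \<rho> d"
  have "V1 \<rho> d = (\<Sum>i\<in>U. Delta1 d i i * (?t i / pi1 d i) * (?t i / pi1 d i))
    + (\<Sum>(i, j)\<in>pairs. Delta1 d i j * (?t i / pi1 d i) * (?t j / pi1 d j))"
    unfolding V1_def pairs_def by (rule sum_product_split_diagonal) simp
  moreover have "(\<Sum>(i, j)\<in>pairs. Delta1 d i j * (?t i / pi1 d i) * (?t j / pi1 d j))
    = (\<Sum>(i, j)\<in>pairs. wt i j * (P {i, j} * ?t i * ?t j))"
    using pos2 by (intro sum.cong refl) (auto simp: pairs_def wt_def pi12_eq less_imp_neq[symmetric])
  moreover have "(\<Sum>i\<in>U. Delta1 d i i * (?t i / pi1 d i) * (?t i / pi1 d i)) + V2 \<rho> d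
    = (\<Sum>i\<in>U. wt i i * (P {i} * sq i))"
    unfolding V2_def sum.distrib[symmetric]
  proof (intro sum.cong refl)
    fix i assume "i \<in> U"
    then have "0 < P {i}" by (rule pos)
    then show "Delta1 d i i * (?t i / pi1 d i) * (?t i / pi1 d i) + (1 - pi1 d i) / pi1 d i * psu_var \<rho> d i
      = wt i i * (P {i} * sq i)"
      by (simp add: wt_def Delta1_def pi1_eq pi12_eq sq_def divide_simps) (simp add: power2_eq_square algebra_simps)
  qed
  ultimately show ?thesis by linarith
qed

lemma V_B_eq:
  assumes "\<omega> \<in> space M"
  shows "V_B \<rho> d \<omega> = (\<Sum>i\<in>U. 1 / P {i} * Vh.R i \<omega>)"
proof -
  have "V_B \<rho> d \<omega> = (\<Sum>i\<in>samp1 d \<omega>. Vh i \<omega> / P {i})"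
    unfolding V_B_def pi1_eq using psu_var_hat_eq[OF assms] S_subset[OF assms]
    by (intro sum.cong refl) auto
  then show ?thesis unfolding sum_samp1[OF assms] Vh.R_def by (simp add: mult_ac)
qed

lemma V3_eq:
  assumes pos: "\<And>i. i \<in> U \<Longrightarrow> 0 < P {i}"
  shows "V3 \<rho> d = (\<Sum>i\<in>U. 1 / P {i} * (P {i} * psu_var \<rho> d i))"
  unfolding V3_def using pos by (intro sum.cong refl) (auto simp: less_imp_neq[symmetric])

lemma R_measurable [measurable]:
  assumes "i \<in> U"
  shows "Y.R i \<in> borel_measurable M" "Y2.R i \<in> borel_measurable M" "Vh.R i \<in> borel_measurable M"
  using Y.R_integrable[OF assms] Y2.R_integrable[OF assms] Vh.R_integrable[OF assms] by auto

lemma diag_measurable: "(\<lambda>\<omega>. \<Sum>i\<in>U. wt i i * Y2.R i \<omega>) \<in> borel_measurable M"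
  using R_measurable by (intro borel_measurable_sum borel_measurable_times) auto

lemma offdiag_measurable: "(\<lambda>\<omega>. \<Sum>(i, j)\<in>pairs. wt i j * (Y.R i \<omega> * Y.R j \<omega>)) \<in> borel_measurable M"
  unfolding case_prod_unfold using R_measurable
  by (intro borel_measurable_sum borel_measurable_times) (auto simp: pairs_def)

lemma V_HT_A_measurable: "V_HT_A \<rho> d \<in> borel_measurable M"
  using borel_measurable_add[OF diag_measurable offdiag_measurable]
  by (subst measurable_cong[OF V_HT_A_eq])

lemma V_B_measurable: "V_B \<rho> d \<in> borel_measurable M"
  using R_measurable by (subst measurable_cong[OF V_B_eq]) (auto intro!: borel_measurable_sum borel_measurable_times)

end

text \<open>
  The constants correspond to the paper's as follows: \<open>a\<close> and \<open>b\<close> are \<open>c\<^sub>I\<^sub>1\<close> and \<open>C\<^sub>I\<^sub>1\<close>,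
  \<open>C2\<close>, \<open>C3\<close> and \<open>C4\<close> are those of (FS2), \<open>e\<close> is \<open>c\<^sub>I\<^sub>2\<close>, while \<open>c\<close> and \<open>l1\<close> are \<open>c\<^sub>1\<close> and \<open>\<lambda>\<^sub>1\<close>
  in (SS1).
\<close>

locale bounded_psu_sampling = psu_sampling F \<rho> d c
  for F :: "'a::euclidean_space set" and \<rho> :: "'a \<Rightarrow> real" and d :: "('w, 'a) design" and c +
  fixes a b C2 C3 C4 e g l1 :: real
  assumes a_pos: "0 < a" and b_pos: "0 < b" and C_pos: "0 < C2" "0 < C3" "0 < C4" and e_pos: "0 < e"
    and l1_pos: "0 < l1"
    and size1: "1 \<le> size1 d" "size1 d \<le> num_psu d"
    and P_lower: "i < num_psu d \<Longrightarrow> a * size1 d / num_psu d \<le> pi1 d i"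
    and P_upper: "i < num_psu d \<Longrightarrow> pi1 d i \<le> b * size1 d / num_psu d"
    and D2: "i < num_psu d \<Longrightarrow> j < num_psu d \<Longrightarrow> distinct [i, j] \<Longrightarrow>
      \<bar>\<integral>\<omega>. cincl d i \<omega> * cincl d j \<omega> \<partial>prob_sp d\<bar> \<le> C2 * size1 d / num_psu d ^ 2"
    and D3: "i < num_psu d \<Longrightarrow> j < num_psu d \<Longrightarrow> k < num_psu d \<Longrightarrow> distinct [i, j, k] \<Longrightarrow>
      \<bar>\<integral>\<omega>. cincl d i \<omega> * cincl d j \<omega> * cincl d k \<omega> \<partial>prob_sp d\<bar> \<le> C3 * size1 d ^ 2 / num_psu d ^ 3"
    and D4: "i < num_psu d \<Longrightarrow> j < num_psu d \<Longrightarrow> k < num_psu d \<Longrightarrow> l < num_psu d \<Longrightarrow>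
      distinct [i, j, k, l] \<Longrightarrow>
      \<bar>\<integral>\<omega>. cincl d i \<omega> * cincl d j \<omega> * cincl d k \<omega> * cincl d l \<omega> \<partial>prob_sp d\<bar>
        \<le> C4 * size1 d ^ 2 / num_psu d ^ 4"
    and P2_lower: "i < num_psu d \<Longrightarrow> j < num_psu d \<Longrightarrow> i \<noteq> j \<Longrightarrow>
      e * size1 d ^ 2 / num_psu d ^ 2 \<le> pi12 d i j"
    and size2_lower: "i < num_psu d \<Longrightarrow> l1 * mean_size2 d \<le> size2 d i"
    and mean_size2_pos: "0 < mean_size2 d"
    and g_pos: "0 \<le> g"
    and fourth_sum: "(\<Sum>i<num_psu d. fourth i) \<le> g ^ 4 / num_psu d ^ 3"
begin

abbreviation N :: real where "N \<equiv> real (num_psu d)"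
abbreviation n :: real where "n \<equiv> real (size1 d)"

lemma n_N: "1 \<le> n" "n \<le> N" "0 < n" "0 < N"
  using size1 by auto

lemma P_pos: "i \<in> U \<Longrightarrow> 0 < P {i}"
  using P_lower[of i] a_pos n_N by (auto simp: pi1_eq intro: less_le_trans[rotated])

lemma P2_pos: "i \<in> U \<Longrightarrow> j \<in> U \<Longrightarrow> i \<noteq> j \<Longrightarrow> 0 < P {i, j}"
  using P2_lower[of i j] e_pos n_N by (auto simp: pi12_eq intro: less_le_trans[rotated])

definition \<mu> :: "nat \<Rightarrow> real" where
  "\<mu> i = sqrt (sqrt (fourth i))"

lemma \<mu>_nonneg: "0 \<le> \<mu> i"
  using fourth_nonneg by (simp add: \<mu>_def)

lemma \<mu>_square: "(\<mu> i)\<^sup>2 = sqrt (fourth i)"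
  using fourth_nonneg by (simp add: \<mu>_def)

lemma \<mu>_moment_2: "(\<Sum>i\<in>U. (\<mu> i)\<^sup>2) \<le> g\<^sup>2 / N"
proof (rule power2_le_imp_le)
  have "(\<Sum>i\<in>U. (\<mu> i)\<^sup>2)\<^sup>2 \<le> N * (\<Sum>i\<in>U. fourth i)"
    using Cauchy_Schwarz_ineq_sum[of "\<lambda>_. 1" "\<lambda>i. (\<mu> i)\<^sup>2" U] fourth_nonneg by (simp add: \<mu>_square)
  also have "\<dots> \<le> N * (g ^ 4 / N ^ 3)" using fourth_sum n_N by (intro mult_left_mono) auto
  also have "\<dots> = (g\<^sup>2 / N)\<^sup>2" using n_N by (simp add: power_divide eval_nat_numeral field_simps)
  finally show "(\<Sum>i\<in>U. (\<mu> i)\<^sup>2)\<^sup>2 \<le> (g\<^sup>2 / N)\<^sup>2" .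
qed (use n_N in simp)

lemma \<mu>_moment_1: "(\<Sum>i\<in>U. \<mu> i) \<le> g"
proof (rule power2_le_imp_le)
  have "(\<Sum>i\<in>U. \<mu> i)\<^sup>2 \<le> N * (\<Sum>i\<in>U. (\<mu> i)\<^sup>2)"
    using Cauchy_Schwarz_ineq_sum[of "\<lambda>_. 1" \<mu> U] by simp
  also have "\<dots> \<le> N * (g\<^sup>2 / N)" using \<mu>_moment_2 n_N by (intro mult_left_mono) auto
  also have "\<dots> = g\<^sup>2" using n_N by simp
  finally show "(\<Sum>i\<in>U. \<mu> i)\<^sup>2 \<le> g\<^sup>2" .
qed (rule g_pos)

lemma Delta_le: "i \<in> U \<Longrightarrow> j \<in> U \<Longrightarrow> i \<noteq> j \<Longrightarrow> \<bar>P {i, j} - P {i} * P {j}\<bar> \<le> C2 * n / N\<^sup>2"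
  using D2[of i j] by (simp add: P_pair cincl_eq)

section \<open>Variances of the diagonal, within-PSU and off-diagonal parts\<close>

text \<open>Squared weights of order N^4 / n^4 meet a sum of order n / N^4, made up of n / N times
  the sum of \<open>fourth\<close> and n / N^2 times the squared sum of
  \<open>(\<mu> i)\<^sup>2\<close>.\<close>

lemma diag_variance:
  shows "integrable M (\<lambda>\<omega>. ((\<Sum>i\<in>U. wt i i * Y2.R i \<omega>) - (\<Sum>i\<in>U. wt i i * (P {i} * sq i)))\<^sup>2)"
    and "expectation (\<lambda>\<omega>. ((\<Sum>i\<in>U. wt i i * Y2.R i \<omega>) - (\<Sum>i\<in>U. wt i i * (P {i} * sq i)))\<^sup>2)
      \<le> (b + C2) * g ^ 4 / a ^ 4 / n ^ 3"
proof -
  have wt: "\<bar>wt i i\<bar> \<le> N\<^sup>2 / (a * n)\<^sup>2" if i: "i \<in> U" for i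
  proof -
    have "wt i i = (1 - P {i}) / (P {i})\<^sup>2"
      using P_pos[OF i] by (simp add: wt_def Delta1_def pi1_eq pi12_eq field_simps power2_eq_square)
    then have "\<bar>wt i i\<bar> \<le> 1 / (P {i})\<^sup>2"
      using P_le_1[of "{i}"] P_nonneg[of "{i}"] by (simp add: abs_mult divide_right_mono)
    also have "\<dots> \<le> 1 / (a * n / N)\<^sup>2"
      using P_lower[of i] i a_pos n_N P_pos[OF i] by (intro divide_left_mono power_mono) (auto simp: pi1_eq)
    finally show ?thesis by (simp add: power_divide)
  qed
  have p: "P {i} \<le> b * n / N" if "i \<in> U" for i using P_upper[of i] that by (simp add: pi1_eq)
  have w: "\<bar>sq i\<bar> \<le> (\<mu> i)\<^sup>2" if "i \<in> U" for i
    using that sq_le sq_nonneg by (simp add: \<mu>_square)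
  have \<delta>0: "0 \<le> C2 * n / N\<^sup>2" using C_pos by simp
  note * = Y2.weighted_sum_variance[where b = "\<lambda>i. wt i i" and \<nu> = "\<lambda>i. (\<mu> i)\<^sup>2", OF wt p Delta_le \<delta>0 w fourth_nonneg]
  show "integrable M (\<lambda>\<omega>. ((\<Sum>i\<in>U. wt i i * Y2.R i \<omega>) - (\<Sum>i\<in>U. wt i i * (P {i} * sq i)))\<^sup>2)"
    by (rule *(1))
  have "b * n / N * (\<Sum>i\<in>U. fourth i) + C2 * n / N\<^sup>2 * (\<Sum>i\<in>U. (\<mu> i)\<^sup>2)\<^sup>2
    \<le> b * n / N * (g ^ 4 / N ^ 3) + C2 * n / N\<^sup>2 * (g\<^sup>2 / N)\<^sup>2"
    using fourth_sum \<mu>_moment_2 b_pos C_pos n_N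
    by (intro add_mono mult_left_mono power_mono) (auto intro!: sum_nonneg)
  also have "\<dots> = (b + C2) * g ^ 4 * n / N ^ 4"
    using n_N by (simp add: field_simps eval_nat_numeral)
  finally have "(N\<^sup>2 / (a * n)\<^sup>2)\<^sup>2 * (b * n / N * (\<Sum>i\<in>U. fourth i) + C2 * n / N\<^sup>2 * (\<Sum>i\<in>U. (\<mu> i)\<^sup>2)\<^sup>2)
    \<le> (N\<^sup>2 / (a * n)\<^sup>2)\<^sup>2 * ((b + C2) * g ^ 4 * n / N ^ 4)" by (intro mult_left_mono) auto
  also have "\<dots> = (b + C2) * g ^ 4 / a ^ 4 / n ^ 3"
    using n_N a_pos by (simp add: field_simps eval_nat_numeral)
  finally show "expectation (\<lambda>\<omega>. ((\<Sum>i\<in>U. wt i i * Y2.R i \<omega>) - (\<Sum>i\<in>U. wt i i * (P {i} * sq i)))\<^sup>2)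
      \<le> (b + C2) * g ^ 4 / a ^ 4 / n ^ 3" using *(2) by linarith
qed

text \<open>The weights are of order N / n, and both the mean and the root mean square of
  \<open>Vh i\<close> are of order \<open>(\<mu> i)\<^sup>2\<close> divided by the average
  second-stage size. The product of N and \<open>mean_size2 d\<close> in the denominator is exactly
  the normalisation of the second claim, however the second-stage sizes grow. The 4 stems from
  \<open>sample_variance_square\<close>.\<close>

lemma V_B_variance:
  shows "integrable M (\<lambda>\<omega>. (V_B \<rho> d \<omega> - V3 \<rho> d)\<^sup>2)"
    and "expectation (\<lambda>\<omega>. (V_B \<rho> d \<omega> - V3 \<rho> d)\<^sup>2)
      \<le> (4 * b + C2) * g ^ 4 / (a * l1)\<^sup>2 / (n * (N * mean_size2 d)\<^sup>2)"
proof -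
  let ?m = "mean_size2 d"
  have lm: "0 < l1 * ?m" using l1_pos mean_size2_pos by simp
  have wt: "\<bar>1 / P {i}\<bar> \<le> N / (a * n)" if i: "i \<in> U" for i
  proof -
    have "1 / P {i} \<le> 1 / (a * n / N)"
      using P_lower[of i] i a_pos n_N P_pos[OF i] by (intro divide_left_mono) (auto simp: pi1_eq)
    then show ?thesis using P_pos[OF i] by simp
  qed
  have p: "P {i} \<le> b * n / N" if "i \<in> U" for i using P_upper[of i] that by (simp add: pi1_eq)
  have w: "\<bar>psu_var \<rho> d i\<bar> \<le> (\<mu> i)\<^sup>2 / (l1 * ?m)" if i: "i \<in> U" for i
  proof -
    have "psu_var \<rho> d i \<le> (\<mu> i)\<^sup>2 / n2 i" using psu_var_le[of i] i by (simp add: \<mu>_square)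
    also have "\<dots> \<le> (\<mu> i)\<^sup>2 / (l1 * ?m)"
      using size2_lower[of i] lm i by (intro divide_left_mono) auto
    finally show ?thesis using psu_var_nonneg[of i] i by simp
  qed
  have v: "0 \<le> 4 * fourth i / (n2 i)\<^sup>2" for i using fourth_nonneg by simp
  have \<delta>0: "0 \<le> C2 * n / N\<^sup>2" using C_pos by simp
  note * = Vh.weighted_sum_variance[where b = "\<lambda>i. 1 / P {i}" and \<nu> = "\<lambda>i. (\<mu> i)\<^sup>2 / (l1 * ?m)", OF wt p Delta_le \<delta>0 w v]
  have eq: "(V_B \<rho> d \<omega> - V3 \<rho> d)\<^sup>2
    = ((\<Sum>i\<in>U. 1 / P {i} * Vh.R i \<omega>) - (\<Sum>i\<in>U. 1 / P {i} * (P {i} * psu_var \<rho> d i)))\<^sup>2" if "\<omega> \<in> space M" for \<omega>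
    using V_B_eq[OF that] V3_eq[OF P_pos] by simp
  have "integrable M (\<lambda>\<omega>. ((\<Sum>i\<in>U. 1 / P {i} * Vh.R i \<omega>) - (\<Sum>i\<in>U. 1 / P {i} * (P {i} * psu_var \<rho> d i)))\<^sup>2)"
    by (rule *(1))
  then show "integrable M (\<lambda>\<omega>. (V_B \<rho> d \<omega> - V3 \<rho> d)\<^sup>2)"
    by (simp only: eq cong: Bochner_Integration.integrable_cong)
  have "(\<Sum>i\<in>U. 4 * fourth i / (n2 i)\<^sup>2) \<le> (\<Sum>i\<in>U. 4 * fourth i / (l1 * ?m)\<^sup>2)"
  proof (intro sum_mono divide_left_mono power_mono)
    fix i assume "i \<in> U"
    then show le: "l1 * ?m \<le> n2 i" using size2_lower[of i] by simp
    with lm show "0 < (n2 i)\<^sup>2 * (l1 * ?m)\<^sup>2"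
      by (intro mult_pos_pos zero_less_power) (use l1_pos mean_size2_pos in linarith)+
  qed (use lm fourth_nonneg in auto)
  also have "\<dots> = 4 / (l1 * ?m)\<^sup>2 * (\<Sum>i\<in>U. fourth i)"
    by (simp add: sum_distrib_left sum_divide_distrib)
  also have "\<dots> \<le> 4 / (l1 * ?m)\<^sup>2 * (g ^ 4 / N ^ 3)" using fourth_sum by (intro mult_left_mono) auto
  finally have s4: "(\<Sum>i\<in>U. 4 * fourth i / (n2 i)\<^sup>2) \<le> 4 / (l1 * ?m)\<^sup>2 * (g ^ 4 / N ^ 3)" .
  have s2: "(\<Sum>i\<in>U. (\<mu> i)\<^sup>2 / (l1 * ?m)) \<le> g\<^sup>2 / N / (l1 * ?m)"
    unfolding sum_divide_distrib[symmetric] using \<mu>_moment_2 lm by (intro divide_right_mono) auto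
  have "b * n / N * (\<Sum>i\<in>U. 4 * fourth i / (n2 i)\<^sup>2) + C2 * n / N\<^sup>2 * (\<Sum>i\<in>U. (\<mu> i)\<^sup>2 / (l1 * ?m))\<^sup>2
    \<le> b * n / N * (4 / (l1 * ?m)\<^sup>2 * (g ^ 4 / N ^ 3)) + C2 * n / N\<^sup>2 * (g\<^sup>2 / N / (l1 * ?m))\<^sup>2"
    using s4 s2 b_pos C_pos n_N lm
    by (intro add_mono mult_left_mono power_mono) (auto intro!: sum_nonneg divide_nonneg_nonneg)
  also have "\<dots> = (4 * b + C2) * g ^ 4 * n / N ^ 4 / (l1 * ?m)\<^sup>2"
    using n_N l1_pos mean_size2_pos by (simp add: field_simps eval_nat_numeral)
  finally have "(N / (a * n))\<^sup>2 * (b * n / N * (\<Sum>i\<in>U. 4 * fourth i / (n2 i)\<^sup>2) + C2 * n / N\<^sup>2 * (\<Sum>i\<in>U. (\<mu> i)\<^sup>2 / (l1 * ?m))\<^sup>2)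
    \<le> (N / (a * n))\<^sup>2 * ((4 * b + C2) * g ^ 4 * n / N ^ 4 / (l1 * ?m)\<^sup>2)" by (intro mult_left_mono) auto
  also have "\<dots> = (4 * b + C2) * g ^ 4 / (a * l1)\<^sup>2 / (n * (N * ?m)\<^sup>2)"
    using n_N a_pos l1_pos mean_size2_pos by (simp add: field_simps eval_nat_numeral)
  finally show "expectation (\<lambda>\<omega>. (V_B \<rho> d \<omega> - V3 \<rho> d)\<^sup>2)
      \<le> (4 * b + C2) * g ^ 4 / (a * l1)\<^sup>2 / (n * (N * mean_size2 d)\<^sup>2)"
    using *(2) by (subst Bochner_Integration.integral_cong[OF refl eq]) auto
qed

text \<open>Constants for the orders n^2 / N^2 and n^3 / N^3 of pair and triple probabilities and
  n^3 / N^4 of the covariance of disjoint pairs. They result from inserting b n / N and the (FS2)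
  bounds into \<open>P_pair_le\<close>, \<open>P_triple_le\<close> and
  \<open>P_quadruple_le\<close>, with lower powers of n raised to the leading one.\<close>

abbreviation (input) K2 where "K2 \<equiv> b\<^sup>2 + C2"
abbreviation (input) K3 where "K3 \<equiv> b ^ 3 + 3 * b * C2 + C3"
abbreviation (input) K4 where "K4 \<equiv> C4 + 4 * b * C3 + 4 * b\<^sup>2 * C2 + C2\<^sup>2"

text \<open>Each overlap class contributes at most order n^3 / N^4: no overlap has this order at
  once, one shared index gains 1 / N on n^3 / N^3 from a sum of squares of \<open>\<mu>\<close>, and
  two shared indices gain 1 / N^2 on n^2 / N^2. The squared weight, of order N^4 / n^6, then leaves
  1 / n^3.\<close>

lemma offdiag_variance:
  shows "integrable M (\<lambda>\<omega>. ((\<Sum>(i, j)\<in>pairs. wt i j * (Y.R i \<omega> * Y.R j \<omega>))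
      - (\<Sum>(i, j)\<in>pairs. wt i j * (P {i, j} * psu_total \<rho> d i * psu_total \<rho> d j)))\<^sup>2)"
    and "expectation (\<lambda>\<omega>. ((\<Sum>(i, j)\<in>pairs. wt i j * (Y.R i \<omega> * Y.R j \<omega>))
      - (\<Sum>(i, j)\<in>pairs. wt i j * (P {i, j} * psu_total \<rho> d i * psu_total \<rho> d j)))\<^sup>2)
      \<le> (C2 / (e * a\<^sup>2))\<^sup>2 * g ^ 4 * (K4 + 4 * (K3 + K2\<^sup>2) + 2 * (K2 + K2\<^sup>2)) / n ^ 3"
proof -
  have wt: "\<bar>wt i j\<bar> \<le> C2 / (e * a\<^sup>2) * (N\<^sup>2 / n ^ 3)" if ij: "i \<in> U" "j \<in> U" "i \<noteq> j" for i j
  proof -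
    have "\<bar>wt i j\<bar> = \<bar>P {i, j} - P {i} * P {j}\<bar> / (P {i, j} * (P {i} * P {j}))"
      using P_nonneg by (simp add: wt_def Delta1_def pi1_eq pi12_eq abs_mult)
    also have "\<dots> \<le> (C2 * n / N\<^sup>2) / (e * n\<^sup>2 / N\<^sup>2 * ((a * n / N) * (a * n / N)))"
    proof (intro frac_le mult_mono Delta_le ij)
      show "e * n\<^sup>2 / N\<^sup>2 \<le> P {i, j}" using P2_lower[of i j] ij by (simp add: pi12_eq)
      show "a * n / N \<le> P {i}" "a * n / N \<le> P {j}" using P_lower[of i] P_lower[of j] ij by (auto simp: pi1_eq)
    qed (use C_pos e_pos a_pos n_N P_nonneg in auto)
    also have "\<dots> = C2 / (e * a\<^sup>2) * (N\<^sup>2 / n ^ 3)"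
      using e_pos a_pos n_N by (simp add: field_simps eval_nat_numeral)
    finally show ?thesis .
  qed
  let ?p = "b * n / N" and ?d2 = "C2 * n / N\<^sup>2" and ?d3 = "C3 * n\<^sup>2 / N ^ 3" and ?d4 = "C4 * n\<^sup>2 / N ^ 4"
  have p: "P {i} \<le> ?p" if "i \<in> U" for i using P_upper[of i] that by (simp add: pi1_eq)
  have d2: "\<bar>expectation (\<lambda>\<omega>. cI i \<omega> * cI j \<omega>)\<bar> \<le> ?d2" if "i \<in> U" "j \<in> U" "i \<noteq> j" for i j
    using D2[of i j] that by (simp add: cincl_eq)
  have d3: "\<bar>expectation (\<lambda>\<omega>. cI i \<omega> * cI j \<omega> * cI k \<omega>)\<bar> \<le> ?d3"
    if "i \<in> U" "j \<in> U" "k \<in> U" "distinct [i, j, k]" for i j k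
    using D3[of i j k] that by (simp add: cincl_eq)
  have d4: "\<bar>expectation (\<lambda>\<omega>. cI i \<omega> * cI j \<omega> * cI k \<omega> * cI l \<omega>)\<bar> \<le> ?d4"
    if "i \<in> U" "j \<in> U" "k \<in> U" "l \<in> U" "distinct [i, j, k, l]" for i j k l
    using D4[of i j k l] that by (simp add: cincl_eq)
  \<comment> \<open>The first two raise exponents because n is at least 1; the last trades a factor
    n for N.\<close>
  have n_pow: "n \<le> n\<^sup>2" "n\<^sup>2 \<le> n ^ 3" "n ^ 4 \<le> n ^ 3 * N"
    using n_N mult_left_mono[OF n_N(2), of "n ^ 3"] by (simp_all add: power2_eq_square power3_eq_cube eval_nat_numeral)
  have n1: "n \<le> n ^ 3" using n_pow by linarith
  have c2: "P {i, j} \<le> K2 * (n\<^sup>2 / N\<^sup>2)" if "i \<in> U" "j \<in> U" "i \<noteq> j" for i j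
  proof -
    have "P {i, j} \<le> ?p\<^sup>2 + ?d2" by (rule P_pair_le[OF p d2 that])
    also have "?d2 \<le> C2 * n\<^sup>2 / N\<^sup>2" using n_pow C_pos by (intro divide_right_mono mult_left_mono) auto
    finally show ?thesis by (simp add: power_mult_distrib power_divide distrib_right add_divide_distrib)
  qed
  have c3: "P {i, j, k} \<le> K3 * (n ^ 3 / N ^ 3)" if "i \<in> U" "j \<in> U" "k \<in> U" "distinct [i, j, k]" for i j k
  proof -
    have "P {i, j, k} \<le> ?p ^ 3 + 3 * ?p * ?d2 + ?d3" by (rule P_triple_le[OF p d2 d3 that])
    also have "\<dots> = (b ^ 3 * n ^ 3 + 3 * b * C2 * n\<^sup>2 + C3 * n\<^sup>2) / N ^ 3"
      using n_N by (simp add: field_simps eval_nat_numeral)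
    also have "\<dots> \<le> (b ^ 3 * n ^ 3 + 3 * b * C2 * n ^ 3 + C3 * n ^ 3) / N ^ 3"
      using n_pow C_pos b_pos by (intro divide_right_mono add_mono mult_left_mono) auto
    finally show ?thesis by (simp add: field_simps)
  qed
  have c4: "\<bar>P {i, j, k, l} - P {i, j} * P {k, l}\<bar> \<le> K4 * (n ^ 3 / N ^ 4)"
    if "i \<in> U" "j \<in> U" "k \<in> U" "l \<in> U" "distinct [i, j, k, l]" for i j k l
  proof -
    have "\<bar>P {i, j, k, l} - P {i, j} * P {k, l}\<bar> \<le> ?d4 + 4 * ?p * ?d3 + 4 * ?p\<^sup>2 * ?d2 + ?d2\<^sup>2"
      by (rule P_quadruple_le[OF p d2 d3 d4 that])
    also have "\<dots> = (C4 * n\<^sup>2 + 4 * b * C3 * n ^ 3 + 4 * b\<^sup>2 * C2 * n ^ 3 + C2\<^sup>2 * n\<^sup>2) / N ^ 4"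
      using n_N by (simp add: field_simps eval_nat_numeral)
    also have "\<dots> \<le> (C4 * n ^ 3 + 4 * b * C3 * n ^ 3 + 4 * b\<^sup>2 * C2 * n ^ 3 + C2\<^sup>2 * n ^ 3) / N ^ 4"
      using n_pow C_pos b_pos by (intro divide_right_mono add_mono mult_left_mono) auto
    finally show ?thesis by (simp add: field_simps)
  qed
  have K_pos: "0 \<le> K2" "0 \<le> K3" "0 \<le> K4" using b_pos C_pos by auto
  have c0: "0 \<le> K2 * (n\<^sup>2 / N\<^sup>2)" "0 \<le> K3 * (n ^ 3 / N ^ 3)" "0 \<le> K4 * (n ^ 3 / N ^ 4)"
    using K_pos by (intro mult_nonneg_nonneg; simp)+
  have w: "\<bar>psu_total \<rho> d i\<bar> \<le> \<mu> i" if "i \<in> U" for i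
    by (rule power2_le_imp_le)
      (use psu_total_square_le[of i] that \<mu>_nonneg[of i] in \<open>auto simp: \<mu>_square\<close>)
  have v: "0 \<le> sq i" "sq i \<le> (\<mu> i)\<^sup>2" if "i \<in> U" for i
    using that sq_le sq_nonneg by (simp_all add: \<mu>_square)
  let ?k2 = "K2 * (n\<^sup>2 / N\<^sup>2)" and ?k3 = "K3 * (n ^ 3 / N ^ 3)" and ?k4 = "K4 * (n ^ 3 / N ^ 4)"
  let ?m1 = "\<Sum>i\<in>U. \<mu> i" and ?m2 = "\<Sum>i\<in>U. (\<mu> i)\<^sup>2" and ?\<alpha> = "C2 / (e * a\<^sup>2) * (N\<^sup>2 / n ^ 3)"
  note * = Y.weighted_pair_sum_variance[where a = wt and \<mu> = \<mu>, OF wt c2 c3 c4 c0 w v, folded pairs_def]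
  show "integrable M (\<lambda>\<omega>. ((\<Sum>(i, j)\<in>pairs. wt i j * (Y.R i \<omega> * Y.R j \<omega>))
      - (\<Sum>(i, j)\<in>pairs. wt i j * (P {i, j} * psu_total \<rho> d i * psu_total \<rho> d j)))\<^sup>2)"
    by (rule *(1))
  \<comment> \<open>The square of a pair probability, of order n^4 / N^4, is absorbed into n^3 / N^3
    because n \<le> N.\<close>
  have k3: "?k3 + ?k2\<^sup>2 \<le> (K3 + K2\<^sup>2) * (n ^ 3 / N ^ 3)"
  proof -
    have "n ^ 4 / N ^ 4 \<le> n ^ 3 * N / N ^ 4" using n_pow by (intro divide_right_mono) auto
    then have "n ^ 4 / N ^ 4 \<le> n ^ 3 / N ^ 3" using n_N by (simp add: eval_nat_numeral)
    then have "K2\<^sup>2 * (n ^ 4 / N ^ 4) \<le> K2\<^sup>2 * (n ^ 3 / N ^ 3)" by (intro mult_left_mono) auto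
    moreover have "?k2\<^sup>2 = K2\<^sup>2 * (n ^ 4 / N ^ 4)"
      unfolding power_mult_distrib by (simp add: power_divide power_mult[symmetric])
    ultimately have "?k2\<^sup>2 \<le> K2\<^sup>2 * (n ^ 3 / N ^ 3)" by (simp only:)
    from add_left_mono[OF this, of ?k3] show ?thesis by (simp only: distrib_right[of K3 "K2\<^sup>2"])
  qed
  have k2: "?k2 + ?k2\<^sup>2 \<le> (K2 + K2\<^sup>2) * (n\<^sup>2 / N\<^sup>2)"
  proof -
    have q: "n\<^sup>2 / N\<^sup>2 \<le> 1" using n_N by (simp add: power_mono)
    have "?k2\<^sup>2 = K2\<^sup>2 * (n\<^sup>2 / N\<^sup>2) * (n\<^sup>2 / N\<^sup>2)" by (simp only: power2_eq_square mult_ac)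
    also have "\<dots> \<le> K2\<^sup>2 * (n\<^sup>2 / N\<^sup>2)" using q by (intro mult_left_le) auto
    finally have "?k2\<^sup>2 \<le> K2\<^sup>2 * (n\<^sup>2 / N\<^sup>2)" .
    from add_left_mono[OF this, of ?k2] show ?thesis by (simp only: distrib_right[of K2 "K2\<^sup>2"])
  qed
  have m0: "0 \<le> ?m1" "0 \<le> ?m2" using \<mu>_nonneg by (auto intro: sum_nonneg)
  have "?k4 * ?m1 ^ 4 + 4 * (?k3 + ?k2\<^sup>2) * ?m2 * ?m1\<^sup>2 + 2 * (?k2 + ?k2\<^sup>2) * ?m2\<^sup>2
    \<le> ?k4 * g ^ 4 + 4 * ((K3 + K2\<^sup>2) * (n ^ 3 / N ^ 3)) * (g\<^sup>2 / N) * g\<^sup>2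
      + 2 * ((K2 + K2\<^sup>2) * (n\<^sup>2 / N\<^sup>2)) * (g\<^sup>2 / N)\<^sup>2"
  proof (intro add_mono)
    show "?k4 * ?m1 ^ 4 \<le> ?k4 * g ^ 4"
      by (intro mult_left_mono power_mono \<mu>_moment_1 m0 c0)
    have k: "0 \<le> ?k3 + ?k2\<^sup>2" "0 \<le> ?k2 + ?k2\<^sup>2" using c0 by (auto intro: add_nonneg_nonneg)
    then have k': "0 \<le> (K3 + K2\<^sup>2) * (n ^ 3 / N ^ 3)" "0 \<le> (K2 + K2\<^sup>2) * (n\<^sup>2 / N\<^sup>2)"
      using k2 k3 by linarith+
    have gN: "0 \<le> g\<^sup>2 / N" by simp
    show "4 * (?k3 + ?k2\<^sup>2) * ?m2 * ?m1\<^sup>2 \<le> 4 * ((K3 + K2\<^sup>2) * (n ^ 3 / N ^ 3)) * (g\<^sup>2 / N) * g\<^sup>2"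
      by (rule mult_mono[OF mult_mono[OF mult_left_mono[OF k3] \<mu>_moment_2 _ m0(2)]
            power_mono[OF \<mu>_moment_1 m0(1)]]) (use k' gN in \<open>simp_all only: mult_nonneg_nonneg zero_le_power2 zero_le_numeral\<close>)
    show "2 * (?k2 + ?k2\<^sup>2) * ?m2\<^sup>2 \<le> 2 * ((K2 + K2\<^sup>2) * (n\<^sup>2 / N\<^sup>2)) * (g\<^sup>2 / N)\<^sup>2"
      by (rule mult_mono[OF mult_left_mono[OF k2] power_mono[OF \<mu>_moment_2 m0(2)]])
        (use k' gN in \<open>simp_all only: mult_nonneg_nonneg zero_le_power2 zero_le_numeral\<close>)
  qed
  also have "\<dots> = g ^ 4 * (K4 * n ^ 3 + 4 * (K3 + K2\<^sup>2) * n ^ 3 + 2 * (K2 + K2\<^sup>2) * n\<^sup>2) / N ^ 4"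
    using n_N by (simp add: divide_simps) algebra
  also have "\<dots> \<le> g ^ 4 * (K4 * n ^ 3 + 4 * (K3 + K2\<^sup>2) * n ^ 3 + 2 * (K2 + K2\<^sup>2) * n ^ 3) / N ^ 4"
    using K_pos n_pow by (intro divide_right_mono mult_left_mono add_mono) auto
  also have "\<dots> = g ^ 4 * (K4 + 4 * (K3 + K2\<^sup>2) + 2 * (K2 + K2\<^sup>2)) * (n ^ 3 / N ^ 4)"
    by (simp only: distrib_right mult.assoc times_divide_eq_right)
  finally have "?\<alpha>\<^sup>2 * (?k4 * ?m1 ^ 4 + 4 * (?k3 + ?k2\<^sup>2) * ?m2 * ?m1\<^sup>2 + 2 * (?k2 + ?k2\<^sup>2) * ?m2\<^sup>2)
    \<le> ?\<alpha>\<^sup>2 * (g ^ 4 * (K4 + 4 * (K3 + K2\<^sup>2) + 2 * (K2 + K2\<^sup>2)) * (n ^ 3 / N ^ 4))"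
    by (intro mult_left_mono) auto
  also have "\<dots> = (C2 / (e * a\<^sup>2))\<^sup>2 * (N\<^sup>2 / n ^ 3)\<^sup>2 * (g ^ 4 * (K4 + 4 * (K3 + K2\<^sup>2) + 2 * (K2 + K2\<^sup>2)) * (n ^ 3 / N ^ 4))"
    by (simp only: power_mult_distrib)
  also have "\<dots> = (C2 / (e * a\<^sup>2))\<^sup>2 * g ^ 4 * (K4 + 4 * (K3 + K2\<^sup>2) + 2 * (K2 + K2\<^sup>2)) * ((N\<^sup>2 / n ^ 3)\<^sup>2 * (n ^ 3 / N ^ 4))"
    by (simp only: mult_ac)
  also have "(N\<^sup>2 / n ^ 3)\<^sup>2 * (n ^ 3 / N ^ 4) = 1 / n ^ 3"
    using n_N by (simp add: field_simps eval_nat_numeral)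
  finally show "expectation (\<lambda>\<omega>. ((\<Sum>(i, j)\<in>pairs. wt i j * (Y.R i \<omega> * Y.R j \<omega>))
      - (\<Sum>(i, j)\<in>pairs. wt i j * (P {i, j} * psu_total \<rho> d i * psu_total \<rho> d j)))\<^sup>2)
      \<le> (C2 / (e * a\<^sup>2))\<^sup>2 * g ^ 4 * (K4 + 4 * (K3 + K2\<^sup>2) + 2 * (K2 + K2\<^sup>2)) / n ^ 3"
    using *(2) by simp
qed

lemma V_HT_A_variance:
  shows "integrable M (\<lambda>\<omega>. (V_HT_A \<rho> d \<omega> - V1 \<rho> d - V2 \<rho> d)\<^sup>2)"
    and "expectation (\<lambda>\<omega>. (V_HT_A \<rho> d \<omega> - V1 \<rho> d - V2 \<rho> d)\<^sup>2)
      \<le> (2 * ((b + C2) * g ^ 4 / a ^ 4)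
        + 2 * ((C2 / (e * a\<^sup>2))\<^sup>2 * g ^ 4 * (K4 + 4 * (K3 + K2\<^sup>2) + 2 * (K2 + K2\<^sup>2)))) / n ^ 3"
proof -
  let ?D = "\<lambda>\<omega>. (\<Sum>i\<in>U. wt i i * Y2.R i \<omega>) - (\<Sum>i\<in>U. wt i i * (P {i} * sq i))"
  let ?O = "\<lambda>\<omega>. (\<Sum>(i, j)\<in>pairs. wt i j * (Y.R i \<omega> * Y.R j \<omega>))
      - (\<Sum>(i, j)\<in>pairs. wt i j * (P {i, j} * psu_total \<rho> d i * psu_total \<rho> d j))"
  have eq: "(V_HT_A \<rho> d \<omega> - V1 \<rho> d - V2 \<rho> d)\<^sup>2 = (?D \<omega> + ?O \<omega>)\<^sup>2" if "\<omega> \<in> space M" for \<omega>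
    using V_HT_A_eq[OF that] V1_V2_eq[OF P_pos P2_pos] by (intro arg_cong[where f = "\<lambda>x. x\<^sup>2"]) linarith
  note * = second_moment_add[OF borel_measurable_diff[OF diag_measurable borel_measurable_const]
      borel_measurable_diff[OF offdiag_measurable borel_measurable_const] diag_variance(1) offdiag_variance(1)]
  show "integrable M (\<lambda>\<omega>. (V_HT_A \<rho> d \<omega> - V1 \<rho> d - V2 \<rho> d)\<^sup>2)"
    by (subst Bochner_Integration.integrable_cong[OF refl eq]) (auto intro: *(1))
  have "expectation (\<lambda>\<omega>. (?D \<omega> + ?O \<omega>)\<^sup>2) \<le> 2 * ((b + C2) * g ^ 4 / a ^ 4 / n ^ 3)
    + 2 * ((C2 / (e * a\<^sup>2))\<^sup>2 * g ^ 4 * (K4 + 4 * (K3 + K2\<^sup>2) + 2 * (K2 + K2\<^sup>2)) / n ^ 3)"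
    using *(2) diag_variance(2) offdiag_variance(2) by linarith
  then show "expectation (\<lambda>\<omega>. (V_HT_A \<rho> d \<omega> - V1 \<rho> d - V2 \<rho> d)\<^sup>2)
      \<le> (2 * ((b + C2) * g ^ 4 / a ^ 4)
        + 2 * ((C2 / (e * a\<^sup>2))\<^sup>2 * g ^ 4 * (K4 + 4 * (K3 + K2\<^sup>2) + 2 * (K2 + K2\<^sup>2)))) / n ^ 3"
    by (simp only: add_divide_distrib times_divide_eq_right eq cong: Bochner_Integration.integral_cong)
qed

end

section \<open>Asymptotics\<close>

lemma mean_square_bigoI:
  assumes "\<And>k. integrable (M k) (\<lambda>\<omega>. (Z k \<omega>)\<^sup>2)"
    and "\<And>k. (\<integral>\<omega>. (Z k \<omega>)\<^sup>2 \<partial>M k) \<le> C * g k" and "\<And>k. 0 \<le> g k"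
  shows "mean_square_bigo M Z g"
  unfolding mean_square_bigo_def using assms by (auto intro!: bigoI[where c = C])

lemma mean_square_scaled:
  assumes "integrable M (\<lambda>\<omega>. (Z \<omega>)\<^sup>2)" and "(\<integral>\<omega>. (Z \<omega>)\<^sup>2 \<partial>M) \<le> B"
  shows "integrable M (\<lambda>\<omega>. (c * Z \<omega>)\<^sup>2)" and "(\<integral>\<omega>. (c * Z \<omega>)\<^sup>2 \<partial>M) \<le> (c :: real)\<^sup>2 * B"
  using assms by (auto simp: power_mult_distrib intro: mult_left_mono)

text \<open>The relative error is the scaled error s (X - v) divided by s v, and s v is at least m.
  A moment bound on the scaled error is therefore enough even if v itself tends to 0.\<close>

lemma (in prob_space) ratio_deviation_le:
  fixes X :: "'a \<Rightarrow> real"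
  assumes [measurable]: "X \<in> borel_measurable M"
    and int: "integrable M (\<lambda>\<omega>. (s * (X \<omega> - v))\<^sup>2)"
    and pos: "0 < \<epsilon>" "0 < m" "0 < s" and v: "m / s \<le> v"
  shows "prob {\<omega> \<in> space M. \<bar>X \<omega> / v - 1\<bar> > \<epsilon>} \<le> expectation (\<lambda>\<omega>. (s * (X \<omega> - v))\<^sup>2) / (\<epsilon> * m)\<^sup>2"
proof -
  have v0: "0 < v" using v pos by (meson divide_pos_pos less_le_trans)
  have sv: "m \<le> s * v" using v pos by (simp add: divide_le_eq mult.commute)
  have "(\<epsilon> * m)\<^sup>2 \<le> (s * (X \<omega> - v))\<^sup>2" if "\<bar>X \<omega> / v - 1\<bar> > \<epsilon>" for \<omega>
  proof -
    have "\<epsilon> * m \<le> \<bar>X \<omega> / v - 1\<bar> * (s * v)" using that sv pos by (intro mult_mono) auto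
    also have "\<dots> = \<bar>(X \<omega> / v - 1) * (s * v)\<bar>" using pos v0 by (simp add: abs_mult)
    also have "(X \<omega> / v - 1) * (s * v) = s * (X \<omega> - v)" using v0 by (simp add: field_simps)
    finally have "\<epsilon> * m \<le> \<bar>s * (X \<omega> - v)\<bar>" .
    then have "(\<epsilon> * m)\<^sup>2 \<le> \<bar>s * (X \<omega> - v)\<bar>\<^sup>2" using pos by (intro power_mono) auto
    then show ?thesis by simp
  qed
  then have "prob {\<omega> \<in> space M. \<bar>X \<omega> / v - 1\<bar> > \<epsilon>} \<le> prob {\<omega> \<in> space M. (s * (X \<omega> - v))\<^sup>2 \<ge> (\<epsilon> * m)\<^sup>2}"
    by (intro finite_measure_mono) auto
  also have "\<dots> \<le> expectation (\<lambda>\<omega>. (s * (X \<omega> - v))\<^sup>2) / (\<epsilon> * m)\<^sup>2"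
    by (rule integral_Markov_inequality_measure[OF int, where A = "{}"]) (use pos in auto)
  finally show ?thesis .
qed

section \<open>Constants that are uniform along the sequence\<close>

text \<open>A common bound on the PSU measures comes out of the sum as a cube, and the partition
  adds up the remaining integrals. With B of order 1 / N this gives the order 1 / N^3 in
  \<open>fourth_sum\<close>.\<close>

lemma (in psu_sampling) sum_fourth_le:
  assumes le: "\<And>i. i < num_psu d \<Longrightarrow> measure lebesgue (psu d i) \<le> B"
  shows "(\<Sum>i<num_psu d. fourth i) \<le> (B / c) ^ 3 * (LINT x:F|lebesgue. \<rho> x ^ 4)"
proof -
  have part: "disjoint_family_on (psu d) U" "(\<Union>i\<in>U. psu d i) = F"
    using design by (auto simp: two_stage_design_def psu_partition_def)
  have nn: "0 \<le> (LINT x:psu d i|lebesgue. \<rho> x ^ 4)" for i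
    unfolding set_lebesgue_integral_def by (intro integral_nonneg_AE AE_I2) (auto split: split_indicator)
  have "(\<Sum>i<num_psu d. fourth i) \<le> (\<Sum>i<num_psu d. (B / c) ^ 3 * (LINT x:psu d i|lebesgue. \<rho> x ^ 4))"
  proof (intro sum_mono)
    fix i assume "i \<in> U"
    then have i: "i < num_psu d" by simp
    have "(measure lebesgue (psu d i) / c) ^ 3 \<le> (B / c) ^ 3"
      using le[OF i] c_pos by (intro power_mono divide_right_mono) auto
    then show "fourth i \<le> (B / c) ^ 3 * (LINT x:psu d i|lebesgue. \<rho> x ^ 4)"
      using fourth_le[OF i] mult_right_mono[OF _ nn] by (meson order_trans)
  qed
  also have "\<dots> = (B / c) ^ 3 * (LINT x:(\<Union>i\<in>U. psu d i)|lebesgue. \<rho> x ^ 4)"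
    using part \<rho>4_psu_int psu_meas by (subst set_integral_finite_Union) (auto simp: sum_distrib_left)
  finally show ?thesis using part by simp
qed

text \<open>Fixes the existential constants of all assumptions once and for all, so that the bounds
  for a single design hold along the sequence with the same constants.\<close>

lemma design_sequence_bounds:
  fixes F :: "'a::euclidean_space set" and D :: "nat \<Rightarrow> ('w, 'a) design"
  assumes F: "F \<in> sets lebesgue" "measure lebesgue F > 0"
    and \<rho>: "set_integrable lebesgue F \<rho>"
    and D: "design_sequence F D" "FS1 D" "FS2 D" "FS3 D" "SS1 F D" and VA1: "VA1 F \<rho>"
  obtains c a b C2 C3 C4 e g l1
  where "\<And>k. bounded_psu_sampling F \<rho> (D k) c a b C2 C3 C4 e g l1" "\<And>k. 1 \<le> mean_size2 (D k)"
proof -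
  let ?A = "measure lebesgue F"
  have design: "two_stage_design F (D k)" for k using D(1) by (simp add: design_sequence_def)
  have N_pos: "0 < num_psu (D k)" for k
  proof (rule ccontr)
    assume "\<not> 0 < num_psu (D k)"
    then have "F = {}" using design[of k] by (auto simp: two_stage_design_def psu_partition_def)
    then show False using F by simp
  qed
  obtain f0 a b where FS1: "f0 < 1" "0 < a" "a \<le> b"
    "\<And>k. real (size1 (D k)) / real (num_psu (D k)) \<le> f0"
    "\<And>k i. i < num_psu (D k) \<Longrightarrow> a \<le> real (num_psu (D k)) / real (size1 (D k)) * pi1 (D k) i"
    "\<And>k i. i < num_psu (D k) \<Longrightarrow> real (num_psu (D k)) / real (size1 (D k)) * pi1 (D k) i \<le> b"
    using D(2) unfolding FS1_def by blast
  obtain C2 C3 C4 where FS2: "0 < C2" "0 < C3" "0 < C4"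
    "\<And>k i j. i < num_psu (D k) \<Longrightarrow> j < num_psu (D k) \<Longrightarrow> distinct [i, j] \<Longrightarrow>
      \<bar>\<integral>\<omega>. cincl (D k) i \<omega> * cincl (D k) j \<omega> \<partial>prob_sp (D k)\<bar>
        \<le> C2 * real (size1 (D k)) / real (num_psu (D k)) ^ 2"
    "\<And>k i j i'. i < num_psu (D k) \<Longrightarrow> j < num_psu (D k) \<Longrightarrow> i' < num_psu (D k) \<Longrightarrow> distinct [i, j, i'] \<Longrightarrow>
      \<bar>\<integral>\<omega>. cincl (D k) i \<omega> * cincl (D k) j \<omega> * cincl (D k) i' \<omega> \<partial>prob_sp (D k)\<bar>
        \<le> C3 * real (size1 (D k)) ^ 2 / real (num_psu (D k)) ^ 3"
    "\<And>k i j i' j'. i < num_psu (D k) \<Longrightarrow> j < num_psu (D k) \<Longrightarrow> i' < num_psu (D k) \<Longrightarrow> j' < num_psu (D k) \<Longrightarrow>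
      distinct [i, j, i', j'] \<Longrightarrow>
      \<bar>\<integral>\<omega>. cincl (D k) i \<omega> * cincl (D k) j \<omega> * cincl (D k) i' \<omega> * cincl (D k) j' \<omega> \<partial>prob_sp (D k)\<bar>
        \<le> C4 * real (size1 (D k)) ^ 2 / real (num_psu (D k)) ^ 4"
  proof (insert D(3)[unfolded FS2_def], elim exE conjE, goal_cases)
    case (1 C2 C3 C4)
    note bounds = spec[OF 1(5)]
    show ?case
      by (rule 1(1)[OF 1(2-4)])
        ((rule bounds[THEN conjunct1, rule_format] bounds[THEN conjunct2, THEN conjunct1, rule_format]
          bounds[THEN conjunct2, THEN conjunct2, rule_format]; assumption)+)
  qed
  obtain e where FS3: "0 < e" "\<And>k i j. i < num_psu (D k) \<Longrightarrow> j < num_psu (D k) \<Longrightarrow> i \<noteq> j \<Longrightarrow>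
      e * real (size1 (D k)) ^ 2 / real (num_psu (D k)) ^ 2 \<le> pi12 (D k) i j"
    using D(4) unfolding FS3_def by blast
  obtain l1 L1 p1 P1 c C where SS1: "0 < l1" "0 < p1" "p1 \<le> P1" "0 < c"
    "\<And>k i. i < num_psu (D k) \<Longrightarrow> l1 * mean_size2 (D k) \<le> real (size2 (D k) i)"
    "\<And>k i. i < num_psu (D k) \<Longrightarrow> p1 * ?A / real (num_psu (D k)) \<le> measure lebesgue (psu (D k) i)"
    "\<And>k i. i < num_psu (D k) \<Longrightarrow> measure lebesgue (psu (D k) i) \<le> P1 * ?A / real (num_psu (D k))"
    "\<And>k i x. i < num_psu (D k) \<Longrightarrow> x \<in> psu (D k) i \<Longrightarrow> c / measure lebesgue (psu (D k) i) \<le> dens2 (D k) i x"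
    "\<And>k i. i < num_psu (D k) \<Longrightarrow> 2 \<le> size2 (D k) i"
    using D(5) unfolding SS1_def by blast
  have \<rho>4: "set_integrable lebesgue F (\<lambda>x. \<rho> x ^ 4)" using VA1 by (simp add: VA1_def)
  define G where "G = (P1 * ?A / c) ^ 3 * (LINT x:F|lebesgue. \<rho> x ^ 4)"
  have "0 \<le> (LINT x:F|lebesgue. \<rho> x ^ 4)"
    unfolding set_lebesgue_integral_def by (intro integral_nonneg_AE AE_I2) (auto split: split_indicator)
  then have G0: "0 \<le> G" unfolding G_def using SS1(2-4) F by (intro mult_nonneg_nonneg) auto
  \<comment> \<open>With the fourth root of G, the sums of \<open>\<mu>\<close> and of its squares
    are bounded by g and by g^2 / N.\<close>
  define g where "g = sqrt (sqrt G)"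
  have "g ^ 4 = ((sqrt (sqrt G))\<^sup>2)\<^sup>2" by (simp only: g_def power_mult[symmetric]) simp
  then have g4: "g ^ 4 = G" using G0 by simp
  \<comment> \<open>If \<open>size1\<close> were 0, the quotient by it in (FS1) would be 0 by
    convention, and the lower bound would read a \<le> 0.\<close>
  have n_pos: "1 \<le> size1 (D k)" for k
    using FS1(5)[OF N_pos[of k]] FS1(2) by (cases "size1 (D k) = 0") auto
  have n_le: "size1 (D k) \<le> num_psu (D k)" for k
  proof -
    have "real (size1 (D k)) / real (num_psu (D k)) \<le> 1" using FS1(1) FS1(4)[of k] by linarith
    then show ?thesis using N_pos[of k] by simp
  qed
  have mean: "1 \<le> mean_size2 (D k)" for k
  proof -
    have "(\<Sum>i<num_psu (D k). 1) \<le> (\<Sum>i<num_psu (D k). real (size2 (D k) i))"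
      using SS1(9) by (intro sum_mono) fastforce
    then show ?thesis unfolding mean_size2_def using N_pos[of k] by simp
  qed
  have "bounded_psu_sampling F \<rho> (D k) c a b C2 C3 C4 e g l1" for k
  proof -
    interpret psu_sampling F \<rho> "D k" c
    proof
      fix i assume i: "i < num_psu (D k)"
      have "0 < p1 * ?A / real (num_psu (D k))" using SS1(2) F N_pos[of k] by simp
      then show "0 < measure lebesgue (psu (D k) i)" using SS1(6)[OF i] by linarith
    qed (use design F \<rho> \<rho>4 SS1 in auto)
    show ?thesis
    proof
      have "(\<Sum>i<num_psu (D k). fourth i) \<le> (P1 * ?A / real (num_psu (D k)) / c) ^ 3 * (LINT x:F|lebesgue. \<rho> x ^ 4)"
        by (rule sum_fourth_le) (rule SS1(7))
      also have "\<dots> = g ^ 4 / real (num_psu (D k)) ^ 3"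
        unfolding g4 G_def by (simp add: power_divide power_mult_distrib mult_ac)
      finally show "(\<Sum>i<num_psu (D k). fourth i) \<le> g ^ 4 / real (num_psu (D k) ^ 3)" by simp
      show "0 < mean_size2 (D k)" using mean[of k] by linarith
      show "a * real (size1 (D k)) / real (num_psu (D k)) \<le> pi1 (D k) i" if "i < num_psu (D k)" for i
        using FS1(5)[OF that] n_pos[of k] N_pos[of k] by (simp add: field_simps)
      show "pi1 (D k) i \<le> b * real (size1 (D k)) / real (num_psu (D k))" if "i < num_psu (D k)" for i
        using FS1(6)[OF that] n_pos[of k] N_pos[of k] by (simp add: field_simps)
      show "0 \<le> g" using G0 by (simp add: g_def)
    qed (use FS1(2,3) FS2 FS3 SS1(1,5) n_pos n_le in auto)
  qed
  then show thesis using mean that by blast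
qed

theorem proposition3:
  fixes F :: "'a::euclidean_space set"
    and \<rho> :: "'a \<Rightarrow> real"
    and D :: "nat \<Rightarrow> ('w, 'a) design"
  assumes "bounded F" and "F \<in> sets lebesgue" and "measure lebesgue F > 0"
    and "set_integrable lebesgue F \<rho>"
    and "design_sequence F D"
    and "FS1 D" and "FS2 D" and "FS3 D" and "SS1 F D" and "VA1 F \<rho>"
  shows "mean_square_bigo (\<lambda>k. prob_sp (D k))
           (\<lambda>k \<omega>. real (size1 (D k)) / (measure lebesgue F)\<^sup>2 *
                  (V_HT_A \<rho> (D k) \<omega> - V1 \<rho> (D k) - V2 \<rho> (D k)))
           (\<lambda>k. 1 / real (size1 (D k))) \<and>
         mean_square_bigo (\<lambda>k. prob_sp (D k))
           (\<lambda>k \<omega>. real (num_psu (D k)) * mean_size2 (D k) / (measure lebesgue F)\<^sup>2 *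
                  (V_B \<rho> (D k) \<omega> - V3 \<rho> (D k)))
           (\<lambda>k. 1 / real (size1 (D k))) \<and>
         (VA2 F \<rho> D \<longrightarrow>
            mean_square_bigo (\<lambda>k. prob_sp (D k))
              (\<lambda>k \<omega>. real (size1 (D k)) / (measure lebesgue F)\<^sup>2 *
                     (V_HT \<rho> (D k) \<omega> - V_total \<rho> (D k)))
              (\<lambda>k. 1 / real (size1 (D k))) \<and>
            tendsto_in_prob (\<lambda>k. prob_sp (D k))
              (\<lambda>k \<omega>. V_HT \<rho> (D k) \<omega> / V_total \<rho> (D k)) 1)"
proof -
  let ?A = "measure lebesgue F" and ?M = "\<lambda>k. prob_sp (D k)"
  let ?n = "\<lambda>k. real (size1 (D k))" and ?N = "\<lambda>k. real (num_psu (D k))" and ?m = "\<lambda>k. mean_size2 (D k)"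
  let ?ZA = "\<lambda>k \<omega>. ?n k / ?A\<^sup>2 * (V_HT_A \<rho> (D k) \<omega> - V1 \<rho> (D k) - V2 \<rho> (D k))"
  let ?ZB = "\<lambda>k \<omega>. ?N k * ?m k / ?A\<^sup>2 * (V_B \<rho> (D k) \<omega> - V3 \<rho> (D k))"
  \<comment> \<open>The error of \<open>V_B\<close> under the smaller normalisation of
    \<open>V_HT_A\<close>. It is \<open>?ZB\<close> times n / (N m), a factor of at most 1 because n
    \<le> N and the average second-stage size m is at least 1.\<close>
  let ?ZC = "\<lambda>k \<omega>. ?n k / ?A\<^sup>2 * (V_B \<rho> (D k) \<omega> - V3 \<rho> (D k))"
  let ?Z = "\<lambda>k \<omega>. ?n k / ?A\<^sup>2 * (V_HT \<rho> (D k) \<omega> - V_total \<rho> (D k))"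
  obtain c a b C2 C3 C4 e g l1 where
    bounded: "\<And>k. bounded_psu_sampling F \<rho> (D k) c a b C2 C3 C4 e g l1" and m1: "\<And>k. 1 \<le> ?m k"
    using design_sequence_bounds[OF assms(2-)] by blast
  \<comment> \<open>\<open>KA\<close> and \<open>KB\<close> are the numerators in
    \<open>V_HT_A_variance\<close> and \<open>V_B_variance\<close>, with the abbreviations
    \<open>K2\<close>, \<open>K3\<close> and \<open>K4\<close> written out.\<close>
  define KA where "KA = 2 * ((b + C2) * g ^ 4 / a ^ 4)
    + 2 * ((C2 / (e * a\<^sup>2))\<^sup>2 * g ^ 4 * (C4 + 4 * b * C3 + 4 * b\<^sup>2 * C2 + C2\<^sup>2
      + 4 * (b ^ 3 + 3 * b * C2 + C3 + (b\<^sup>2 + C2)\<^sup>2) + 2 * (b\<^sup>2 + C2 + (b\<^sup>2 + C2)\<^sup>2)))"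
  define KB where "KB = (4 * b + C2) * g ^ 4 / (a * l1)\<^sup>2"
  have prob: "prob_space (?M k)" for k
  proof -
    interpret bounded_psu_sampling F \<rho> "D k" c a b C2 C3 C4 e g l1 by (rule bounded)
    show ?thesis by (rule prob_space_M)
  qed
  have n_pos: "1 \<le> ?n k" "?n k \<le> ?N k" for k
  proof -
    interpret bounded_psu_sampling F \<rho> "D k" c a b C2 C3 C4 e g l1 by (rule bounded)
    show "1 \<le> ?n k" "?n k \<le> ?N k" using n_N by auto
  qed
  have meas: "V_HT_A \<rho> (D k) \<in> borel_measurable (?M k)" "V_B \<rho> (D k) \<in> borel_measurable (?M k)" for k
  proof -
    interpret bounded_psu_sampling F \<rho> "D k" c a b C2 C3 C4 e g l1 by (rule bounded)
    show "V_HT_A \<rho> (D k) \<in> borel_measurable (?M k)" "V_B \<rho> (D k) \<in> borel_measurable (?M k)"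
      by (rule V_HT_A_measurable, rule V_B_measurable)
  qed
  have A: "integrable (?M k) (\<lambda>\<omega>. (?ZA k \<omega>)\<^sup>2)"
    "(\<integral>\<omega>. (?ZA k \<omega>)\<^sup>2 \<partial>?M k) \<le> KA / ?A ^ 4 * (1 / ?n k)" for k
  proof -
    interpret bounded_psu_sampling F \<rho> "D k" c a b C2 C3 C4 e g l1 by (rule bounded)
    note * = mean_square_scaled[OF V_HT_A_variance, folded KA_def, of "?n k / ?A\<^sup>2"]
    show "integrable (?M k) (\<lambda>\<omega>. (?ZA k \<omega>)\<^sup>2)" by (rule *(1))
    have "(?n k / ?A\<^sup>2)\<^sup>2 * (KA / ?n k ^ 3) = KA / ?A ^ 4 * (1 / ?n k)"
      using n_pos[of k] assms(3) by (simp add: field_simps eval_nat_numeral)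
    then show "(\<integral>\<omega>. (?ZA k \<omega>)\<^sup>2 \<partial>?M k) \<le> KA / ?A ^ 4 * (1 / ?n k)" using *(2) by simp
  qed
  have B: "integrable (?M k) (\<lambda>\<omega>. (?ZB k \<omega>)\<^sup>2)"
    "(\<integral>\<omega>. (?ZB k \<omega>)\<^sup>2 \<partial>?M k) \<le> KB / ?A ^ 4 * (1 / ?n k)" for k
  proof -
    interpret bounded_psu_sampling F \<rho> "D k" c a b C2 C3 C4 e g l1 by (rule bounded)
    note * = mean_square_scaled[OF V_B_variance, folded KB_def, of "?N k * ?m k / ?A\<^sup>2"]
    show "integrable (?M k) (\<lambda>\<omega>. (?ZB k \<omega>)\<^sup>2)" by (rule *(1))
    have "(?N k * ?m k / ?A\<^sup>2)\<^sup>2 * (KB / (?n k * (?N k * ?m k)\<^sup>2)) = KB / ?A ^ 4 * (1 / ?n k)"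
      using n_N mean_size2_pos assms(3) by (simp add: field_simps eval_nat_numeral)
    then show "(\<integral>\<omega>. (?ZB k \<omega>)\<^sup>2 \<partial>?M k) \<le> KB / ?A ^ 4 * (1 / ?n k)" using *(2) by simp
  qed
  have C: "integrable (?M k) (\<lambda>\<omega>. (?ZC k \<omega>)\<^sup>2)"
    "(\<integral>\<omega>. (?ZC k \<omega>)\<^sup>2 \<partial>?M k) \<le> KB / ?A ^ 4 * (1 / ?n k)" for k
  proof -
    let ?q = "?n k / (?N k * ?m k)"
    have Nm: "0 < ?N k * ?m k" "?n k \<le> ?N k * ?m k"
      using n_pos[of k] m1[of k] mult_mono[of "?n k" "?N k" 1 "?m k"] by auto
    have cancel: "s / t * y = s / x * (x / t * y)" if "0 < x" for s t x y :: real
      using that by simp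
    have eq: "?ZC k \<omega> = ?q * ?ZB k \<omega>" for \<omega>
      by (rule cancel[OF Nm(1)])
    note * = mean_square_scaled[OF B, of k ?q, folded eq]
    show "integrable (?M k) (\<lambda>\<omega>. (?ZC k \<omega>)\<^sup>2)" by (rule *(1))
    have "?q \<le> 1" "0 \<le> ?q" using Nm by auto
    then have "?q\<^sup>2 \<le> 1" by (simp add: power_le_one)
    \<comment> \<open>The sign is read off the bound itself, which dominates the integral of a
      square.\<close>
    moreover have "0 \<le> KB / ?A ^ 4 * (1 / ?n k)"
      using B(2)[of k] by (rule order_trans[rotated]) simp
    ultimately have "?q\<^sup>2 * (KB / ?A ^ 4 * (1 / ?n k)) \<le> KB / ?A ^ 4 * (1 / ?n k)"
      by (intro mult_left_le_one_le) auto
    then show "(\<integral>\<omega>. (?ZC k \<omega>)\<^sup>2 \<partial>?M k) \<le> KB / ?A ^ 4 * (1 / ?n k)" using *(2) by linarith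
  qed
  have Z: "integrable (?M k) (\<lambda>\<omega>. (?Z k \<omega>)\<^sup>2)"
    "(\<integral>\<omega>. (?Z k \<omega>)\<^sup>2 \<partial>?M k) \<le> 2 * (KA + KB) / ?A ^ 4 * (1 / ?n k)" for k
  proof -
    interpret prob_space "?M k" by (rule prob)
    have eq: "?Z k \<omega> = ?ZA k \<omega> + ?ZC k \<omega>" for \<omega>
      by (simp only: distrib_left[symmetric]) (simp add: V_HT_def V_total_def)
    have m: "?ZA k \<in> borel_measurable (?M k)" "?ZC k \<in> borel_measurable (?M k)"
      using meas[of k] by measurable
    note * = second_moment_add[OF m A(1) C(1), folded eq]
    show "integrable (?M k) (\<lambda>\<omega>. (?Z k \<omega>)\<^sup>2)" by (rule *(1))
    have "2 * (KA + KB) / ?A ^ 4 * (1 / ?n k) = 2 * (KA / ?A ^ 4 * (1 / ?n k)) + 2 * (KB / ?A ^ 4 * (1 / ?n k))"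
      by (simp add: algebra_simps add_divide_distrib)
    then show "(\<integral>\<omega>. (?Z k \<omega>)\<^sup>2 \<partial>?M k) \<le> 2 * (KA + KB) / ?A ^ 4 * (1 / ?n k)"
      using *(2) A(2)[of k] C(2)[of k] by linarith
  qed
  have bigo: "mean_square_bigo ?M ?ZA (\<lambda>k. 1 / ?n k)" "mean_square_bigo ?M ?ZB (\<lambda>k. 1 / ?n k)"
    "mean_square_bigo ?M ?Z (\<lambda>k. 1 / ?n k)"
    by (rule mean_square_bigoI, rule A, rule A, simp,
        rule mean_square_bigoI, rule B, rule B, simp,
        rule mean_square_bigoI, rule Z, rule Z, simp)
  have "tendsto_in_prob ?M (\<lambda>k \<omega>. V_HT \<rho> (D k) \<omega> / V_total \<rho> (D k)) 1" if VA2: "VA2 F \<rho> D"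
  proof -
    obtain m2 where m2: "0 < m2" "\<And>k. m2 \<le> ?n k * V1 \<rho> (D k) / ?A\<^sup>2"
      using VA2 unfolding VA2_def by blast
    \<comment> \<open>\<open>V2\<close> and \<open>V3\<close> are nonnegative, so (VA2) bounds the
      total variance from below by a positive multiple of 1 / n; in particular the ratio never
      divides by zero.\<close>
    have V: "m2 / (?n k / ?A\<^sup>2) \<le> V_total \<rho> (D k)" for k
    proof -
      interpret bounded_psu_sampling F \<rho> "D k" c a b C2 C3 C4 e g l1 by (rule bounded)
      have "0 \<le> V2 \<rho> (D k)" unfolding V2_def
        using psu_var_nonneg P_le_1 P_nonneg by (intro sum_nonneg mult_nonneg_nonneg divide_nonneg_nonneg) (auto simp: pi1_eq)
      moreover have "0 \<le> V3 \<rho> (D k)" unfolding V3_def using psu_var_nonneg by (intro sum_nonneg) auto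
      moreover have "m2 / (?n k / ?A\<^sup>2) \<le> V1 \<rho> (D k)"
        using m2(2)[of k] n_pos[of k] assms(3) by (simp add: field_simps)
      ultimately show ?thesis unfolding V_total_def by linarith
    qed
    have HT: "V_HT \<rho> (D k) \<in> borel_measurable (?M k)" for k
      unfolding V_HT_def[abs_def] using meas[of k] by measurable
    have "(\<lambda>k. measure (?M k) {\<omega> \<in> space (?M k). \<bar>V_HT \<rho> (D k) \<omega> / V_total \<rho> (D k) - 1\<bar> > \<epsilon>}) \<longlonglongrightarrow> 0"
      if \<epsilon>: "0 < \<epsilon>" for \<epsilon>
    proof (rule tendsto_sandwich[OF _ _ tendsto_const])
      let ?u = "\<lambda>k. 2 * (KA + KB) / ?A ^ 4 * (1 / ?n k) / (\<epsilon> * m2)\<^sup>2"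
      show "\<forall>\<^sub>F k in sequentially. measure (?M k) {\<omega> \<in> space (?M k). \<bar>V_HT \<rho> (D k) \<omega> / V_total \<rho> (D k) - 1\<bar> > \<epsilon>} \<le> ?u k"
      proof (intro always_eventually allI)
        fix k
        interpret prob_space "?M k" by (rule prob)
        have "0 < ?n k / ?A\<^sup>2" using n_pos[of k] assms(3) by simp
        from ratio_deviation_le[OF HT Z(1) \<epsilon> m2(1) this V]
        show "measure (?M k) {\<omega> \<in> space (?M k). \<bar>V_HT \<rho> (D k) \<omega> / V_total \<rho> (D k) - 1\<bar> > \<epsilon>} \<le> ?u k"
          by (rule order_trans) (intro divide_right_mono Z(2), simp)
      qed
      have "filterlim (\<lambda>k. ?n k) at_top sequentially"
        using assms(5) filterlim_compose[OF filterlim_real_sequentially] unfolding design_sequence_def by blast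
      then have "(\<lambda>k. 1 / ?n k) \<longlonglongrightarrow> 0"
        by (intro tendsto_divide_0[OF tendsto_const] filterlim_at_top_imp_at_infinity)
      then show "?u \<longlonglongrightarrow> 0"
        by (rule tendsto_divide_zero[OF tendsto_mult_right_zero])
    qed (auto intro!: always_eventually)
    then show ?thesis unfolding tendsto_in_prob_def using HT by (auto intro!: borel_measurable_divide)
  qed
  then show ?thesis using bigo by blast
qed

end
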